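(* The functor $[1_\blacktriangleright,-]$ gives the coreflection of $\mathbf{fpMlt}$ in $\mathbf{fpSeq}$, i.e. it takes values in $\mathbf{fpSeq}$ and is right adjoint to the inclusion $\mathbf{fpSeq}\to\mathbf{fpMlt}$. Thus, the preadditive categories are exactly (up to isomorphism) those of the form $\mathbf{cMon}(\mathcal M)$, for a cartesian multicategory $\mathcal M$.
   Context: A cartesian structure on a multicategory $\mathcal M$ assigns, to every mapping $\sigma:\{1,\dots,n\}\to\{1,\dots,m\}$ and sequences of objects $A_1,\dots,A_n$ and $B_1,\dots,B_m$ with $B_{\sigma i}=A_i$, and every object $C$, a mapping $f\mapsto\sigma f$, $\mathcal M(A_1,\dots,A_n;C)\to\mathcal M(B_1,\dots,B_m;C)$, functorially ($\mathrm{id}f=f$, $\rho(\sigma f)=(\rho\sigma)f$) and compatibly with composition: (i) $f(\sigma_1f_1,\dots,\sigma_nf_n)=(\sigma_1+\cdots+\sigma_n)f(f_1,\dots,f_n)$, where $+$ is juxtaposition of mappings; (ii) $(\sigma f)(f_1,\dots,f_m)=\sigma'\big(f(f_{\sigma1},\dots,f_{\sigma n})\big)$, where $\sigma'$ maps the $k$-th place of the $i$-th block (the domain of $f_{\sigma i}$) to the $k$-th place of the $(\sigma i)$-th block of the concatenated domains of $f_1,\dots,f_m$. A symmetric structure is the same with only bijective $\sigma$. $\mathbf{fpMlt}$ is the category of cartesian multicategories and functors preserving the actions. For a category $\mathcal C$, $\mathcal C_\blacktriangleright$ is the multicategory with the objects of $\mathcal C$ and $\mathcal C_\blacktriangleright(X_1,\dots,X_n;X)=\mathcal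 C(X_1;X)\times\cdots\times\mathcal C(X_n;X)$, with composition $\langle f_1,\dots,f_n\rangle(\langle g_{11},\dots,g_{1m_1}\rangle,\dots,\langle g_{n1},\dots,g_{nm_n}\rangle)=\langle f_1g_{11},\dots,f_1g_{1m_1},\dots,f_ng_{n1},\dots,f_ng_{nm_n}\rangle$. A multicategory is sequential if it is isomorphic to some $\mathcal C_\blacktriangleright$; $\mathbf{fpSeq}\subset\mathbf{fpMlt}$ is the full subcategory of sequential cartesian multicategories. $1_\blacktriangleright$ ($1$ the terminal category) is the terminal symmetric multicategory. For a cartesian multicategory $\mathcal M$, $[1_\blacktriangleright,\mathcal M]$ is the multicategory whose objects are the symmetric functors $M:1_\blacktriangleright\to\mathcal M$, i.e. commutative monoids in $\mathcal M$ (an object $A$ with structure arrows $m_A^n:A,\dots,A\to A$, the images of the unique $n$-ary arrows), and whose arrows $M_1,\dots,M_n\to M$ are the arrows $\alpha:A_1,\dots,A_n\to A$ of $\mathcal M$ between underlying objects with $m^k_A(\alpha,\dots,\alpha)=\tau\,\alpha(m^k_{A_1},\dots,m^k_{A_n})$ for all $k\ge0$, $\tau$ being the evident permutation; its composition and cartesian structure are those of $\mathcal M$. $\mathbf{cMon}(\mathcal M)$ is the category of unary arrows of $[1_\blacktriangleright,\mathcal M]$, i.e. commutative monoids and monoid morphisms. Preadditive category means a category enriched in commutative monoids. $\mathbf{cMon}(\mathcal M)$ is preadditive, the sum of monoid morphisms $f_1,\dots,f_n:M\to N$ (on underlying objects $A$ and $B$) being $\gamma_n\big(m^n_B(f_1,\dots,f_n)\big)$,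 where $\gamma_n:\mathcal M(A,\dots,A;B)\to\mathcal M(A;B)$ is the action of the map $\{1,\dots,n\}\to\{1\}$. *)

theory Defs
  imports "HOL-Algebra.Group" "HOL-Library.FuncSet"
begin

section \<open>Categories and preadditive categories\<close>

record ('o, 'a) cat =
  cobj :: "'o set"
  carr :: "'a set"
  csrc :: "'a \<Rightarrow> 'o"
  ctgt :: "'a \<Rightarrow> 'o"
  cid :: "'o \<Rightarrow> 'a"
  ccomp :: "'a \<Rightarrow> 'a \<Rightarrow> 'a"  \<comment> \<open>\<open>ccomp C g f\<close> is g after f\<close>

definition chom :: "('o, 'a, 'c) cat_scheme \<Rightarrow> 'o \<Rightarrow> 'o \<Rightarrow> 'a set" where
  "chom C X Y = {f \<in> carr C. csrc C f = X \<and> ctgt C f = Y}"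

locale category =
  fixes C :: "('o, 'a, 'c) cat_scheme"
  assumes src_closed: "f \<in> carr C \<Longrightarrow> csrc C f \<in> cobj C"
    and tgt_closed: "f \<in> carr C \<Longrightarrow> ctgt C f \<in> cobj C"
    and id_hom: "X \<in> cobj C \<Longrightarrow> cid C X \<in> chom C X X"
    and comp_hom: "\<lbrakk>f \<in> chom C X Y; g \<in> chom C Y Z\<rbrakk> \<Longrightarrow> ccomp C g f \<in> chom C X Z"
    and comp_id: "f \<in> chom C X Y \<Longrightarrow> ccomp C f (cid C X) = f"
    and id_comp: "f \<in> chom C X Y \<Longrightarrow> ccomp C (cid C Y) f = f"
    and comp_assoc: "\<lbrakk>f \<in> chom C X Y; g \<in> chom C Y Z; h \<in> chom C Z W\<rbrakk>
           \<Longrightarrow> ccomp C (ccomp C h g) f = ccomp C h (ccomp C g f)"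

record ('o, 'a) preadd_cat = "('o, 'a) cat" +
  czero :: "'o \<Rightarrow> 'o \<Rightarrow> 'a"
  cadd :: "'a \<Rightarrow> 'a \<Rightarrow> 'a"

locale preadditive_category = category C
  for C :: "('o, 'a, 'c) preadd_cat_scheme" +
  assumes hom_comm_monoid: "\<lbrakk>X \<in> cobj C; Y \<in> cobj C\<rbrakk>
      \<Longrightarrow> comm_monoid \<lparr>carrier = chom C X Y, monoid.mult = cadd C, one = czero C X Y\<rparr>"
    and comp_add_left: "\<lbrakk>f \<in> chom C X Y; g \<in> chom C X Y; h \<in> chom C Y Z\<rbrakk>
      \<Longrightarrow> ccomp C h (cadd C f g) = cadd C (ccomp C h f) (ccomp C h g)"
    and comp_add_right: "\<lbrakk>h \<in> chom C X Y; f \<in> chom C Y Z; g \<in> chom C Y Z\<rbrakk>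
      \<Longrightarrow> ccomp C (cadd C f g) h = cadd C (ccomp C f h) (ccomp C g h)"
    and comp_zero_left: "\<lbrakk>X \<in> cobj C; h \<in> chom C Y Z\<rbrakk>
      \<Longrightarrow> ccomp C h (czero C X Y) = czero C X Z"
    and comp_zero_right: "\<lbrakk>h \<in> chom C X Y; Z \<in> cobj C\<rbrakk>
      \<Longrightarrow> ccomp C (czero C Y Z) h = czero C X Z"

text \<open>The data of a functor, used both for categories and for multicategories. Functors are
  required to be extensional, so that equality of functors is equality in HOL.\<close>

record ('o, 'a, 'p, 'b) fctr =
  fobj :: "'o \<Rightarrow> 'p"
  farr :: "'a \<Rightarrow> 'b"

definition additive_functor ::
  "('o, 'a, 'c) preadd_cat_scheme \<Rightarrow> ('p, 'b, 'd) preadd_cat_scheme \<Rightarrow> ('o, 'a, 'p, 'b) fctr \<Rightarrow> bool"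
where
  "additive_functor C D F \<longleftrightarrow>
     fobj F \<in> cobj C \<rightarrow>\<^sub>E cobj D \<and>
     farr F \<in> carr C \<rightarrow>\<^sub>E carr D \<and>
     (\<forall>f\<in>carr C. csrc D (farr F f) = fobj F (csrc C f) \<and> ctgt D (farr F f) = fobj F (ctgt C f)) \<and>
     (\<forall>X\<in>cobj C. farr F (cid C X) = cid D (fobj F X)) \<and>
     (\<forall>X Y Z. \<forall>f\<in>chom C X Y. \<forall>g\<in>chom C Y Z.
        farr F (ccomp C g f) = ccomp D (farr F g) (farr F f)) \<and>
     (\<forall>X\<in>cobj C. \<forall>Y\<in>cobj C. farr F (czero C X Y) = czero D (fobj F X) (fobj F Y)) \<and>
     (\<forall>X Y. \<forall>f\<in>chom C X Y. \<forall>g\<in>chom C X Y.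
        farr F (cadd C f g) = cadd D (farr F f) (farr F g))"

definition preadd_isomorphic ::
  "('o, 'a, 'c) preadd_cat_scheme \<Rightarrow> ('p, 'b, 'd) preadd_cat_scheme \<Rightarrow> bool"
where
  "preadd_isomorphic C D \<longleftrightarrow>
     (\<exists>F G. additive_functor C D F \<and> additive_functor D C G \<and>
        (\<forall>X\<in>cobj C. fobj G (fobj F X) = X) \<and> (\<forall>f\<in>carr C. farr G (farr F f) = f) \<and>
        (\<forall>Y\<in>cobj D. fobj F (fobj G Y) = Y) \<and> (\<forall>g\<in>carr D. farr F (farr G g) = g))"


section \<open>Multicategories\<close>


record ('o, 'a) multicat =
  mobj :: "'o set"
  marr :: "'a set"
  msrc :: "'a \<Rightarrow> 'o list"
  mtgt :: "'a \<Rightarrow> 'o"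
  mid :: "'o \<Rightarrow> 'a"
  mcomp :: "'a \<Rightarrow> 'a list \<Rightarrow> 'a"

definition composable :: "('o, 'a, 'm) multicat_scheme \<Rightarrow> 'a \<Rightarrow> 'a list \<Rightarrow> bool" where
  "composable M f gs \<longleftrightarrow> f \<in> marr M \<and> set gs \<subseteq> marr M \<and> map (mtgt M) gs = msrc M f"

locale multicategory =
  fixes M :: "('o, 'a, 'm) multicat_scheme"
  assumes src_closed: "f \<in> marr M \<Longrightarrow> set (msrc M f) \<subseteq> mobj M"
    and tgt_closed: "f \<in> marr M \<Longrightarrow> mtgt M f \<in> mobj M"
    and id_closed: "X \<in> mobj M \<Longrightarrow> mid M X \<in> marr M"
    and id_src: "X \<in> mobj M \<Longrightarrow> msrc M (mid M X) = [X]"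
    and id_tgt: "X \<in> mobj M \<Longrightarrow> mtgt M (mid M X) = X"
    and comp_closed: "composable M f gs \<Longrightarrow> mcomp M f gs \<in> marr M"
    and comp_src: "composable M f gs \<Longrightarrow> msrc M (mcomp M f gs) = concat (map (msrc M) gs)"
    and comp_tgt: "composable M f gs \<Longrightarrow> mtgt M (mcomp M f gs) = mtgt M f"
    and comp_id: "f \<in> marr M \<Longrightarrow> mcomp M f (map (mid M) (msrc M f)) = f"
    and id_comp: "f \<in> marr M \<Longrightarrow> mcomp M (mid M (mtgt M f)) [f] = f"
    and comp_assoc: "\<lbrakk>composable M f gs; list_all2 (composable M) gs hss\<rbrakk>
      \<Longrightarrow> mcomp M f (map2 (mcomp M) gs hss) = mcomp M (mcomp M f gs) (concat hss)"

definition multifunctor ::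
  "('o, 'a, 'm) multicat_scheme \<Rightarrow> ('p, 'b, 'n) multicat_scheme \<Rightarrow> ('o, 'a, 'p, 'b) fctr \<Rightarrow> bool"
where
  "multifunctor M N F \<longleftrightarrow>
     fobj F \<in> mobj M \<rightarrow>\<^sub>E mobj N \<and>
     farr F \<in> marr M \<rightarrow>\<^sub>E marr N \<and>
     (\<forall>f\<in>marr M. msrc N (farr F f) = map (fobj F) (msrc M f) \<and>
        mtgt N (farr F f) = fobj F (mtgt M f)) \<and>
     (\<forall>X\<in>mobj M. farr F (mid M X) = mid N (fobj F X)) \<and>
     (\<forall>f gs. composable M f gs \<longrightarrow>
        farr F (mcomp M f gs) = mcomp N (farr F f) (map (farr F) gs))"

definition id_fctr :: "('o, 'a, 'm) multicat_scheme \<Rightarrow> ('o, 'a, 'o, 'a) fctr" where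
  "id_fctr M = \<lparr>fobj = restrict id (mobj M), farr = restrict id (marr M)\<rparr>"

text \<open>\<open>comp_fctr M G F\<close> is \<open>G\<close> after \<open>F\<close>, where \<open>M\<close> is the domain of \<open>F\<close>.\<close>

definition comp_fctr ::
  "('o, 'a, 'm) multicat_scheme \<Rightarrow> ('p, 'b, 'q, 'c) fctr \<Rightarrow> ('o, 'a, 'p, 'b) fctr
     \<Rightarrow> ('o, 'a, 'q, 'c) fctr"
where
  "comp_fctr M G F =
     \<lparr>fobj = compose (mobj M) (fobj G) (fobj F), farr = compose (marr M) (farr G) (farr F)\<rparr>"

definition multicat_isomorphic ::
  "('o, 'a, 'm) multicat_scheme \<Rightarrow> ('p, 'b, 'n) multicat_scheme \<Rightarrow> bool"
where
  "multicat_isomorphic M N \<longleftrightarrow>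
     (\<exists>F G. multifunctor M N F \<and> multifunctor N M G \<and>
        comp_fctr M G F = id_fctr M \<and> comp_fctr N F G = id_fctr N)"


section \<open>Symmetric and cartesian structures\<close>

text \<open>A mapping from an n-element to an m-element set of places is the list
  (of length n, with entries below m) of its values; places are counted from 0.
  \<open>mact M \<sigma> Bs f\<close> is the action of \<open>\<sigma>\<close> on \<open>f\<close>, with result an arrow with source \<open>Bs\<close>.\<close>

record ('o, 'a) act_multicat = "('o, 'a) multicat" +
  mact :: "nat list \<Rightarrow> 'o list \<Rightarrow> 'a \<Rightarrow> 'a"

definition reindexes :: "nat list \<Rightarrow> 'o list \<Rightarrow> 'o list \<Rightarrow> bool" where
  "reindexes \<sigma> As Bs \<longleftrightarrow> set \<sigma> \<subseteq> {..<length Bs} \<and> map ((!) Bs) \<sigma> = As"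

definition actable :: "('o, 'a, 'm) multicat_scheme \<Rightarrow> nat list \<Rightarrow> 'o list \<Rightarrow> 'a \<Rightarrow> bool" where
  "actable M \<sigma> Bs f \<longleftrightarrow> f \<in> marr M \<and> set Bs \<subseteq> mobj M \<and> reindexes \<sigma> (msrc M f) Bs"

definition bijective_map :: "nat list \<Rightarrow> nat \<Rightarrow> bool" where
  "bijective_map \<sigma> m \<longleftrightarrow> bij_betw ((!) \<sigma>) {..<length \<sigma>} {..<m}"

text \<open>Juxtaposition of a list of mappings, each paired with the size of its codomain.\<close>

fun juxtapose :: "(nat list \<times> nat) list \<Rightarrow> nat list" where
  "juxtapose [] = []"
| "juxtapose ((\<sigma>, m) # ss) = \<sigma> @ map ((+) m) (juxtapose ss)"

text \<open>For \<open>\<sigma>\<close> with codomain of size \<open>length ls\<close>: the mapping from the concatenation of blocks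
  of sizes \<open>ls ! (\<sigma> ! i)\<close> to the concatenation of blocks of sizes \<open>ls ! j\<close>, taking the k-th place
  of the i-th block to the k-th place of the \<open>\<sigma> ! i\<close>-th block.\<close>

definition block_map :: "nat list \<Rightarrow> nat list \<Rightarrow> nat list" where
  "block_map \<sigma> ls = concat (map (\<lambda>j. map (\<lambda>k. sum_list (take j ls) + k) [0..<ls ! j]) \<sigma>)"

locale cartesian_multicategory = multicategory M
  for M :: "('o, 'a, 'm) act_multicat_scheme" +
  assumes act_closed: "actable M \<sigma> Bs f \<Longrightarrow> mact M \<sigma> Bs f \<in> marr M"
    and act_src: "actable M \<sigma> Bs f \<Longrightarrow> msrc M (mact M \<sigma> Bs f) = Bs"
    and act_tgt: "actable M \<sigma> Bs f \<Longrightarrow> mtgt M (mact M \<sigma> Bs f) = mtgt M f"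
    and act_id: "f \<in> marr M \<Longrightarrow> mact M [0..<length (msrc M f)] (msrc M f) f = f"
    and act_act: "\<lbrakk>actable M \<sigma> Bs f; set Cs \<subseteq> mobj M; reindexes \<rho> Bs Cs\<rbrakk>
      \<Longrightarrow> mact M \<rho> Cs (mact M \<sigma> Bs f) = mact M (map ((!) \<rho>) \<sigma>) Cs f"
    and comp_act_args:
      "\<lbrakk>composable M f fs; length \<sigma>s = length fs; length Bss = length fs;
        \<forall>i<length fs. actable M (\<sigma>s ! i) (Bss ! i) (fs ! i)\<rbrakk>
      \<Longrightarrow> mcomp M f (map (\<lambda>i. mact M (\<sigma>s ! i) (Bss ! i) (fs ! i)) [0..<length fs])
          = mact M (juxtapose (zip \<sigma>s (map length Bss))) (concat Bss) (mcomp M f fs)"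
    and comp_act_fun:
      "\<lbrakk>actable M \<sigma> Bs f; set fs \<subseteq> marr M; map (mtgt M) fs = Bs\<rbrakk>
      \<Longrightarrow> mcomp M (mact M \<sigma> Bs f) fs
          = mact M (block_map \<sigma> (map (length \<circ> msrc M) fs)) (concat (map (msrc M) fs))
              (mcomp M f (map ((!) fs) \<sigma>))"

definition cartesian_functor ::
  "('o, 'a, 'm) act_multicat_scheme \<Rightarrow> ('p, 'b, 'n) act_multicat_scheme
     \<Rightarrow> ('o, 'a, 'p, 'b) fctr \<Rightarrow> bool"
where
  "cartesian_functor M N F \<longleftrightarrow> multifunctor M N F \<and>
     (\<forall>\<sigma> Bs f. actable M \<sigma> Bs f \<longrightarrow>
        farr F (mact M \<sigma> Bs f) = mact N \<sigma> (map (fobj F) Bs) (farr F f))"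

definition symmetric_functor ::
  "('o, 'a, 'm) act_multicat_scheme \<Rightarrow> ('p, 'b, 'n) act_multicat_scheme
     \<Rightarrow> ('o, 'a, 'p, 'b) fctr \<Rightarrow> bool"
where
  "symmetric_functor M N F \<longleftrightarrow> multifunctor M N F \<and>
     (\<forall>\<sigma> Bs f. actable M \<sigma> Bs f \<and> bijective_map \<sigma> (length Bs) \<longrightarrow>
        farr F (mact M \<sigma> Bs f) = mact N \<sigma> (map (fobj F) Bs) (farr F f))"

text \<open>The hom-sets of \<open>fpMlt\<close>, and (as it is a full subcategory) also of \<open>fpSeq\<close>.\<close>

definition fpMlt_hom ::
  "('o, 'a) act_multicat \<Rightarrow> ('p, 'b) act_multicat \<Rightarrow> ('o, 'a, 'p, 'b) fctr set"
where
  "fpMlt_hom M N = {F. cartesian_functor M N F}"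


section \<open>Sequential multicategories\<close>

text \<open>An arrow to \<open>X\<close> is a tuple of arrows to \<open>X\<close>; the target is recorded
  since it cannot be recovered from the empty tuple.\<close>

definition seq_multicat :: "('o, 'a, 'c) cat_scheme \<Rightarrow> ('o, 'o \<times> 'a list) multicat" where
  "seq_multicat C = \<lparr>
     mobj = cobj C,
     marr = {(X, fs). X \<in> cobj C \<and> (\<forall>f\<in>set fs. f \<in> carr C \<and> ctgt C f = X)},
     msrc = (\<lambda>(X, fs). map (csrc C) fs),
     mtgt = fst,
     mid = (\<lambda>X. (X, [cid C X])),
     mcomp = (\<lambda>(X, fs) gs. (X, concat (map2 (\<lambda>f (Y, hs). map (ccomp C f) hs) fs gs)))\<rparr>"

text \<open>If \<open>M\<close> is isomorphic to \<open>seq_multicat D\<close>, for a category \<open>D\<close> with any types of objects and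
  arrows, then \<open>D\<close> is isomorphic to the category of unary arrows of \<open>M\<close>. So it is no
  restriction that the category below has the same types of objects and arrows as \<open>M\<close>.\<close>

definition sequential :: "('o, 'a, 'm) multicat_scheme \<Rightarrow> bool" where
  "sequential M \<longleftrightarrow> (\<exists>C :: ('o, 'a) cat. category C \<and> multicat_isomorphic M (seq_multicat C))"

definition fpMlt_obj :: "('o, 'a) act_multicat \<Rightarrow> bool" where
  "fpMlt_obj M \<longleftrightarrow> cartesian_multicategory M"

definition fpSeq_obj :: "('o, 'a) act_multicat \<Rightarrow> bool" where
  "fpSeq_obj M \<longleftrightarrow> fpMlt_obj M \<and> sequential M"

definition terminal_cat :: "(unit, unit) cat" where
  "terminal_cat = \<lparr>cobj = UNIV, carr = UNIV, csrc = (\<lambda>_. ()), ctgt = (\<lambda>_. ()),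
     cid = (\<lambda>_. ()), ccomp = (\<lambda>_ _. ())\<rparr>"

text \<open>There is exactly one arrow with source \<open>Bs\<close> in \<open>seq_multicat terminal_cat\<close>, which
  determines the action.\<close>

definition one_seq :: "(unit, unit \<times> unit list) act_multicat" where
  "one_seq = multicat.extend (seq_multicat terminal_cat)
     (act_multicat.fields (\<lambda>\<sigma> Bs f. ((), map (\<lambda>_. ()) Bs)))"


section \<open>Commutative monoids in a cartesian multicategory\<close>

type_synonym ('o, 'a) cmonoid = "(unit, unit \<times> unit list, 'o, 'a) fctr"

definition under_obj :: "('o, 'a) cmonoid \<Rightarrow> 'o" where
  "under_obj X = fobj X ()"

text \<open>The structure arrow of arity n: the image of the unique n-ary arrow.\<close>

definition str_arr :: "('o, 'a) cmonoid \<Rightarrow> nat \<Rightarrow> 'a" where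
  "str_arr X n = farr X ((), replicate n ())"

text \<open>The mapping from n blocks of k places to k blocks of n places, taking
  the j-th place of the i-th block to the i-th place of the j-th block.\<close>

definition transpose_map :: "nat \<Rightarrow> nat \<Rightarrow> nat list" where
  "transpose_map n k = concat (map (\<lambda>i. map (\<lambda>j. j * n + i) [0..<k]) [0..<n])"

definition commutes_with_str ::
  "('o, 'a, 'm) act_multicat_scheme \<Rightarrow> ('o, 'a) cmonoid list \<Rightarrow> ('o, 'a) cmonoid \<Rightarrow> 'a \<Rightarrow> bool"
where
  "commutes_with_str M Xs X \<alpha> \<longleftrightarrow>
     (\<forall>k. mcomp M (str_arr X k) (replicate k \<alpha>) =
          mact M (transpose_map (length Xs) k) (concat (replicate k (map under_obj Xs)))
            (mcomp M \<alpha> (map (\<lambda>Y. str_arr Y k) Xs)))"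

text \<open>An arrow is a triple of its source, its target and the underlying arrow of \<open>M\<close>.\<close>

type_synonym ('o, 'a) cmon_arr = "('o, 'a) cmonoid list \<times> ('o, 'a) cmonoid \<times> 'a"

abbreviation under_arr :: "('o, 'a) cmon_arr \<Rightarrow> 'a" where
  "under_arr f \<equiv> snd (snd f)"

definition cmonoids ::
  "('o, 'a) act_multicat \<Rightarrow> (('o, 'a) cmonoid, ('o, 'a) cmon_arr) act_multicat"
where
  "cmonoids M = \<lparr>
     mobj = {X. symmetric_functor one_seq M X},
     marr = {(Xs, X, \<alpha>).
        (\<forall>Y\<in>set Xs. symmetric_functor one_seq M Y) \<and> symmetric_functor one_seq M X \<and>
        \<alpha> \<in> marr M \<and> msrc M \<alpha> = map under_obj Xs \<and> mtgt M \<alpha> = under_obj X \<and>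
        commutes_with_str M Xs X \<alpha>},
     msrc = (\<lambda>(Xs, X, \<alpha>). Xs),
     mtgt = (\<lambda>(Xs, X, \<alpha>). X),
     mid = (\<lambda>X. ([X], X, mid M (under_obj X))),
     mcomp = (\<lambda>(Xs, X, \<alpha>) gs. (concat (map fst gs), X, mcomp M \<alpha> (map under_arr gs))),
     mact = (\<lambda>\<sigma> Ys (Xs, X, \<alpha>). (Ys, X, mact M \<sigma> (map under_obj Ys) \<alpha>))\<rparr>"

definition cmonoids_map ::
  "('o, 'a) act_multicat \<Rightarrow> ('o, 'a, 'p, 'b) fctr
     \<Rightarrow> (('o, 'a) cmonoid, ('o, 'a) cmon_arr, ('p, 'b) cmonoid, ('p, 'b) cmon_arr) fctr"
where
  "cmonoids_map M F = \<lparr>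
     fobj = (\<lambda>X\<in>mobj (cmonoids M). comp_fctr one_seq F X),
     farr = (\<lambda>(Xs, X, \<alpha>)\<in>marr (cmonoids M).
        (map (comp_fctr one_seq F) Xs, comp_fctr one_seq F X, farr F \<alpha>))\<rparr>"

definition forget ::
  "('o, 'a) act_multicat \<Rightarrow> (('o, 'a) cmonoid, ('o, 'a) cmon_arr, 'o, 'a) fctr"
where
  "forget M = \<lparr>
     fobj = (\<lambda>X\<in>mobj (cmonoids M). under_obj X),
     farr = (\<lambda>f\<in>marr (cmonoids M). under_arr f)\<rparr>"

definition unary_cat :: "('o, 'a, 'm) multicat_scheme \<Rightarrow> ('o, 'a) cat" where
  "unary_cat M = \<lparr>
     cobj = mobj M,
     carr = {f \<in> marr M. length (msrc M f) = 1},
     csrc = (\<lambda>f. hd (msrc M f)),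
     ctgt = mtgt M,
     cid = mid M,
     ccomp = (\<lambda>g f. mcomp M g [f])\<rparr>"

definition cMon_sum ::
  "('o, 'a) act_multicat \<Rightarrow> ('o, 'a) cmonoid \<Rightarrow> ('o, 'a) cmonoid \<Rightarrow> ('o, 'a) cmon_arr list
     \<Rightarrow> ('o, 'a) cmon_arr"
where
  "cMon_sum M X Y fs =
     ([X], Y, mact M (replicate (length fs) 0) [under_obj X]
                (mcomp M (str_arr Y (length fs)) (map under_arr fs)))"

definition cMon :: "('o, 'a) act_multicat \<Rightarrow> (('o, 'a) cmonoid, ('o, 'a) cmon_arr) preadd_cat" where
  "cMon M = (let U = unary_cat (cmonoids M) in
     cat.extend U
       (preadd_cat.fields (\<lambda>X Y. cMon_sum M X Y [])
          (\<lambda>f g. cMon_sum M (csrc U f) (ctgt U f) [f, g])))"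

end

theory Submission
  imports Defs
begin

text \<open>Let \<open>M\<close> be a cartesian multicategory. Inserting units, an arrow \<open>\<alpha> : X\<^sub>1, \<dots>, X\<^sub>n \<rightarrow> X\<close> of
  commutative monoids has components \<open>\<alpha>\<^sub>i : X\<^sub>i \<rightarrow> X\<close>. The commutation of \<open>\<alpha>\<close> with the \<open>n\<close>-ary
  operations, evaluated on the unit matrix, gives \<open>\<alpha> = m(\<alpha>\<^sub>1, \<dots>, \<alpha>\<^sub>n)\<close>; conversely all such sums of
  monoid morphisms are arrows. Hence \<open>\<alpha> \<mapsto> (\<alpha>\<^sub>1, \<dots>, \<alpha>\<^sub>n)\<close> identifies \<open>cmonoids M\<close> with the sequential
  multicategory of its unary arrows. In a sequential cartesian multicategory the tuples of identities
  form a commutative monoid on each object, and all arrows commute with these, which lifts functors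
  along \<open>forget M\<close>; an Eckmann--Hilton argument shows that the lift is unique.
  A preadditive category \<open>C\<close> is recovered from \<open>seq_multicat C\<close>, made cartesian by adding the
  arrows whose places are identified.\<close>

section \<open>Mappings of places\<close>

text \<open>The isomorphism that makes a cartesian multicategory sequential respects composition
  only: nothing in it ties the action of a mapping to the tuples. What a bijection does to a tuple
  has to be deduced from the axioms, by inserting units until one place is left, where the identity
  is the only mapping. Bijections suffice for the lift, because commutative monoids are symmetric
  functors and the commutation condition contains only a transposition. Transpositions are the main
  technical burden. Units remove them: nullary arguments are empty blocks, and a mapping that moves
  only empty blocks past the others induces the identity. Once every arrow of monoids is known to be
  a sum of morphisms, closure under composition needs no further permutations, being distributivity
  of sums. The action chosen on the tuples of a preadditive category is dictated by
  \<open>cMon\<close>: there a sum is the contraction of a structure arrow, so identified places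
  must be added, and places outside the image must receive zero.\<close>

lemma concat_map_if_eq:
  "i < n \<Longrightarrow> concat (map (\<lambda>l. if l = i then g l else []) [0..<n]) = g i"
proof (induction n)
  case (Suc n)
  have "concat (map (\<lambda>l. if l = n then g l else []) [0..<n]) = []"
    by auto
  with Suc show ?case by (cases "i = n") auto
qed simp

lemma sum_list_map_if_eq: "i < n \<Longrightarrow> sum_list (map (\<lambda>l. if l = i then 1 else 0 :: nat) [0..<n]) = 1"
  by (simp add: interv_sum_list_conv_sum_set_nat)

lemma upt_add_conv_append: "[0..<a + b] = [0..<a] @ map ((+) a) [0..<b]"
  by (induction b) auto

lemma sum_list_concat: "sum_list (concat xss) = sum_list (map sum_list xss)"
  for xss :: "nat list list"
  by (induction xss) auto

text \<open>Matrices with \<open>k\<close> rows and \<open>n\<close> columns are flattened by rows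
  throughout: place \<open>j * n + i\<close> is row \<open>j\<close>, column
  \<open>i\<close>.\<close>

lemma upt_mult_conv_concat: "[0..<k * n] = concat (map (\<lambda>j. map (\<lambda>i. j * n + i) [0..<n]) [0..<k])"
proof (induction k)
  case (Suc k)
  have "[0..<Suc k * n] = [0..<k * n] @ map (\<lambda>i. k * n + i) [0..<n]"
    using upt_add_conv_append[of "k * n" n] by (simp add: add.commute)
  with Suc show ?case by simp
qed simp

lemma nth_concat_map_upt:
  "j < k \<Longrightarrow> i < n \<Longrightarrow> concat (map (\<lambda>j. map (f j) [0..<n]) [0..<k]) ! (j * n + i) = f j i"
proof (induction k)
  case (Suc k)
  have len: "length (concat (map (\<lambda>j. map (f j) [0..<n]) [0..<k])) = k * n" for k
    by (induction k) auto
  show ?case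
  proof (cases "j = k")
    case True
    with Suc.prems show ?thesis by (simp add: nth_append len)
  next
    case False
    with Suc.prems have "j < k" by simp
    then have "j * n + i < k * n"
      using Suc.prems mult_le_mono1[of "Suc j" k n] by simp
    with Suc \<open>j < k\<close> show ?thesis by (simp add: nth_append len)
  qed
qed simp

section \<open>Transpositions and bijective mappings\<close>

lemma length_transpose_map: "length (transpose_map n k) = n * k"
  by (simp add: transpose_map_def length_concat o_def sum_list_triv)

lemma map_transpose_map:
  "map h (transpose_map n k) = concat (map (\<lambda>i. map (\<lambda>j. h (j * n + i)) [0..<k]) [0..<n])"
  by (simp add: transpose_map_def map_concat o_def)

lemma set_transpose_map: "set (transpose_map n k) = {..<k * n}"
proof -
  have "set (transpose_map n k) = (\<Union>i<n. \<Union>j<k. {j * n + i})"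
    by (auto simp: transpose_map_def)
  also have "\<dots> = (\<Union>j<k. \<Union>i<n. {j * n + i})"
    by blast
  also have "\<dots> = set (concat (map (\<lambda>j. map (\<lambda>i. j * n + i) [0..<n]) [0..<k]))"
    by auto (metis le_Suc_ex nat_add_left_cancel_less add.commute lessThan_iff)
  finally have "set (transpose_map n k) = \<dots>" .
  then show ?thesis by (simp add: upt_mult_conv_concat[symmetric] lessThan_atLeast0)
qed

lemma transpose_map_1: "transpose_map (Suc 0) k = [0..<k]"
  by (simp add: transpose_map_def map_idI)

lemma transpose_map_0: "transpose_map n 0 = []"
  by (simp add: transpose_map_def)

lemma bijective_map_iff: "bijective_map \<sigma> m \<longleftrightarrow> distinct \<sigma> \<and> set \<sigma> = {..<m}"
proof -
  have "(!) \<sigma> ` {..<length \<sigma>} = set \<sigma>"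
    by (auto simp: set_conv_nth)
  then show ?thesis
    by (auto simp: bijective_map_def bij_betw_def distinct_conv_nth inj_on_def)
qed

lemma bijective_map_length: "bijective_map \<sigma> m \<Longrightarrow> length \<sigma> = m"
  by (metis bijective_map_iff card_lessThan distinct_card)

lemma bijective_transpose_map: "bijective_map (transpose_map n k) (n * k)"
  by (simp add: bijective_map_iff set_transpose_map mult.commute card_distinct length_transpose_map)

section \<open>Mappings of blocks\<close>

lemma block_map_upt: "block_map [0..<length ls] ls = [0..<sum_list ls]"
proof (induction ls rule: rev_induct)
  case (snoc x xs)
  have "block_map [0..<length (xs @ [x])] (xs @ [x])
    = block_map [0..<length xs] xs @ map (\<lambda>k. sum_list xs + k) [0..<x]"
    by (auto simp: block_map_def nth_append intro!: arg_cong[where f = concat] map_cong)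
  then show ?case using snoc
    using upt_add_conv_append[of "sum_list xs" x] by simp
qed (simp add: block_map_def)

lemma block_map_filter: "block_map \<sigma> ls = block_map (filter (\<lambda>p. ls ! p \<noteq> 0) \<sigma>) ls"
  by (induction \<sigma>) (auto simp: block_map_def)

text \<open>Empty blocks contribute no places, so only the order in which \<open>\<sigma>\<close>
  meets the nonempty blocks matters. Transpositions of matrices with many nullary entries are
  removed in this way.\<close>

lemma block_map_eq_upt:
  assumes "filter (\<lambda>p. ls ! p \<noteq> 0) \<sigma> = filter (\<lambda>p. ls ! p \<noteq> 0) [0..<length ls]"
  shows "block_map \<sigma> ls = [0..<sum_list ls]"
  using assms block_map_filter block_map_upt by metis

lemma block_map_replicate:
  "set \<sigma> \<subseteq> {..<m} \<Longrightarrow> block_map \<sigma> (replicate m k) = concat (map (\<lambda>s. map (\<lambda>j. s * k + j) [0..<k]) \<sigma>)"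
  by (auto simp: block_map_def sum_list_replicate min_absorb1 subset_iff
      intro!: arg_cong[where f = concat] map_cong)

text \<open>Unary arguments form blocks of size 1, so axiom \<open>comp_act_fun\<close> applied to
  unary arrows returns the original mapping.\<close>

lemma block_map_ones: "set \<sigma> \<subseteq> {..<m} \<Longrightarrow> block_map \<sigma> (replicate m (Suc 0)) = \<sigma>"
  by (simp add: block_map_replicate)

text \<open>In the next two lemmas the blocks of length 1 occur in the same order whether the matrix of
  blocks is read by rows or by columns, so that the block map is the identity.\<close>

lemma block_map_transpose_diag:
  assumes "ls = concat (map (\<lambda>j. map (\<lambda>i. if i = j then 1 else 0) [0..<n]) [0..<n])"
  shows "block_map (transpose_map n n) ls = [0..<n]"
proof -
  have ls: "ls ! (j * n + i) = (if i = j then 1 else 0)" if "j < n" "i < n" for i j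
    unfolding assms using that by (rule nth_concat_map_upt)
  have len: "length ls = n * n"
    by (simp add: assms length_concat o_def sum_list_triv)
  have sum: "sum_list ls = n"
  proof -
    have "map (\<lambda>j. \<Sum>i\<leftarrow>[0..<n]. if i = j then 1 else 0) [0..<n] = map (\<lambda>_. 1 :: nat) [0..<n]"
      by (intro map_cong refl sum_list_map_if_eq) simp
    then show ?thesis
      by (simp only: assms sum_list_concat map_map o_def) (simp add: sum_list_triv)
  qed
  have "filter (\<lambda>i. i = j) [0..<n] = [j]" if "j < n" for j
    using that by (induction n) auto
  moreover have "filter (\<lambda>i. ls ! (j * n + i) \<noteq> 0) [0..<n] = filter (\<lambda>i. i = j) [0..<n]"
    "filter (\<lambda>i. ls ! (i * n + j) \<noteq> 0) [0..<n] = filter (\<lambda>i. i = j) [0..<n]" if "j < n" for j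
    using that by (intro filter_cong refl; simp add: ls)+
  ultimately have fl: "filter (\<lambda>i. ls ! (j * n + i) \<noteq> 0) [0..<n] = [j]"
    "filter (\<lambda>i. ls ! (i * n + j) \<noteq> 0) [0..<n] = [j]" if "j < n" for j
    using that by simp_all
  have "filter (\<lambda>p. ls ! p \<noteq> 0) (transpose_map n n)
      = concat (map (\<lambda>i. map (\<lambda>j. j * n + i) (filter (\<lambda>j. ls ! (j * n + i) \<noteq> 0) [0..<n])) [0..<n])"
    by (simp add: transpose_map_def filter_concat filter_map o_def)
  also have "\<dots> = concat (map (\<lambda>i. [i * n + i]) [0..<n])"
    by (intro arg_cong[where f = concat] map_cong refl) (simp add: fl[simplified])
  also have "\<dots> = concat (map (\<lambda>j. map (\<lambda>i. j * n + i) (filter (\<lambda>i. ls ! (j * n + i) \<noteq> 0) [0..<n])) [0..<n])"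
    by (intro arg_cong[where f = concat] map_cong refl) (simp add: fl[simplified])
  also have "\<dots> = filter (\<lambda>p. ls ! p \<noteq> 0) [0..<length ls]"
    by (simp add: len upt_mult_conv_concat filter_concat filter_map o_def)
  finally show ?thesis using block_map_eq_upt sum by metis
qed

lemma block_map_transpose_column:
  assumes "ls = concat (replicate k (map (\<lambda>i. if i = l then 1 else 0) [0..<n]))" "l < n"
  shows "block_map (transpose_map n k) ls = [0..<k]"
proof -
  have "ls = concat (map (\<lambda>j. map (\<lambda>i. if i = l then 1 else 0) [0..<n]) [0..<k])"
    by (simp add: assms map_replicate_const)
  then have ls: "ls ! (j * n + i) = (if i = l then 1 else 0)" if "j < k" "i < n" for i j
    using that nth_concat_map_upt[of j k i n "\<lambda>j i. if i = l then 1 else 0"] by simp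
  have len: "length ls = k * n"
    by (simp add: assms length_concat o_def sum_list_replicate)
  have sum: "sum_list ls = k"
    using sum_list_map_if_eq[OF assms(2)]
    by (simp add: assms(1) sum_list_concat o_def sum_list_replicate)
  have "filter (\<lambda>i. i = l) [0..<n] = [l]"
    using assms(2) by (induction n) auto
  moreover have "filter (\<lambda>i. ls ! (j * n + i) \<noteq> 0) [0..<n] = filter (\<lambda>i. i = l) [0..<n]"
    if "j < k" for j
    using that by (intro filter_cong refl) (simp add: ls)
  ultimately have fl: "filter (\<lambda>i. ls ! (j * n + i) \<noteq> 0) [0..<n] = [l]" if "j < k" for j
    using that by simp
  have "filter (\<lambda>p. ls ! p \<noteq> 0) (transpose_map n k)
      = concat (map (\<lambda>i. map (\<lambda>j. j * n + i) (filter (\<lambda>j. ls ! (j * n + i) \<noteq> 0) [0..<k])) [0..<n])"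
    by (simp add: transpose_map_def filter_concat filter_map o_def)
  also have "\<dots> = concat (map (\<lambda>i. if i = l then map (\<lambda>j. j * n + i) [0..<k] else []) [0..<n])"
    by (intro arg_cong[where f = concat] map_cong refl) (simp add: ls cong: filter_cong)
  also have "\<dots> = map (\<lambda>j. j * n + l) [0..<k]"
    using concat_map_if_eq[OF assms(2)] .
  also have "\<dots> = concat (map (\<lambda>j. [j * n + l]) [0..<k])"
    by simp
  also have "\<dots> = concat (map (\<lambda>j. map (\<lambda>i. j * n + i) (filter (\<lambda>i. ls ! (j * n + i) \<noteq> 0) [0..<n])) [0..<k])"
    by (intro arg_cong[where f = concat] map_cong refl) (simp add: fl[simplified])
  also have "\<dots> = filter (\<lambda>p. ls ! p \<noteq> 0) [0..<length ls]"
    by (simp add: len upt_mult_conv_concat filter_concat filter_map o_def)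
  finally show ?thesis using block_map_eq_upt sum by metis
qed

section \<open>Reindexing of concatenated sources\<close>

lemma map_nth_offset: 
  "map (\<lambda>k. concat xss ! (sum_list (take j (map length xss)) + k)) [0..<length (xss ! j)] = xss ! j"
  if "j < length xss"
  using that
proof (induction xss arbitrary: j)
  case (Cons xs xss)
  show ?case
  proof (cases j)
    case 0
    then show ?thesis by (auto simp: nth_append intro: nth_equalityI)
  next
    case (Suc j')
    with Cons show ?thesis by (simp add: nth_append add.assoc)
  qed
qed simp

lemma offset_le:
  "j < length ls \<Longrightarrow> sum_list (take j ls) + ls ! j \<le> sum_list (ls :: nat list)"
proof (induction ls arbitrary: j)
  case (Cons l ls)
  then show ?case by (cases j) (auto simp: add.assoc)
qed simp

lemma map_block_map:
  assumes "set \<sigma> \<subseteq> {..<length xss}"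
  shows "map ((!) (concat xss)) (block_map \<sigma> (map length xss)) = concat (map ((!) xss) \<sigma>)"
  using assms
  by (auto simp: block_map_def map_concat o_def subset_iff map_nth_offset[simplified]
      intro!: arg_cong[where f = concat] map_cong)

text \<open>With \<open>xss\<close> the sources of the arguments, this makes the right-hand side of
  axiom \<open>comp_act_fun\<close> well typed; \<open>reindexes_juxtapose\<close> does the same for
  \<open>comp_act_args\<close>.\<close>

lemma reindexes_block_map:
  assumes "set \<sigma> \<subseteq> {..<length xss}"
  shows "reindexes (block_map \<sigma> (map length xss)) (concat (map ((!) xss) \<sigma>)) (concat xss)"
proof -
  have "set (block_map \<sigma> (map length xss)) \<subseteq> {..<length (concat xss)}"
    using assms offset_le[of _ "map length xss"]
    by (fastforce simp: block_map_def length_concat subset_iff)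
  then show ?thesis using map_block_map[OF assms] by (simp add: reindexes_def)
qed

lemma reindexes_append:
  assumes "reindexes \<sigma> As Bs" "reindexes \<rho> Cs Ds"
  shows "reindexes (\<sigma> @ map ((+) (length Bs)) \<rho>) (As @ Cs) (Bs @ Ds)"
  using assms by (auto simp: reindexes_def nth_append)

lemma reindexes_juxtapose:
  assumes "length \<sigma>s = length Ass" "length Bss = length Ass"
    "\<forall>i<length Ass. reindexes (\<sigma>s ! i) (Ass ! i) (Bss ! i)"
  shows "reindexes (juxtapose (zip \<sigma>s (map length Bss))) (concat Ass) (concat Bss)"
  using assms(1) assms(2)[symmetric] assms(3)
proof (induction \<sigma>s Ass Bss rule: list_induct3)
  case (Cons \<sigma> \<sigma>s As Ass Bs Bss)
  then have "reindexes (juxtapose (zip \<sigma>s (map length Bss))) (concat Ass) (concat Bss)"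
    "reindexes \<sigma> As Bs" by fastforce+
  then show ?case using reindexes_append by fastforce
qed (auto simp: reindexes_def)

lemma length_reindexes: "reindexes \<sigma> As Bs \<Longrightarrow> length \<sigma> = length As"
  by (auto simp: reindexes_def)

lemma map_nth_upt_length: "length xs = n \<Longrightarrow> map (\<lambda>i. f (xs ! i)) [0..<n] = map f xs"
  by (auto intro: nth_equalityI)

lemma map_nth_map: "set \<sigma> \<subseteq> {..<length xs} \<Longrightarrow> map ((!) (map f xs)) \<sigma> = map f (map ((!) xs) \<sigma>)"
  by (auto simp: subset_iff)

lemma concat_concat: "concat (concat xsss) = concat (map concat xsss)"
  by (induction xsss) auto

text \<open>Typing of the commutation condition: its right-hand side permutes the source of
  \<open>\<alpha>\<close> composed with k-ary operations into \<open>k\<close> copies of the source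
  of \<open>\<alpha>\<close>.\<close>

lemma reindexes_transpose_map:
  "reindexes (transpose_map (length As) k) (concat (map (replicate k) As)) (concat (replicate k As))"
proof -
  let ?n = "length As" and ?Bs = "concat (replicate k As)"
  have Bs: "?Bs = concat (map (\<lambda>j. map ((!) As) [0..<?n]) [0..<k])"
    by (simp add: map_replicate_const map_nth)
  have "map ((!) ?Bs) (transpose_map ?n k)
    = concat (map (\<lambda>i. map (\<lambda>j. As ! i) [0..<k]) [0..<?n])"
    unfolding map_transpose_map
    by (intro arg_cong[where f = concat] map_cong refl)
       (simp add: Bs nth_concat_map_upt[where f = "\<lambda>_. (!) As"])
  also have "\<dots> = concat (map (replicate k) As)"
    by (simp add: map_replicate_const map_nth_upt_length)
  finally show ?thesis
    by (simp add: reindexes_def set_transpose_map length_concat sum_list_replicate)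
qed

text \<open>Parallel copies of \<open>\<sigma>\<close> keep the row \<open>j\<close> of a place and
  move only its column.\<close>

lemma juxtapose_replicate:
  "juxtapose (replicate k (\<sigma>, m)) = concat (map (\<lambda>j. map (\<lambda>i. j * m + \<sigma> ! i) [0..<length \<sigma>]) [0..<k])"
proof -
  have "juxtapose (replicate k (\<sigma>, m)) = concat (map (\<lambda>j. map (\<lambda>s. j * m + s) \<sigma>) [0..<k])"
  proof (induction k)
    case (Suc k)
    have "(+) (m + j * m) = (\<lambda>s. m + (j * m + s))" for j
      by (simp add: fun_eq_iff)
    with Suc show ?case
      by (simp add: upt_conv_Cons map_Suc_upt[symmetric] map_concat o_def map_idI del: upt_Suc)
  qed simp
  then show ?thesis by (simp add: map_nth_upt_length[of \<sigma>, OF refl, where f = "\<lambda>s. _ * m + s"])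
qed

text \<open>Both sides send place \<open>j\<close> of block \<open>i\<close> to row
  \<open>j\<close>, column \<open>\<sigma> ! i\<close>. This naturality of the transposition is what
  makes \<open>cmonoids\<close> closed under the action.\<close>

lemma transpose_map_natural:
  assumes "set \<sigma> \<subseteq> {..<m}" "length \<sigma> = n"
  shows "map ((!) (juxtapose (replicate k (\<sigma>, m)))) (transpose_map n k)
    = map ((!) (transpose_map m k)) (block_map \<sigma> (replicate m k))"
proof -
  have "map ((!) (juxtapose (replicate k (\<sigma>, m)))) (transpose_map n k)
    = concat (map (\<lambda>i. map (\<lambda>j. j * m + \<sigma> ! i) [0..<k]) [0..<n])"
    unfolding map_transpose_map juxtapose_replicate assms(2)
    by (intro arg_cong[where f = concat] map_cong refl)
       (simp add: nth_concat_map_upt[where f = "\<lambda>j i. j * m + \<sigma> ! i"])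
  also have "\<dots> = concat (map (\<lambda>s. map (\<lambda>j. j * m + s) [0..<k]) \<sigma>)"
    by (simp add: map_nth_upt_length[OF assms(2), of "\<lambda>s. map (\<lambda>j. j * m + s) [0..<k]"])
  also have "\<dots> = concat (map (\<lambda>s. map (\<lambda>j. transpose_map m k ! (s * k + j)) [0..<k]) \<sigma>)"
    using assms(1) unfolding transpose_map_def
    by (intro arg_cong[where f = concat] map_cong refl)
       (simp add: subset_iff nth_concat_map_upt[where f = "\<lambda>i j. j * m + i"])
  finally show ?thesis
    by (simp add: block_map_replicate[OF assms(1)] map_concat o_def)
qed

section \<open>The terminal symmetric multicategory\<close>

lemma unit_list_eq_replicate: "(xs :: unit list) = replicate (length xs) ()"
  by (simp add: list_eq_iff_nth_eq)

lemma one_seq_simps: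
  "mobj one_seq = UNIV" "marr one_seq = UNIV" "msrc one_seq f = snd f" "mtgt one_seq f = ()"
  "mid one_seq x = ((), [()])" "mact one_seq \<sigma> Bs f = ((), replicate (length Bs) ())"
  by (auto simp: one_seq_def multicat.defs act_multicat.defs seq_multicat_def terminal_cat_def
      case_prod_beta map_replicate_const unit_list_eq_replicate[symmetric])

lemma length_concat_map2:
  "length fs = length gs \<Longrightarrow>
    length (concat (map2 (\<lambda>f (Y, hs). map (h f) hs) fs gs)) = sum_list (map (length \<circ> snd) gs)"
  by (induction fs gs rule: list_induct2) (auto simp: case_prod_beta)

lemma mcomp_one_seq:
  assumes "length gs = length (snd f)"
  shows "mcomp one_seq f gs = ((), replicate (sum_list (map (length \<circ> snd) gs)) ())"
proof -
  have "mcomp one_seq f gs = ((), concat (map2 (\<lambda>f (Y, hs). map (ccomp terminal_cat f) hs) (snd f) gs))"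
    by (simp add: one_seq_def multicat.defs act_multicat.defs seq_multicat_def case_prod_beta)
  then show ?thesis
    by (metis assms length_concat_map2 unit_list_eq_replicate)
qed

section \<open>Commutative monoids\<close>

lemma concat_replicate_singleton: "concat (replicate k [x]) = replicate k x"
  by (induction k) auto

lemma map_eq_replicate_iff: "map f xs = replicate n y \<longleftrightarrow> length xs = n \<and> (\<forall>x\<in>set xs. f x = y)"
proof (induction xs arbitrary: n)
  case (Cons x xs)
  then show ?case by (cases n) auto
qed auto

lemma unit_list_eq_iff: "xs = ys \<longleftrightarrow> length xs = length ys" for xs ys :: "unit list"
  by (metis unit_list_eq_replicate)

lemma farr_one_seq: "farr X = (\<lambda>f. str_arr X (length (snd f)))"
proof
  fix f :: "unit \<times> unit list"
  show "farr X f = str_arr X (length (snd f))"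
    by (cases f) (simp add: str_arr_def unit_list_eq_replicate[symmetric])
qed

lemma actable_one_seq: "actable one_seq \<sigma> Bs f \<longleftrightarrow> set \<sigma> \<subseteq> {..<length Bs} \<and> length \<sigma> = length (snd f)"
  by (auto simp: actable_def one_seq_simps reindexes_def unit_list_eq_iff)

text \<open>The unbiased form of a commutative monoid: an arrow of \<open>one_seq\<close> amounts to
  its arity, so functoriality says that arities add up under composition and that permutations fix
  the structure arrows.\<close>

lemma symmetric_functor_one_seq_iff:
  "symmetric_functor one_seq M X \<longleftrightarrow>
    under_obj X \<in> mobj M \<and>
    (\<forall>n. str_arr X n \<in> marr M \<and> msrc M (str_arr X n) = replicate n (under_obj X) \<and>
      mtgt M (str_arr X n) = under_obj X) \<and>
    str_arr X 1 = mid M (under_obj X) \<and>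
    (\<forall>ks. mcomp M (str_arr X (length ks)) (map (str_arr X) ks) = str_arr X (sum_list ks)) \<and>
    (\<forall>\<sigma>. bijective_map \<sigma> (length \<sigma>) \<longrightarrow>
      mact M \<sigma> (replicate (length \<sigma>) (under_obj X)) (str_arr X (length \<sigma>)) = str_arr X (length \<sigma>))"
  (is "_ \<longleftrightarrow> ?obj \<and> ?arr \<and> ?id \<and> ?comp \<and> ?act")
proof -
  have arr: "?arr \<longleftrightarrow> farr X \<in> marr one_seq \<rightarrow>\<^sub>E marr M \<and>
     (\<forall>f\<in>marr one_seq. msrc M (farr X f) = map (fobj X) (msrc one_seq f) \<and>
        mtgt M (farr X f) = fobj X (mtgt one_seq f))" (is "_ \<longleftrightarrow> ?arr'")
  proof
    assume ?arr
    then show ?arr'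
      by (auto simp: one_seq_simps farr_one_seq map_eq_replicate_iff under_obj_def PiE_def
          eq_commute[of "replicate _ _"])
  next
    assume arr': ?arr'
    show ?arr
    proof
      fix n
      show "str_arr X n \<in> marr M \<and> msrc M (str_arr X n) = replicate n (under_obj X) \<and>
        mtgt M (str_arr X n) = under_obj X"
        using arr' by (auto simp: str_arr_def under_obj_def one_seq_simps map_replicate)
    qed
  qed
  have comp: "?comp \<longleftrightarrow> (\<forall>f gs. composable one_seq f gs \<longrightarrow>
        farr X (mcomp one_seq f gs) = mcomp M (farr X f) (map (farr X) gs))" (is "_ \<longleftrightarrow> ?comp'")
  proof
    assume c: ?comp
    show ?comp'
    proof (intro allI impI)
      fix f and gs :: "(unit \<times> unit list) list" assume "composable one_seq f gs"
      then have l: "length gs = length (snd f)"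
        by (metis composable_def length_map one_seq_simps(3))
      show "farr X (mcomp one_seq f gs) = mcomp M (farr X f) (map (farr X) gs)"
        using c[rule_format, of "map (length \<circ> snd) gs"] l
        by (simp add: mcomp_one_seq farr_one_seq o_def)
    qed
  next
    assume c: ?comp'
    show ?comp
    proof
      fix ks :: "nat list"
      have "composable one_seq ((), replicate (length ks) ()) (map (\<lambda>k. ((), replicate k ())) ks)"
        by (simp add: composable_def one_seq_simps o_def map_replicate_const)
      with c show "mcomp M (str_arr X (length ks)) (map (str_arr X) ks) = str_arr X (sum_list ks)"
        by (force simp: mcomp_one_seq farr_one_seq o_def)
    qed
  qed
  have act: "?act \<longleftrightarrow> (\<forall>\<sigma> Bs f. actable one_seq \<sigma> Bs f \<and> bijective_map \<sigma> (length Bs) \<longrightarrow>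
        farr X (mact one_seq \<sigma> Bs f) = mact M \<sigma> (map (fobj X) Bs) (farr X f))" (is "_ \<longleftrightarrow> ?act'")
  proof
    assume c: ?act
    show ?act'
    proof (intro allI impI)
      fix \<sigma> Bs f assume "actable one_seq \<sigma> Bs f \<and> bijective_map \<sigma> (length Bs)"
      then have "length \<sigma> = length (snd f)" "length \<sigma> = length Bs" "bijective_map \<sigma> (length \<sigma>)"
        by (auto simp: actable_one_seq bijective_map_length)
      moreover have "map (fobj X) Bs = replicate (length Bs) (under_obj X)"
        by (simp add: map_eq_replicate_iff under_obj_def)
      ultimately show "farr X (mact one_seq \<sigma> Bs f) = mact M \<sigma> (map (fobj X) Bs) (farr X f)"
        using c by (metis farr_one_seq length_replicate one_seq_simps(6) snd_conv)
    qed
  next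
    assume c: ?act'
    show ?act
    proof (intro allI impI)
      fix \<sigma> assume b: "bijective_map \<sigma> (length \<sigma>)"
      then have "actable one_seq \<sigma> (replicate (length \<sigma>) ()) ((), replicate (length \<sigma>) ())"
        by (auto simp: actable_one_seq bijective_map_iff)
      with b c show "mact M \<sigma> (replicate (length \<sigma>) (under_obj X)) (str_arr X (length \<sigma>)) = str_arr X (length \<sigma>)"
        by (force simp: farr_one_seq one_seq_simps under_obj_def)
    qed
  qed
  have id: "?id \<longleftrightarrow> (\<forall>x\<in>mobj one_seq. farr X (mid one_seq x) = mid M (fobj X x))"
    by (simp add: one_seq_simps farr_one_seq under_obj_def)
  have obj: "?obj \<longleftrightarrow> fobj X \<in> mobj one_seq \<rightarrow>\<^sub>E mobj M"
    by (auto simp: one_seq_simps under_obj_def PiE_def)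
  show ?thesis
    unfolding symmetric_functor_def multifunctor_def arr comp act id obj by blast
qed

lemma cmonoid_eqI:
  assumes "under_obj X = under_obj Y" "\<And>n. str_arr X n = str_arr Y n"
  shows "X = Y"
proof -
  have "farr X f = farr Y f" for f
    using assms(2) by (simp add: farr_one_seq)
  with assms(1) show ?thesis
    by (auto intro!: fctr.equality simp: under_obj_def fun_eq_iff)
qed

lemma cmonoids_simps:
  "mobj (cmonoids M) = {X. symmetric_functor one_seq M X}"
  "(Xs, X, \<alpha>) \<in> marr (cmonoids M) \<longleftrightarrow> set Xs \<subseteq> mobj (cmonoids M) \<and> X \<in> mobj (cmonoids M) \<and>
     \<alpha> \<in> marr M \<and> msrc M \<alpha> = map under_obj Xs \<and> mtgt M \<alpha> = under_obj X \<and>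
     commutes_with_str M Xs X \<alpha>"
  "msrc (cmonoids M) = fst"
  "mtgt (cmonoids M) = (\<lambda>f. fst (snd f))"
  "mid (cmonoids M) X = ([X], X, mid M (under_obj X))"
  "mcomp (cmonoids M) f gs =
     (concat (map fst gs), fst (snd f), mcomp M (under_arr f) (map under_arr gs))"
  "mact (cmonoids M) \<sigma> Ys f = (Ys, fst (snd f), mact M \<sigma> (map under_obj Ys) (under_arr f))"
  by (auto simp: cmonoids_def case_prod_beta)

context multicategory
begin

text \<open>Associativity with the arguments as functions of an index, the form in which rows and
  columns of matrices are composed.\<close>

lemma comp_assoc_map:
  assumes "composable M f (map g xs)" "\<And>x. x \<in> set xs \<Longrightarrow> composable M (g x) (h x)"
  shows "mcomp M f (map (\<lambda>x. mcomp M (g x) (h x)) xs) = mcomp M (mcomp M f (map g xs)) (concat (map h xs))"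
proof -
  have "map2 (mcomp M) (map g xs) (map h xs) = map (\<lambda>x. mcomp M (g x) (h x)) xs"
    by (induction xs) auto
  moreover have "list_all2 (composable M) (map g xs) (map h xs)"
    using assms(2) by (simp add: list_all2_conv_all_nth)
  ultimately show ?thesis
    using comp_assoc[OF assms(1)] by metis
qed

lemma comp_nil: "f \<in> marr M \<Longrightarrow> msrc M f = [] \<Longrightarrow> mcomp M f [] = f"
  using comp_id by fastforce

lemma comp_single_assoc:
  "\<lbrakk>composable M f [g]; composable M g hs\<rbrakk> \<Longrightarrow> mcomp M f [mcomp M g hs] = mcomp M (mcomp M f [g]) hs"
  using comp_assoc_map[of f "\<lambda>_. g" "[()]" "\<lambda>_. hs"] by simp

end

text \<open>\<open>cmonoids\<close> is only defined for records without further fields.\<close>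

locale plain_cartesian_multicategory = cartesian_multicategory M
  for M :: "('o, 'a) act_multicat"
begin

lemma cmonoidD:
  assumes "X \<in> mobj (cmonoids M)"
  shows "under_obj X \<in> mobj M" "str_arr X n \<in> marr M"
    "msrc M (str_arr X n) = replicate n (under_obj X)" "mtgt M (str_arr X n) = under_obj X"
    "str_arr X (Suc 0) = mid M (under_obj X)"
    "length ks = n \<Longrightarrow> mcomp M (str_arr X n) (map (str_arr X) ks) = str_arr X (sum_list ks)"
    "bijective_map \<sigma> n \<Longrightarrow> mact M \<sigma> (replicate n (under_obj X)) (str_arr X n) = str_arr X n"
  using assms unfolding cmonoids_simps mem_Collect_eq symmetric_functor_one_seq_iff
  by (auto dest: bijective_map_length)

section \<open>Sums formed with the structure arrows\<close>

lemma composable_str: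
  "X \<in> mobj (cmonoids M) \<Longrightarrow> composable M (str_arr X n) fs \<longleftrightarrow>
    length fs = n \<and> set fs \<subseteq> {f \<in> marr M. mtgt M f = under_obj X}"
  by (auto simp: composable_def cmonoidD map_eq_replicate_iff)

text \<open>General associativity of sums: the inner structure arrows are composed with the outer
  one, and their arities add up.\<close>

lemma str_flatten:
  assumes X: "X \<in> mobj (cmonoids M)"
    and "\<And>fs. fs \<in> set fss \<Longrightarrow> set fs \<subseteq> {f \<in> marr M. mtgt M f = under_obj X}"
  shows "mcomp M (str_arr X (length fss)) (map (\<lambda>fs. mcomp M (str_arr X (length fs)) fs) fss)
    = mcomp M (str_arr X (length (concat fss))) (concat fss)"
proof -
  have "mcomp M (str_arr X (length fss)) (map (\<lambda>fs. mcomp M (str_arr X (length fs)) fs) fss)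
    = mcomp M (mcomp M (str_arr X (length fss)) (map (\<lambda>fs. str_arr X (length fs)) fss)) (concat (map (\<lambda>fs. fs) fss))"
    using assms by (intro comp_assoc_map) (auto simp: composable_str cmonoidD)
  then show ?thesis
    using cmonoidD(6)[OF X, of "map length fss"] by (simp add: o_def length_concat)
qed

text \<open>The invariance of the structure arrow under \<open>\<rho>\<close> is transported to sums
  by \<open>comp_act_fun\<close>. The summands are unary so that the block mapping is
  \<open>\<rho>\<close> itself.\<close>

lemma str_permute:
  assumes X: "X \<in> mobj (cmonoids M)" and \<rho>: "bijective_map \<rho> (length fs)"
    and fs: "set fs \<subseteq> {f \<in> marr M. mtgt M f = under_obj X}" and src: "map (msrc M) fs = map (\<lambda>A. [A]) As"
  shows "mact M \<rho> As (mcomp M (str_arr X (length fs)) (map ((!) fs) \<rho>)) = mcomp M (str_arr X (length fs)) fs"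
proof -
  let ?m = "str_arr X (length fs)"
  have \<rho>': "set \<rho> = {..<length fs}" "length \<rho> = length fs"
    using \<rho> bijective_map_length by (auto simp: bijective_map_iff)
  have "actable M \<rho> (replicate (length fs) (under_obj X)) ?m"
    using \<rho>' by (simp add: set_replicate_conv_if actable_def cmonoidD(1-4)[OF X] reindexes_def map_eq_replicate_iff)
  moreover have "map (mtgt M) fs = replicate (length fs) (under_obj X)"
    using fs by (auto simp: map_eq_replicate_iff)
  ultimately have "mcomp M (mact M \<rho> (replicate (length fs) (under_obj X)) ?m) fs
    = mact M (block_map \<rho> (map (length \<circ> msrc M) fs)) (concat (map (msrc M) fs)) (mcomp M ?m (map ((!) fs) \<rho>))"
    using fs by (intro comp_act_fun) (simp_all add: subset_iff)
  moreover have "map (length \<circ> msrc M) fs = replicate (length fs) (Suc 0)"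
    using arg_cong[OF src, of "map length"] arg_cong[OF src, of length]
    by (simp add: o_def map_replicate_const)
  ultimately show ?thesis
    using cmonoidD(7)[OF X \<rho>] by (simp add: src \<rho>' block_map_ones)
qed

lemma str_unit:
  assumes X: "X \<in> mobj (cmonoids M)" and f: "f \<in> marr M" "mtgt M f = under_obj X" and i: "i < n"
  shows "mcomp M (str_arr X n) (map (\<lambda>l. if l = i then f else str_arr X 0) [0..<n]) = f"
proof -
  \<comment> \<open>Each summand is written as a structure arrow with arguments, of arity 1 at place
    \<open>i\<close> and 0 elsewhere. The arities add up to 1, and the structure arrow of arity 1 is
    an identity.\<close>
  have "map (\<lambda>l. if l = i then f else str_arr X 0) [0..<n]
    = map (\<lambda>l. mcomp M (str_arr X (if l = i then 1 else 0)) (if l = i then [f] else [])) [0..<n]"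
    using X f by (auto simp: cmonoidD id_comp comp_nil) (metis f id_comp)
  also have "mcomp M (str_arr X n) \<dots> = mcomp M (mcomp M (str_arr X n) (map (\<lambda>l. str_arr X (if l = i then 1 else 0)) [0..<n]))
     (concat (map (\<lambda>l. if l = i then [f] else []) [0..<n]))"
    using X f by (intro comp_assoc_map) (auto simp: composable_str cmonoidD)
  also have "mcomp M (str_arr X n) (map (\<lambda>l. str_arr X (if l = i then 1 else 0)) [0..<n]) = str_arr X (Suc 0)"
    using cmonoidD(6)[OF X, of "map (\<lambda>l. if l = i then 1 else 0) [0..<n]" n] sum_list_map_if_eq[OF i]
    by (simp add: o_def)
  also have "mcomp M (str_arr X (Suc 0)) (concat (map (\<lambda>l. if l = i then [f] else []) [0..<n])) = f"
    using X id_comp[OF f(1)] f concat_map_if_eq[OF i, of "\<lambda>_. [f]"] by (simp add: cmonoidD)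
  finally show ?thesis .
qed

text \<open>For one variable the transposition is the identity, which leaves the usual condition on
  a morphism of monoids.\<close>

lemma cmonoids_unary_iff:
  "([X], Y, f) \<in> marr (cmonoids M) \<longleftrightarrow> X \<in> mobj (cmonoids M) \<and> Y \<in> mobj (cmonoids M) \<and>
    f \<in> marr M \<and> msrc M f = [under_obj X] \<and> mtgt M f = under_obj Y \<and>
    (\<forall>k. mcomp M (str_arr Y k) (replicate k f) = mcomp M f [str_arr X k])"
proof -
  have "mact M [0..<k] (replicate k (under_obj X)) (mcomp M f [str_arr X k]) = mcomp M f [str_arr X k]"
    if "X \<in> mobj (cmonoids M)" "f \<in> marr M" "msrc M f = [under_obj X]" for k
  proof -
    have c: "composable M f [str_arr X k]"
      using that by (simp add: composable_def cmonoidD)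
    show ?thesis
      using act_id[OF comp_closed[OF c]] comp_src[OF c] that by (simp add: cmonoidD)
  qed
  then show ?thesis
    by (auto simp: cmonoids_simps(2) commutes_with_str_def transpose_map_1 concat_replicate_singleton)
qed

text \<open>Preservation of the operations extends, by associativity, to sums of arrows of any
  arity.\<close>

lemma cmonoids_unary_comp_str:
  assumes f: "([X], Y, f) \<in> marr (cmonoids M)" and gs: "set gs \<subseteq> {g \<in> marr M. mtgt M g = under_obj X}"
  shows "mcomp M f [mcomp M (str_arr X (length gs)) gs] = mcomp M (str_arr Y (length gs)) (map (\<lambda>g. mcomp M f [g]) gs)"
proof -
  note f' = f[unfolded cmonoids_unary_iff]
  have "mcomp M f [mcomp M (str_arr X (length gs)) gs] = mcomp M (mcomp M f [str_arr X (length gs)]) gs"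
    using f' gs by (intro comp_single_assoc) (auto simp: composable_str composable_def[of _ f] cmonoidD)
  also have "\<dots> = mcomp M (mcomp M (str_arr Y (length gs)) (map (\<lambda>_. f) gs)) (concat (map (\<lambda>g. [g]) gs))"
    using f' by (simp add: map_replicate_const)
  also have "\<dots> = mcomp M (str_arr Y (length gs)) (map (\<lambda>g. mcomp M f [g]) gs)"
    using f' gs by (intro comp_assoc_map[symmetric]) (auto simp: composable_str composable_def[of _ f])
  finally show ?thesis .
qed

text \<open>This is where commutativity enters: a transposition is a bijection, hence acts trivially on
  the structure arrows.\<close>

lemma str_sum_commutes:
  assumes arr: "list_all2 (\<lambda>X f. ([X], Y, f) \<in> marr (cmonoids M)) Xs fs" and Y: "Y \<in> mobj (cmonoids M)"
  shows "(Xs, Y, mcomp M (str_arr Y (length Xs)) fs) \<in> marr (cmonoids M)"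
proof -
  have fs: "\<And>i. i < length Xs \<Longrightarrow> ([Xs ! i], Y, fs ! i) \<in> marr (cmonoids M)" and len: "length fs = length Xs"
    using arr by (auto simp: list_all2_conv_all_nth)
  let ?n = "length Xs" and ?m = "str_arr Y"
  let ?\<alpha> = "mcomp M (?m ?n) fs"
  have fs': "set fs \<subseteq> {f \<in> marr M. mtgt M f = under_obj Y}" and Xs: "set Xs \<subseteq> mobj (cmonoids M)"
    using fs len by (auto simp: cmonoids_unary_iff in_set_conv_nth)
  have srcs: "map (msrc M) fs = map (\<lambda>X. [under_obj X]) Xs"
    using fs len by (auto simp: list_eq_iff_nth_eq cmonoids_unary_iff)
  have c: "composable M (?m ?n) fs"
    using fs' len Y by (simp add: composable_str)
  have \<alpha>: "?\<alpha> \<in> marr M" "msrc M ?\<alpha> = map under_obj Xs" "mtgt M ?\<alpha> = under_obj Y"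
    using comp_closed[OF c] comp_src[OF c] comp_tgt[OF c] Y
    by (auto simp: srcs cmonoidD concat_map_singleton)
  have "mcomp M (?m k) (replicate k ?\<alpha>) = mact M (transpose_map ?n k)
    (concat (replicate k (map under_obj Xs))) (mcomp M ?\<alpha> (map (\<lambda>X. str_arr X k) Xs))" for k
  proof -
    \<comment> \<open>The matrix with \<open>k\<close> rows equal to \<open>fs\<close>. Both sides
      of the commutation condition are its sum, on the left by rows and on the right by columns,
      since each \<open>fs ! i\<close> preserves the k-ary operation; \<open>str_permute\<close>
      compares the two orders.\<close>
    let ?hs = "concat (replicate k fs)"
    have hs: "set ?hs \<subseteq> {f \<in> marr M. mtgt M f = under_obj Y}"
      using fs' by auto
    have "length ?hs = ?n * k"
      by (simp add: length_concat len sum_list_replicate)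
    have "map ((!) ?hs) (transpose_map ?n k) = concat (map (\<lambda>i. replicate k (fs ! i)) [0..<?n])"
    proof -
      have "?hs = concat (map (\<lambda>j. map ((!) fs) [0..<?n]) [0..<k])"
        by (simp add: map_replicate_const len[symmetric] map_nth)
      then have "map (\<lambda>j. ?hs ! (j * ?n + i)) [0..<k] = replicate k (fs ! i)" if "i < ?n" for i
        using that nth_concat_map_upt[where f = "\<lambda>_. (!) fs"] by (intro nth_equalityI) auto
      then show ?thesis
        unfolding map_transpose_map by (intro arg_cong[where f = concat] map_cong) auto
    qed
    have "mcomp M ?\<alpha> (map (\<lambda>X. str_arr X k) Xs) = mcomp M (mcomp M (?m ?n) (map ((!) fs) [0..<?n]))
        (concat (map (\<lambda>i. [str_arr (Xs ! i) k]) [0..<?n]))"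
      by (simp add: concat_map_singleton map_nth[of fs, unfolded len] map_nth_upt_length[of Xs _ "\<lambda>X. str_arr X k"])
    also have "\<dots> = mcomp M (?m ?n) (map (\<lambda>i. mcomp M (fs ! i) [str_arr (Xs ! i) k]) [0..<?n])"
      using c fs len by (intro comp_assoc_map[symmetric]) 
       (auto simp: composable_def[of _ "fs ! _"] cmonoids_unary_iff cmonoidD map_nth[of fs, unfolded len])
    also have "\<dots> = mcomp M (?m ?n) (map (\<lambda>i. mcomp M (?m k) (replicate k (fs ! i))) [0..<?n])"
      using fs by (intro arg_cong[where f = "mcomp M (?m ?n)"] map_cong) (auto simp: cmonoids_unary_iff)
    also have "\<dots> = mcomp M (?m (?n * k)) (concat (map (\<lambda>i. replicate k (fs ! i)) [0..<?n]))"
    proof -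
      have "set gs \<subseteq> {f \<in> marr M. mtgt M f = under_obj Y}"
        if "gs \<in> set (map (\<lambda>i. replicate k (fs ! i)) [0..<?n])" for gs
        using that subsetD[OF fs' nth_mem] len by (auto simp: set_replicate_conv_if split: if_splits)
      then show ?thesis
        using str_flatten[OF Y, of "map (\<lambda>i. replicate k (fs ! i)) [0..<?n]"]
        by (simp add: o_def length_concat sum_list_triv)
    qed
    also have "\<dots> = mcomp M (?m (length ?hs)) (map ((!) ?hs) (transpose_map ?n k))"
      by (simp add: \<open>length ?hs = _\<close> \<open>map ((!) ?hs) _ = _\<close>)
    finally have "mact M (transpose_map ?n k) (concat (replicate k (map under_obj Xs))) (mcomp M ?\<alpha> (map (\<lambda>X. str_arr X k) Xs))
       = mcomp M (?m (length ?hs)) ?hs"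
      using str_permute[OF Y _ hs, of "transpose_map ?n k" "concat (replicate k (map under_obj Xs))"]
      by (simp add: \<open>length ?hs = _\<close> bijective_transpose_map map_concat srcs o_def)
    moreover have "mcomp M (?m (length ?hs)) ?hs = mcomp M (?m k) (replicate k ?\<alpha>)"
    proof -
      have "set gs \<subseteq> {f \<in> marr M. mtgt M f = under_obj Y}" if "gs \<in> set (replicate k fs)" for gs
        using that fs' by simp
      then show ?thesis
        using str_flatten[OF Y, of "replicate k fs"] by (simp add: len)
    qed
    ultimately show ?thesis by simp
  qed
  then show ?thesis
    using \<alpha> Xs Y by (simp add: cmonoids_simps(2) commutes_with_str_def)
qed

section \<open>Components of arrows of monoids\<close>

lemma cmonoids_arrD:
  assumes "(Xs, X, \<alpha>) \<in> marr (cmonoids M)"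
  shows "set Xs \<subseteq> mobj (cmonoids M)" "X \<in> mobj (cmonoids M)" "\<alpha> \<in> marr M"
    "msrc M \<alpha> = map under_obj Xs" "mtgt M \<alpha> = under_obj X" "i < length Xs \<Longrightarrow> Xs ! i \<in> mobj (cmonoids M)"
    "mcomp M (str_arr X k) (replicate k \<alpha>) =
       mact M (transpose_map (length Xs) k) (concat (replicate k (map under_obj Xs)))
         (mcomp M \<alpha> (map (\<lambda>Y. str_arr Y k) Xs))"
  using assms nth_mem[of i Xs] by (auto simp: cmonoids_simps(2) commutes_with_str_def)

lemma composable_cmonoids_arr:
  assumes "(Xs, X, \<alpha>) \<in> marr (cmonoids M)"
    and "\<And>i. i < length Xs \<Longrightarrow> f i \<in> marr M \<and> mtgt M (f i) = under_obj (Xs ! i)"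
  shows "composable M \<alpha> (map f [0..<length Xs])"
proof -
  have "map (mtgt M) (map f [0..<length Xs]) = map under_obj Xs"
    using assms(2) by (intro nth_equalityI) simp_all
  then show ?thesis
    using assms(2) cmonoids_arrD(3,4)[OF assms(1)] by (auto simp: composable_def)
qed

lemma actable_transpose_map:
  assumes "set Xs \<subseteq> mobj (cmonoids M)" "\<beta> \<in> marr M"
    "msrc M \<beta> = concat (map (\<lambda>X. replicate k (under_obj X)) Xs)"
  shows "actable M (transpose_map (length Xs) k) (concat (replicate k (map under_obj Xs))) \<beta>"
  using assms reindexes_transpose_map[of "map under_obj Xs" k]
  by (auto simp: actable_def o_def cmonoidD(1) subset_iff)

text \<open>The commutation condition composed with a matrix of arrows, whose entry
  \<open>u j i\<close> ends in \<open>Xs ! i\<close>: applying \<open>\<alpha>\<close> to the rows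
  and summing agrees with summing the columns and applying \<open>\<alpha>\<close>. The arities of
  the entries turn the transposition into its block mapping. Both facts about components below are
  instances.\<close>

lemma cmonoids_arr_interchange:
  assumes \<alpha>: "(Xs, X, \<alpha>) \<in> marr (cmonoids M)" and n: "n = length Xs"
    and u: "\<And>i j. i < n \<Longrightarrow> j < k \<Longrightarrow> u j i \<in> marr M \<and> mtgt M (u j i) = under_obj (Xs ! i)"
    and U: "U = concat (map (\<lambda>j. map (u j) [0..<n]) [0..<k])"
  shows "mcomp M (str_arr X k) (map (\<lambda>j. mcomp M \<alpha> (map (u j) [0..<n])) [0..<k]) =
    mact M (block_map (transpose_map n k) (map (length \<circ> msrc M) U)) (concat (map (msrc M) U))
      (mcomp M \<alpha> (map (\<lambda>i. mcomp M (str_arr (Xs ! i) k) (map (\<lambda>j. u j i) [0..<k])) [0..<n]))"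
proof -
  note \<alpha>' = cmonoids_arrD[OF \<alpha>]
  let ?\<beta> = "mcomp M \<alpha> (map (\<lambda>i. str_arr (Xs ! i) k) [0..<n])"
  have c: "composable M \<alpha> (map (\<lambda>i. str_arr (Xs ! i) k) [0..<n])"
    unfolding n using \<alpha>' by (intro composable_cmonoids_arr[OF \<alpha>]) (simp add: cmonoidD)
  have "map (\<lambda>i. replicate k (under_obj (Xs ! i))) [0..<n] = map (\<lambda>X. replicate k (under_obj X)) Xs"
    by (rule map_nth_upt_length) (simp add: n)
  moreover have "map (msrc M \<circ> (\<lambda>i. str_arr (Xs ! i) k)) [0..<n] = map (\<lambda>i. replicate k (under_obj (Xs ! i))) [0..<n]"
    using \<alpha>' by (intro map_cong) (auto simp: cmonoidD n)
  ultimately have act: "actable M (transpose_map n k) (concat (replicate k (map under_obj Xs))) ?\<beta>"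
    unfolding n using comp_closed[OF c] comp_src[OF c] \<alpha>'(1)
    by (intro actable_transpose_map) (simp_all add: n)
  have tgt_row: "map (mtgt M \<circ> u j) [0..<n] = map under_obj Xs" if "j < k" for j
    using u that by (intro nth_equalityI) (simp_all add: n)
  have "mcomp M (str_arr X k) (map (\<lambda>j. mcomp M \<alpha> (map (u j) [0..<n])) [0..<k])
    = mcomp M (mcomp M (str_arr X k) (map (\<lambda>_. \<alpha>) [0..<k])) U"
    unfolding U using \<alpha>' u
    by (intro comp_assoc_map) (auto simp: composable_str n intro!: composable_cmonoids_arr[OF \<alpha>])
  also have "mcomp M (str_arr X k) (map (\<lambda>_. \<alpha>) [0..<k]) =
      mact M (transpose_map n k) (concat (replicate k (map under_obj Xs))) ?\<beta>"
    using \<alpha>'(7)[of k] by (simp add: map_replicate_const n map_nth_upt_length[of Xs _ "\<lambda>X. str_arr X k"])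
  also have "mcomp M \<dots> U = mact M (block_map (transpose_map n k) (map (length \<circ> msrc M) U)) (concat (map (msrc M) U))
      (mcomp M ?\<beta> (map ((!) U) (transpose_map n k)))"
  proof (rule comp_act_fun[OF act])
    show "set U \<subseteq> marr M"
      using u by (auto simp: U)
    have "map (\<lambda>j. map (mtgt M \<circ> u j) [0..<n]) [0..<k] = map (\<lambda>j. map under_obj Xs) [0..<k]"
      by (intro map_cong) (use tgt_row in auto)
    then show "map (mtgt M) U = concat (replicate k (map under_obj Xs))"
      unfolding U map_concat map_map by (simp add: o_def map_replicate_const)
  qed
  also have "map ((!) U) (transpose_map n k) = concat (map (\<lambda>i. map (\<lambda>j. u j i) [0..<k]) [0..<n])"
    unfolding map_transpose_map
    by (intro arg_cong[where f = concat] map_cong refl) (simp add: U nth_concat_map_upt)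
  also have "mcomp M ?\<beta> \<dots> = mcomp M \<alpha> (map (\<lambda>i. mcomp M (str_arr (Xs ! i) k) (map (\<lambda>j. u j i) [0..<k])) [0..<n])"
    using c \<alpha>'(6) u by (intro comp_assoc_map[symmetric]) (auto simp: composable_str n)
  finally show ?thesis .
qed

text \<open>Row \<open>i\<close> of a unit matrix: identities play the role of 1 and nullary
  operations that of 0. Composing with it keeps variable \<open>i\<close> and sets the others to the
  neutral element.\<close>

definition unit_arrs :: "('o, 'a) cmonoid list \<Rightarrow> nat \<Rightarrow> 'a list" where
  "unit_arrs Xs i =
     map (\<lambda>l. if l = i then mid M (under_obj (Xs ! l)) else str_arr (Xs ! l) 0) [0..<length Xs]"

definition component :: "('o, 'a) cmonoid list \<Rightarrow> 'a \<Rightarrow> nat \<Rightarrow> 'a" where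
  "component Xs \<alpha> i = mcomp M \<alpha> (unit_arrs Xs i)"

lemma sources_unit_arrs:
  assumes "set Xs \<subseteq> mobj (cmonoids M)"
  shows "map (msrc M) (unit_arrs Xs i) = map (\<lambda>l. if l = i then [under_obj (Xs ! l)] else []) [0..<length Xs]"
proof -
  have "Xs ! l \<in> mobj (cmonoids M)" if "l < length Xs" for l
    using that assms nth_mem by blast
  then show ?thesis
    by (auto simp: unit_arrs_def cmonoidD id_src)
qed

lemma composable_unit_arrs:
  assumes "(Xs, X, \<alpha>) \<in> marr (cmonoids M)"
  shows "composable M \<alpha> (unit_arrs Xs i)"
  unfolding unit_arrs_def using cmonoids_arrD(6)[OF assms]
  by (intro composable_cmonoids_arr[OF assms]) (simp add: cmonoidD id_closed id_tgt)

lemma component_arr: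
  assumes "(Xs, X, \<alpha>) \<in> marr (cmonoids M)" "i < length Xs"
  shows "component Xs \<alpha> i \<in> marr M" "msrc M (component Xs \<alpha> i) = [under_obj (Xs ! i)]"
    "mtgt M (component Xs \<alpha> i) = under_obj X"
  using composable_unit_arrs[OF assms(1), of i] cmonoids_arrD[OF assms(1)]
    concat_map_if_eq[OF assms(2), of "\<lambda>l. [under_obj (Xs ! l)]"]
  by (simp_all add: component_def comp_closed comp_src comp_tgt sources_unit_arrs)

text \<open>Interchange on the unit matrix: applying \<open>\<alpha>\<close> to row \<open>j\<close>
  gives component \<open>j\<close>, while every column sums to an identity, so that the other side
  is \<open>\<alpha>\<close> acted upon by a block mapping.\<close>

lemma str_component:
  assumes \<alpha>: "(Xs, X, \<alpha>) \<in> marr (cmonoids M)"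
  shows "mcomp M (str_arr X (length Xs)) (map (component Xs \<alpha>) [0..<length Xs]) = \<alpha>"
proof -
  note \<alpha>' = cmonoids_arrD[OF \<alpha>]
  let ?n = "length Xs"
  define u where "u = (\<lambda>j l. if l = j then mid M (under_obj (Xs ! l)) else str_arr (Xs ! l) 0)"
  define U where "U = concat (map (\<lambda>j. map (u j) [0..<?n]) [0..<?n])"
  have rows: "U = concat (map (unit_arrs Xs) [0..<?n])"
    by (simp add: U_def u_def unit_arrs_def[abs_def])
  have "concat (map (msrc M) U) = concat (map (\<lambda>j. concat (map (msrc M) (unit_arrs Xs j))) [0..<?n])"
    by (simp add: rows map_concat o_def concat_concat)
  also have "\<dots> = concat (map (\<lambda>j. [under_obj (Xs ! j)]) [0..<?n])"
    using concat_map_if_eq[of _ ?n "\<lambda>l. [under_obj (Xs ! l)]"] \<alpha>'(1)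
    by (intro arg_cong[where f = concat] map_cong refl) (simp add: sources_unit_arrs)
  finally have src: "concat (map (msrc M) U) = map under_obj Xs"
    by (simp add: concat_map_singleton map_nth_upt_length)
  have "map (length \<circ> msrc M) U = concat (map (\<lambda>j. map length (map (msrc M) (unit_arrs Xs j))) [0..<?n])"
    by (simp add: rows map_concat o_def)
  also have "\<dots> = concat (map (\<lambda>j. map (\<lambda>i. if i = j then 1 else 0) [0..<?n]) [0..<?n])"
    using \<alpha>'(1) by (intro arg_cong[where f = concat] map_cong refl) (simp add: sources_unit_arrs)
  \<comment> \<open>The off-diagonal entries are nullary; what remains of the transposition is the
    identity mapping, which acts trivially by \<open>act_id\<close>.\<close>
  finally have block: "block_map (transpose_map ?n ?n) (map (length \<circ> msrc M) U) = [0..<?n]"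
    by (rule block_map_transpose_diag)
  have u: "u j i \<in> marr M \<and> mtgt M (u j i) = under_obj (Xs ! i)" if "i < ?n" for i j
    using \<alpha>'(6)[OF that] by (auto simp: u_def cmonoidD id_closed id_tgt)
  have "mcomp M (str_arr (Xs ! i) ?n) (map (\<lambda>j. u j i) [0..<?n]) = mid M (under_obj (Xs ! i))" if "i < ?n" for i
  proof -
    have eq: "map (\<lambda>j. u j i) [0..<?n] = map (\<lambda>l. if l = i then mid M (under_obj (Xs ! i)) else str_arr (Xs ! i) 0) [0..<?n]"
      by (auto simp: u_def)
    show ?thesis
      unfolding eq using cmonoidD(1)[OF \<alpha>'(6)[OF that]]
      by (intro str_unit[OF \<alpha>'(6)[OF that] _ _ that]) (simp_all add: id_closed id_tgt)
  qed
  then have "map (\<lambda>i. mcomp M (str_arr (Xs ! i) ?n) (map (\<lambda>j. u j i) [0..<?n])) [0..<?n] = map (mid M) (msrc M \<alpha>)"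
    by (auto simp: \<alpha>'(4) intro: nth_equalityI)
  then have "mcomp M (str_arr X ?n) (map (\<lambda>j. mcomp M \<alpha> (map (u j) [0..<?n])) [0..<?n]) = \<alpha>"
    using cmonoids_arr_interchange[OF \<alpha> refl u U_def] comp_id[OF \<alpha>'(3)] act_id[OF \<alpha>'(3)] \<alpha>'(4)
    by (simp add: block src)
  then show ?thesis
    by (simp add: component_def[abs_def] unit_arrs_def u_def)
qed

text \<open>Interchange on the matrix with \<open>k\<close> rows equal to
  \<open>unit_arrs Xs i\<close>: column \<open>i\<close> sums to the k-ary operation of
  \<open>Xs ! i\<close>, every other column to a neutral element. Inserting that operation into the
  component produces the same arguments of \<open>\<alpha>\<close>.\<close>

lemma component_closed:
  assumes \<alpha>: "(Xs, X, \<alpha>) \<in> marr (cmonoids M)" and i: "i < length Xs"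
  shows "([Xs ! i], X, component Xs \<alpha> i) \<in> marr (cmonoids M)"
proof -
  note \<alpha>' = cmonoids_arrD[OF \<alpha>]
  let ?n = "length Xs"
  note Xi = cmonoidD[OF \<alpha>'(6)[OF i]]
  have "mcomp M (str_arr X k) (replicate k (component Xs \<alpha> i)) = mcomp M (component Xs \<alpha> i) [str_arr (Xs ! i) k]" for k
  proof -
    define u where "u = (\<lambda>j :: nat. \<lambda>l. if l = i then mid M (under_obj (Xs ! l)) else str_arr (Xs ! l) 0)"
    define U where "U = concat (map (\<lambda>j. map (u j) [0..<?n]) [0..<k])"
    have rows: "U = concat (replicate k (unit_arrs Xs i))"
      by (simp add: U_def u_def unit_arrs_def map_replicate_const)
    have src: "concat (map (msrc M) U) = replicate k (under_obj (Xs ! i))"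
    proof -
      have "concat (map (msrc M) U) = concat (replicate k (concat (map (msrc M) (unit_arrs Xs i))))"
        unfolding rows by (induction k) auto
      then show ?thesis
        using concat_map_if_eq[OF i, of "\<lambda>l. [under_obj (Xs ! l)]"] \<alpha>'(1)
        by (simp add: sources_unit_arrs concat_replicate_singleton)
    qed
    have "map (length \<circ> msrc M) U = concat (replicate k (map length (map (msrc M) (unit_arrs Xs i))))"
      by (simp add: rows map_concat o_def)
    also have "map length (map (msrc M) (unit_arrs Xs i)) = map (\<lambda>l. if l = i then 1 else 0) [0..<?n]"
      using \<alpha>'(1) by (simp add: sources_unit_arrs)
    finally have block: "block_map (transpose_map ?n k) (map (length \<circ> msrc M) U) = [0..<k]"
      using i by (rule block_map_transpose_column)
    have u: "u j i \<in> marr M \<and> mtgt M (u j i) = under_obj (Xs ! i)" if "i < ?n" for i j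
      using \<alpha>'(6)[OF that] by (auto simp: u_def cmonoidD id_closed id_tgt)
    let ?v = "\<lambda>l. if l = i then str_arr (Xs ! l) k else str_arr (Xs ! l) 0"
    let ?w = "\<lambda>l. if l = i then [str_arr (Xs ! l) k] else []"
    \<comment> \<open>A sum of \<open>k\<close> identities is the k-ary operation, and a sum of
      \<open>k\<close> neutral elements is the neutral element; both are instances of the
      composition law of the structure arrows.\<close>
    have col: "mcomp M (str_arr (Xs ! l) k) (map (\<lambda>j. u j l) [0..<k]) = ?v l" if "l < ?n" for l
    proof (cases "l = i")
      case True
      then have "map (\<lambda>j. u j l) [0..<k] = map (str_arr (Xs ! l)) (replicate k 1)"
        using Xi by (simp add: u_def map_replicate_const)
      then show ?thesis
        using cmonoidD(6)[OF \<alpha>'(6)[OF that], of "replicate k 1" k] True by (simp add: sum_list_replicate)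
    next
      case False
      then have "map (\<lambda>j. u j l) [0..<k] = map (str_arr (Xs ! l)) (replicate k 0)"
        by (simp add: u_def map_replicate_const)
      then show ?thesis
        using cmonoidD(6)[OF \<alpha>'(6)[OF that], of "replicate k 0" k] False by (simp add: sum_list_replicate)
    qed
    \<comment> \<open>The rows are all equal, so row 0 stands for any of them, also when
      \<open>k = 0\<close>.\<close>
    have v: "mcomp M (u 0 l) (?w l) = ?v l" if "l < ?n" for l
      using \<alpha>'(6)[OF that] cmonoidD[OF \<alpha>'(6)[OF that]] id_comp[of "str_arr (Xs ! l) k"]
      by (auto simp: u_def comp_nil)
    have c: "composable M \<alpha> (map ?v [0..<?n])"
      using \<alpha>'(6) by (intro composable_cmonoids_arr[OF \<alpha>]) (simp add: cmonoidD)
    have "mcomp M (component Xs \<alpha> i) [str_arr (Xs ! i) k]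
      = mcomp M (mcomp M \<alpha> (map (u 0) [0..<?n])) (concat (map ?w [0..<?n]))"
      using concat_map_if_eq[OF i, of "\<lambda>l. [str_arr (Xs ! l) k]"]
      by (simp add: component_def unit_arrs_def u_def)
    also have "\<dots> = mcomp M \<alpha> (map (\<lambda>l. mcomp M (u 0 l) (?w l)) [0..<?n])"
    proof (intro comp_assoc_map[symmetric] composable_cmonoids_arr[OF \<alpha>])
      fix l assume "l \<in> set [0..<?n]"
      then show "composable M (u 0 l) (?w l)"
        using \<alpha>'(6)[of l] cmonoidD[OF \<alpha>'(6)[of l]] by (auto simp: u_def composable_def id_closed id_src)
    qed (use u in auto)
    also have "\<dots> = mcomp M \<alpha> (map ?v [0..<?n])"
      using v by (intro arg_cong[where f = "mcomp M \<alpha>"] map_cong) auto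
    finally have rhs: "mcomp M (component Xs \<alpha> i) [str_arr (Xs ! i) k] = mcomp M \<alpha> (map ?v [0..<?n])" .
    have "mcomp M (str_arr X k) (replicate k (component Xs \<alpha> i))
      = mcomp M (str_arr X k) (map (\<lambda>j. mcomp M \<alpha> (map (u j) [0..<?n])) [0..<k])"
      by (simp add: component_def unit_arrs_def u_def map_replicate_const)
    also have "\<dots> = mact M [0..<k] (replicate k (under_obj (Xs ! i)))
      (mcomp M \<alpha> (map (\<lambda>i. mcomp M (str_arr (Xs ! i) k) (map (\<lambda>j. u j i) [0..<k])) [0..<?n]))"
      using cmonoids_arr_interchange[OF \<alpha> refl u U_def] by (simp add: block src)
    also have "map (\<lambda>i. mcomp M (str_arr (Xs ! i) k) (map (\<lambda>j. u j i) [0..<k])) [0..<?n] = map ?v [0..<?n]"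
      using col by (intro map_cong) auto
    also have "mact M [0..<k] (replicate k (under_obj (Xs ! i))) (mcomp M \<alpha> (map ?v [0..<?n])) = mcomp M \<alpha> (map ?v [0..<?n])"
    proof -
      have "composable M (component Xs \<alpha> i) [str_arr (Xs ! i) k]"
        using component_arr[OF \<alpha> i] Xi by (simp add: composable_def)
      then have "msrc M (mcomp M \<alpha> (map ?v [0..<?n])) = replicate k (under_obj (Xs ! i))"
        unfolding rhs[symmetric] using Xi by (simp add: comp_src)
      then show ?thesis
        using act_id[OF comp_closed[OF c]] by simp
    qed
    finally show ?thesis using rhs by simp
  qed
  then show ?thesis
    using component_arr[OF \<alpha> i] \<alpha>' i by (simp add: cmonoids_unary_iff)
qed

section \<open>The cartesian multicategory of commutative monoids\<close>

text \<open>Distributivity: morphisms preserve the inner sums, and nested sums are flattened. The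
  order of the summands is that of composition in \<open>seq_multicat\<close>, so this serves
  closure under composition and also the functoriality of \<open>sum_functor\<close>.\<close>

lemma cmonoids_comp_sum:
  assumes f: "\<And>i. i < n \<Longrightarrow> ([Xs ! i], Y, f i) \<in> marr (cmonoids M)" and Y: "Y \<in> mobj (cmonoids M)"
    and g: "\<And>i. i < n \<Longrightarrow> set (g i) \<subseteq> {h \<in> marr M. mtgt M h = under_obj (Xs ! i)}"
    and hs: "hs = concat (map (\<lambda>i. map (\<lambda>h. mcomp M (f i) [h]) (g i)) [0..<n])"
  shows "mcomp M (mcomp M (str_arr Y n) (map f [0..<n]))
      (map (\<lambda>i. mcomp M (str_arr (Xs ! i) (length (g i))) (g i)) [0..<n])
    = mcomp M (str_arr Y (length hs)) hs"
proof -
  note f' = f[unfolded cmonoids_unary_iff]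
  have cg: "composable M (str_arr (Xs ! i) (length (g i))) (g i)" if "i < n" for i
    using f'[OF that] g[OF that] by (simp add: composable_str)
  have "mcomp M (mcomp M (str_arr Y n) (map f [0..<n]))
      (concat (map (\<lambda>i. [mcomp M (str_arr (Xs ! i) (length (g i))) (g i)]) [0..<n]))
    = mcomp M (str_arr Y n) (map (\<lambda>i. mcomp M (f i) [mcomp M (str_arr (Xs ! i) (length (g i))) (g i)]) [0..<n])"
    using f' Y cg by (intro comp_assoc_map[symmetric])
      (auto simp: composable_str composable_def[of _ "f _"] comp_closed comp_tgt cmonoidD)
  also have "map (\<lambda>i. mcomp M (f i) [mcomp M (str_arr (Xs ! i) (length (g i))) (g i)]) [0..<n]
    = map (\<lambda>i. mcomp M (str_arr Y (length (g i))) (map (\<lambda>h. mcomp M (f i) [h]) (g i))) [0..<n]"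
    using f g by (intro map_cong cmonoids_unary_comp_str refl) auto
  also have "mcomp M (str_arr Y n) \<dots> = mcomp M (str_arr Y (length hs)) hs"
  proof -
    have "mcomp M (f i) [h] \<in> marr M \<and> mtgt M (mcomp M (f i) [h]) = under_obj Y" if "i < n" "h \<in> set (g i)" for i h
    proof -
      have "composable M (f i) [h]"
        using f'[OF that(1)] g[OF that(1)] that(2) by (auto simp: composable_def)
      then show ?thesis
        using f'[OF that(1)] by (simp add: comp_closed comp_tgt)
    qed
    then have "set fs \<subseteq> {h \<in> marr M. mtgt M h = under_obj Y}"
      if "fs \<in> set (map (\<lambda>i. map (\<lambda>h. mcomp M (f i) [h]) (g i)) [0..<n])" for fs
      using that by auto
    then show ?thesis
      using str_flatten[OF Y, of "map (\<lambda>i. map (\<lambda>h. mcomp M (f i) [h]) (g i)) [0..<n]"]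
      by (simp add: hs o_def)
  qed
  finally show ?thesis
    by (simp add: concat_map_singleton)
qed

lemma cmonoids_unary_comp:
  assumes f: "([X], Y, f) \<in> marr (cmonoids M)" and g: "([Z], X, g) \<in> marr (cmonoids M)"
  shows "([Z], Y, mcomp M f [g]) \<in> marr (cmonoids M)"
proof -
  note f' = f[unfolded cmonoids_unary_iff] and g' = g[unfolded cmonoids_unary_iff]
  have c: "composable M f [g]" 
    using f' g' by (simp add: composable_def)
  have "mcomp M (str_arr Y k) (replicate k (mcomp M f [g])) = mcomp M (mcomp M f [g]) [str_arr Z k]" for k
  proof -
    have "mcomp M (str_arr Y k) (replicate k (mcomp M f [g])) = mcomp M f [mcomp M g [str_arr Z k]]"
      using cmonoids_unary_comp_str[OF f, of "replicate k g"] g' by (auto simp: set_replicate_conv_if)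
    then show ?thesis
      using c g' by (simp add: comp_single_assoc composable_def cmonoidD)
  qed
  then show ?thesis
    using f' g' comp_closed[OF c] comp_src[OF c] comp_tgt[OF c] by (simp add: cmonoids_unary_iff)
qed

text \<open>A direct proof would have to compose transpositions. Instead all arrows are replaced by
  the sums of their components; the composite is then a sum of unary morphisms, hence an arrow of
  monoids by \<open>str_sum_commutes\<close>.\<close>

lemma cmonoids_arr_comp:
  assumes \<alpha>: "(Xs, X, \<alpha>) \<in> marr (cmonoids M)"
    and gs: "set gs \<subseteq> marr (cmonoids M)" "map (\<lambda>g. fst (snd g)) gs = Xs"
  shows "(concat (map fst gs), X, mcomp M \<alpha> (map under_arr gs)) \<in> marr (cmonoids M)"
proof -
  define n where "n = length Xs"
  have n: "length gs = n"
    using gs(2) by (auto simp: n_def)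
  define g where "g = (\<lambda>i. map (component (fst (gs ! i)) (under_arr (gs ! i))) [0..<length (fst (gs ! i))])"
  have X: "X \<in> mobj (cmonoids M)"
    using cmonoids_arrD[OF \<alpha>] by simp
  have gi: "(fst (gs ! i), Xs ! i, under_arr (gs ! i)) \<in> marr (cmonoids M)" if "i < n" for i
    using that gs nth_mem[of i gs] by (auto simp: n)
  have comp: "([Xs ! i], X, component Xs \<alpha> i) \<in> marr (cmonoids M)" if "i < n" for i
    using component_closed[OF \<alpha>] that by (simp add: n_def)
  have gset: "set (g i) \<subseteq> {h \<in> marr M. mtgt M h = under_obj (Xs ! i)}" if "i < n" for i
    using component_arr[OF gi[OF that]] by (auto simp: g_def)
  let ?hs = "concat (map (\<lambda>i. map (\<lambda>h. mcomp M (component Xs \<alpha> i) [h]) (g i)) [0..<n])"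
  have "map (\<lambda>i. mcomp M (str_arr (Xs ! i) (length (g i))) (g i)) [0..<n] = map under_arr gs"
    using str_component[OF gi] by (intro nth_equalityI) (simp_all add: n g_def)
  then have eq: "mcomp M \<alpha> (map under_arr gs) = mcomp M (str_arr X (length ?hs)) ?hs"
    using cmonoids_comp_sum[where n = n, OF comp X gset refl] str_component[OF \<alpha>] by (simp add: n_def)
  have "list_all2 (\<lambda>Z h. ([Z], X, h) \<in> marr (cmonoids M)) (fst (gs ! i))
      (map (\<lambda>h. mcomp M (component Xs \<alpha> i) [h]) (g i))" if "i < n" for i
    using cmonoids_unary_comp[OF comp[OF that] component_closed[OF gi[OF that]]]
    by (simp add: list_all2_conv_all_nth g_def)
  then have "list_all2 (list_all2 (\<lambda>Z h. ([Z], X, h) \<in> marr (cmonoids M))) (map fst gs)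
      (map (\<lambda>i. map (\<lambda>h. mcomp M (component Xs \<alpha> i) [h]) (g i)) [0..<n])"
    by - (rule list_all2_all_nthI, simp_all add: n)
  then have l: "list_all2 (\<lambda>Z h. ([Z], X, h) \<in> marr (cmonoids M)) (concat (map fst gs)) ?hs"
    by (rule concat_transfer[THEN rel_funD])
  show ?thesis
    using str_sum_commutes[OF l X] list_all2_lengthD[OF l] unfolding eq by simp
qed

text \<open>By \<open>comp_act_args\<close> and \<open>comp_act_fun\<close> both sides of the
  commutation condition become actions on the same arrow, \<open>\<alpha>\<close> composed with
  k-ary operations; the two mappings agree by \<open>transpose_map_natural\<close>.\<close>

lemma cmonoids_arr_act:
  assumes \<alpha>: "(Xs, X, \<alpha>) \<in> marr (cmonoids M)"
    and Ys: "set Ys \<subseteq> mobj (cmonoids M)" and \<sigma>: "reindexes \<sigma> Xs Ys"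
  shows "actable M \<sigma> (map under_obj Ys) \<alpha>" "(Ys, X, mact M \<sigma> (map under_obj Ys) \<alpha>) \<in> marr (cmonoids M)"
proof -
  note \<alpha>' = cmonoids_arrD[OF \<alpha>]
  have \<sigma>Ys: "set \<sigma> \<subseteq> {..<length Ys}" "map ((!) Ys) \<sigma> = Xs"
    using \<sigma> by (auto simp: reindexes_def)
  note \<sigma>map = map_nth_map[OF \<sigma>Ys(1), unfolded \<sigma>Ys(2)]
  have \<sigma>': "reindexes \<sigma> (map under_obj Xs) (map under_obj Ys)"
    using \<sigma>Ys by (simp add: reindexes_def \<sigma>map)
  show act: "actable M \<sigma> (map under_obj Ys) \<alpha>"
    using \<sigma>' Ys \<alpha>' by (auto simp: actable_def cmonoidD(1) subset_iff)
  let ?n = "length Xs" and ?m = "length Ys" and ?B = "\<lambda>k. concat (replicate k (map under_obj Ys))"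
  have len: "length \<sigma> = ?n"
    using \<sigma> by (rule length_reindexes)
  have "mcomp M (str_arr X k) (replicate k (mact M \<sigma> (map under_obj Ys) \<alpha>)) =
      mact M (transpose_map ?m k) (?B k) (mcomp M (mact M \<sigma> (map under_obj Ys) \<alpha>) (map (\<lambda>Y. str_arr Y k) Ys))" for k
  proof -
    let ?\<beta> = "mcomp M \<alpha> (map (\<lambda>X. str_arr X k) Xs)" and ?J = "juxtapose (replicate k (\<sigma>, ?m))"
    let ?Ds = "concat (map (\<lambda>Y. replicate k (under_obj Y)) Ys)"
    have c: "composable M \<alpha> (map (\<lambda>X. str_arr X k) Xs)"
      using \<alpha>' by (auto simp: composable_def cmonoidD subset_iff)
    have srcs: "map (msrc M \<circ> (\<lambda>X. str_arr X k)) Xs = map (\<lambda>X. replicate k (under_obj X)) Xs"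
      "map (msrc M \<circ> (\<lambda>Y. str_arr Y k)) Ys = map (\<lambda>X. replicate k (under_obj X)) Ys"
      using \<alpha>'(1) Ys by (auto simp: cmonoidD)
    have \<beta>: "?\<beta> \<in> marr M" "msrc M ?\<beta> = concat (map (\<lambda>X. replicate k (under_obj X)) Xs)"
      using comp_closed[OF c] comp_src[OF c] by (simp_all add: srcs)
    have B: "set (?B k) \<subseteq> mobj M"
      using Ys by (auto simp: cmonoidD(1) subset_iff)
    have "mcomp M (str_arr X k) (replicate k (mact M \<sigma> (map under_obj Ys) \<alpha>))
      = mact M ?J (?B k) (mcomp M (str_arr X k) (replicate k \<alpha>))"
    proof -
      have c: "composable M (str_arr X k) (replicate k \<alpha>)"
        using \<alpha>' by (simp add: composable_str set_replicate_conv_if)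
      have row: "map (\<lambda>i. mact M (replicate k \<sigma> ! i) (replicate k (map under_obj Ys) ! i) (replicate k \<alpha> ! i)) [0..<k]
        = replicate k (mact M \<sigma> (map under_obj Ys) \<alpha>)"
        by (simp add: map_eq_replicate_iff)
      from comp_act_args[OF c, of "replicate k \<sigma>" "replicate k (map under_obj Ys)"] show ?thesis
        using act by (simp add: zip_replicate row)
    qed
    also have "\<dots> = mact M ?J (?B k) (mact M (transpose_map ?n k) (concat (replicate k (map under_obj Xs))) ?\<beta>)"
      using \<alpha>'(7) by simp
    also have "\<dots> = mact M (map ((!) ?J) (transpose_map ?n k)) (?B k) ?\<beta>"
    proof (rule act_act[OF actable_transpose_map[OF \<alpha>'(1) \<beta>] B])
      show "reindexes ?J (concat (replicate k (map under_obj Xs))) (?B k)"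
        using reindexes_juxtapose[of "replicate k \<sigma>" "replicate k (map under_obj Xs)" "replicate k (map under_obj Ys)"] \<sigma>'
        by (simp add: map_replicate_const zip_replicate)
    qed
    also have "\<dots> = mact M (map ((!) (transpose_map ?m k)) (block_map \<sigma> (replicate ?m k))) (?B k) ?\<beta>"
      using transpose_map_natural[OF \<sigma>Ys(1) len] by simp
    also have "\<dots> = mact M (transpose_map ?m k) (?B k) (mact M (block_map \<sigma> (replicate ?m k)) ?Ds ?\<beta>)"
    proof (rule act_act[symmetric, OF _ B])
      have "reindexes (block_map \<sigma> (replicate ?m k)) (concat (map (\<lambda>X. replicate k (under_obj X)) Xs)) ?Ds"
        using reindexes_block_map[of \<sigma> "map (\<lambda>Y. replicate k (under_obj Y)) Ys"] \<sigma>Ys(1)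
        by (simp add: o_def map_replicate_const \<sigma>map)
      then show "actable M (block_map \<sigma> (replicate ?m k)) ?Ds ?\<beta>"
        using \<beta> Ys by (auto simp: actable_def cmonoidD(1) subset_iff)
      show "reindexes (transpose_map ?m k) ?Ds (?B k)"
        using reindexes_transpose_map[of "map under_obj Ys" k] by (simp add: o_def)
    qed
    also have "mact M (block_map \<sigma> (replicate ?m k)) ?Ds ?\<beta>
      = mcomp M (mact M \<sigma> (map under_obj Ys) \<alpha>) (map (\<lambda>Y. str_arr Y k) Ys)"
    proof -
      have lens: "map (length \<circ> msrc M) (map (\<lambda>Y. str_arr Y k) Ys) = replicate ?m k"
        using Ys by (auto simp: map_eq_replicate_iff cmonoidD)
      have "mcomp M (mact M \<sigma> (map under_obj Ys) \<alpha>) (map (\<lambda>Y. str_arr Y k) Ys)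
        = mact M (block_map \<sigma> (map (length \<circ> msrc M) (map (\<lambda>Y. str_arr Y k) Ys)))
            (concat (map (msrc M) (map (\<lambda>Y. str_arr Y k) Ys)))
            (mcomp M \<alpha> (map ((!) (map (\<lambda>Y. str_arr Y k) Ys)) \<sigma>))"
        using Ys by (intro comp_act_fun[OF act]) (auto simp: cmonoidD)
      then show ?thesis
        unfolding lens by (simp add: srcs \<sigma>map)
    qed
    finally show ?thesis .
  qed
  then show "(Ys, X, mact M \<sigma> (map under_obj Ys) \<alpha>) \<in> marr (cmonoids M)"
    using act_closed[OF act] act_src[OF act] act_tgt[OF act] Ys \<alpha>'
    by (simp add: cmonoids_simps(2) commutes_with_str_def)
qed

lemma composable_cmonoidsD:
  assumes "composable (cmonoids M) f gs"
  shows "composable M (under_arr f) (map under_arr gs)" "f \<in> marr (cmonoids M)" "set gs \<subseteq> marr (cmonoids M)"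
    "map (\<lambda>g. fst (snd g)) gs = fst f"
proof -
  show *: "f \<in> marr (cmonoids M)" "set gs \<subseteq> marr (cmonoids M)" "map (\<lambda>g. fst (snd g)) gs = fst f"
    using assms by (auto simp: composable_def cmonoids_simps)
  have f: "msrc M (under_arr f) = map under_obj (fst f)" "under_arr f \<in> marr M"
    using cmonoids_arrD[of "fst f" "fst (snd f)" "under_arr f"] *(1) by auto
  have g: "mtgt M (under_arr g) = under_obj (fst (snd g))" "under_arr g \<in> marr M" if "g \<in> set gs" for g
    using cmonoids_arrD[of "fst g" "fst (snd g)" "under_arr g"] *(2) that by auto
  show "composable M (under_arr f) (map under_arr gs)"
    using g f by (auto simp: composable_def *(3)[symmetric])
qed

lemma actable_cmonoidsD:
  assumes "actable (cmonoids M) \<sigma> Ys f"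
  shows "actable M \<sigma> (map under_obj Ys) (under_arr f)"
    "mact (cmonoids M) \<sigma> Ys f \<in> marr (cmonoids M)"
proof -
  have *: "(fst f, fst (snd f), under_arr f) \<in> marr (cmonoids M)" "set Ys \<subseteq> mobj (cmonoids M)" "reindexes \<sigma> (fst f) Ys"
    using assms by (auto simp: actable_def cmonoids_simps(3))
  then show "actable M \<sigma> (map under_obj Ys) (under_arr f)"
    "mact (cmonoids M) \<sigma> Ys f \<in> marr (cmonoids M)"
    using cmonoids_arr_act[OF *] by (auto simp: cmonoids_simps(7))
qed

lemma cmonoids_arr_cases:
  assumes "f \<in> marr (cmonoids M)"
  obtains Xs X \<alpha> where "f = (Xs, X, \<alpha>)" "(Xs, X, \<alpha>) \<in> marr (cmonoids M)"
  using assms by (metis prod_cases3)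

text \<open>The content lies in the closure properties above. Each equation is that of
  \<open>M\<close> for the underlying arrows, since the triples carry their sources and targets
  along.\<close>

lemma cmonoids_cartesian: "cartesian_multicategory (cmonoids M)"
proof
  let ?C = "cmonoids M"
  show "set (msrc ?C f) \<subseteq> mobj ?C" "mtgt ?C f \<in> mobj ?C" if "f \<in> marr ?C" for f
    using that cmonoids_arrD(1,2)[of "fst f" "fst (snd f)" "under_arr f"] by (auto simp: cmonoids_simps(3,4))
  show "mid ?C X \<in> marr ?C" if "X \<in> mobj ?C" for X
    using that cmonoidD(1-4)[OF that] comp_id[OF cmonoidD(2)[OF that]] id_comp[OF cmonoidD(2)[OF that]]
    by (simp add: cmonoids_simps(5) cmonoids_unary_iff id_closed id_src id_tgt)
  show "msrc ?C (mid ?C X) = [X]" "mtgt ?C (mid ?C X) = X" for X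
    by (simp_all add: cmonoids_simps(3-5))
  show "mcomp ?C f gs \<in> marr ?C" if "composable ?C f gs" for f gs
    using composable_cmonoidsD[OF that] cmonoids_arr_comp[of "fst f" "fst (snd f)" "under_arr f" gs]
    by (simp add: cmonoids_simps(6))
  show "msrc ?C (mcomp ?C f gs) = concat (map (msrc ?C) gs)" for f gs
    by (simp add: cmonoids_simps(3,6) cong: map_cong)
  show "mtgt ?C (mcomp ?C f gs) = mtgt ?C f" for f gs
    by (simp add: cmonoids_simps(4,6))
  show "mcomp ?C f (map (mid ?C) (msrc ?C f)) = f" if "f \<in> marr ?C" for f
    by (rule cmonoids_arr_cases[OF that])
       (use comp_id cmonoids_arrD(3,4) in \<open>force simp: cmonoids_simps(3,5,6) o_def\<close>)
  show "mcomp ?C (mid ?C (mtgt ?C f)) [f] = f" if "f \<in> marr ?C" for f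
    by (rule cmonoids_arr_cases[OF that])
       (use id_comp cmonoids_arrD(3,5) in \<open>force simp: cmonoids_simps(4,5,6)\<close>)
  show "mcomp ?C f (map2 (mcomp ?C) gs hss) = mcomp ?C (mcomp ?C f gs) (concat hss)"
    if "composable ?C f gs" "list_all2 (composable ?C) gs hss" for f gs hss
  proof -
    have "list_all2 (composable M) (map under_arr gs) (map (map under_arr) hss)"
      using that(2) composable_cmonoidsD(1) by (auto simp: list_all2_conv_all_nth)
    then have "mcomp M (under_arr f) (map2 (mcomp M) (map under_arr gs) (map (map under_arr) hss))
      = mcomp M (mcomp M (under_arr f) (map under_arr gs)) (concat (map (map under_arr) hss))"
      using comp_assoc[OF composable_cmonoidsD(1)[OF that(1)]] by blast
    moreover have "map2 (mcomp M) (map under_arr gs) (map (map under_arr) hss) = map under_arr (map2 (mcomp ?C) gs hss)"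
      by (auto simp: zip_map_map cmonoids_simps(6))
    moreover have "map fst (map2 (mcomp ?C) gs hss) = map (concat \<circ> map fst) hss"
      using list_all2_lengthD[OF that(2)] by (intro nth_equalityI) (auto simp: cmonoids_simps(6))
    ultimately show ?thesis
      by (simp add: cmonoids_simps(6) map_concat concat_concat o_def del: map_map)
         (simp add: o_def)
  qed
  show "mact ?C \<sigma> Ys f \<in> marr ?C" if "actable ?C \<sigma> Ys f" for \<sigma> Ys f
    using actable_cmonoidsD[OF that] by simp
  show "msrc ?C (mact ?C \<sigma> Ys f) = Ys" "mtgt ?C (mact ?C \<sigma> Ys f) = mtgt ?C f" for \<sigma> Ys f
    by (simp_all add: cmonoids_simps(3,4,7))
  show "mact ?C [0..<length (msrc ?C f)] (msrc ?C f) f = f" if "f \<in> marr ?C" for f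
    by (rule cmonoids_arr_cases[OF that])
       (use act_id cmonoids_arrD(3,4) in \<open>force simp: cmonoids_simps(3,7)\<close>)
  show "mact ?C \<rho> Zs (mact ?C \<sigma> Ys f) = mact ?C (map ((!) \<rho>) \<sigma>) Zs f"
    if "actable ?C \<sigma> Ys f" "set Zs \<subseteq> mobj ?C" "reindexes \<rho> Ys Zs" for \<sigma> Ys f \<rho> Zs
  proof -
    have "reindexes \<rho> (map under_obj Ys) (map under_obj Zs)" 
      using that(3) by (auto simp: reindexes_def subset_iff)
    moreover have "set (map under_obj Zs) \<subseteq> mobj M"
      using that(2) cmonoidD(1) by auto
    ultimately show ?thesis
      using act_act[OF actable_cmonoidsD(1)[OF that(1)]] by (simp add: cmonoids_simps(7))
  qed
  show "mcomp ?C f (map (\<lambda>i. mact ?C (\<sigma>s ! i) (Yss ! i) (fs ! i)) [0..<length fs])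
      = mact ?C (juxtapose (zip \<sigma>s (map length Yss))) (concat Yss) (mcomp ?C f fs)"
    if "composable ?C f fs" "length \<sigma>s = length fs" "length Yss = length fs"
      "\<forall>i<length fs. actable ?C (\<sigma>s ! i) (Yss ! i) (fs ! i)" for f fs \<sigma>s Yss
  proof -
    have "concat (map ((!) Yss) [0..<length fs]) = concat Yss"
      using that(3) by (metis map_nth)
    moreover have "mcomp M (under_arr f) (map (\<lambda>i. mact M (\<sigma>s ! i) (map under_obj (Yss ! i)) (under_arr (fs ! i))) [0..<length fs])
      = mact M (juxtapose (zip \<sigma>s (map length Yss))) (map under_obj (concat Yss)) (mcomp M (under_arr f) (map under_arr fs))"
    proof -
      have row: "map (\<lambda>i. mact M (\<sigma>s ! i) (map (map under_obj) Yss ! i) (map under_arr fs ! i)) [0..<length fs]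
        = map (\<lambda>i. mact M (\<sigma>s ! i) (map under_obj (Yss ! i)) (under_arr (fs ! i))) [0..<length fs]"
        using that(3) by simp
      have act: "\<forall>i<length fs. actable M (\<sigma>s ! i) (map (map under_obj) Yss ! i) (map under_arr fs ! i)"
        using that(3,4) actable_cmonoidsD(1) by simp
      have "map length (map (map under_obj) Yss) = map length Yss"
        by simp
      then show ?thesis
        using comp_act_args[OF composable_cmonoidsD(1)[OF that(1)], of \<sigma>s "map (map under_obj) Yss",
          unfolded length_map row, OF that(2,3) act]
        by (simp only: map_concat)
    qed
    ultimately show ?thesis
      by (simp add: cmonoids_simps(6,7) o_def)
  qed
  show "mcomp ?C (mact ?C \<sigma> Ys f) fs
      = mact ?C (block_map \<sigma> (map (length \<circ> msrc ?C) fs)) (concat (map (msrc ?C) fs)) (mcomp ?C f (map ((!) fs) \<sigma>))"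
    if act: "actable ?C \<sigma> Ys f" and fs: "set fs \<subseteq> marr ?C" "map (mtgt ?C) fs = Ys" for \<sigma> Ys f fs
  proof -
    have g: "under_arr g \<in> marr M \<and> msrc M (under_arr g) = map under_obj (fst g) \<and> mtgt M (under_arr g) = under_obj (fst (snd g))"
      if "g \<in> set fs" for g
      using cmonoids_arrD[of "fst g" "fst (snd g)" "under_arr g"] fs(1) that by auto
    have \<sigma>: "map ((!) (map under_arr fs)) \<sigma> = map under_arr (map ((!) fs) \<sigma>)"
    proof (rule map_nth_map)
      show "set \<sigma> \<subseteq> {..<length fs}"
        using act arg_cong[OF fs(2), of length] by (simp add: actable_def reindexes_def)
    qed
    have len: "map (length \<circ> msrc M) (map under_arr fs) = map (length \<circ> msrc ?C) fs"
      using g by (simp add: cmonoids_simps(3))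
    have src: "concat (map (msrc M) (map under_arr fs)) = map under_obj (concat (map (msrc ?C) fs))"
      unfolding map_concat using g by (intro arg_cong[where f = concat]) (simp add: cmonoids_simps(3))
    have "mcomp M (mact M \<sigma> (map under_obj Ys) (under_arr f)) (map under_arr fs)
      = mact M (block_map \<sigma> (map (length \<circ> msrc ?C) fs)) (map under_obj (concat (map (msrc ?C) fs)))
         (mcomp M (under_arr f) (map under_arr (map ((!) fs) \<sigma>)))"
    proof (rule comp_act_fun[OF actable_cmonoidsD(1)[OF act], of "map under_arr fs", unfolded len src \<sigma>])
      show "set (map under_arr fs) \<subseteq> marr M" "map (mtgt M) (map under_arr fs) = map under_obj Ys"
        using g by (auto simp: fs(2)[symmetric] cmonoids_simps(4))
    qed
    then show ?thesis
      by (simp add: cmonoids_simps(6,7) cmonoids_simps(3))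
  qed
qed

end

section \<open>Sequential multicategories\<close>

lemma unary_cat_simps:
  "cobj (unary_cat M) = mobj M" "carr (unary_cat M) = {f \<in> marr M. length (msrc M f) = 1}"
  "csrc (unary_cat M) f = hd (msrc M f)" "ctgt (unary_cat M) = mtgt M"
  "cid (unary_cat M) = mid M" "ccomp (unary_cat M) g f = mcomp M g [f]"
  by (simp_all add: unary_cat_def)

lemma chom_unary_cat: "chom (unary_cat M) X Y = {f \<in> marr M. msrc M f = [X] \<and> mtgt M f = Y}"
  by (auto simp: chom_def unary_cat_simps length_Suc_conv)

lemma (in multicategory) category_unary_cat: "category (unary_cat M)"
proof
  have c: "composable M g [f]" if "f \<in> chom (unary_cat M) X Y" "g \<in> chom (unary_cat M) Y Z" for f g X Y Z
    using that by (simp add: composable_def chom_unary_cat)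
  show "csrc (unary_cat M) f \<in> cobj (unary_cat M)" "ctgt (unary_cat M) f \<in> cobj (unary_cat M)"
    if "f \<in> carr (unary_cat M)" for f
    using that src_closed[of f] tgt_closed[of f] by (auto simp: unary_cat_simps length_Suc_conv)
  show "cid (unary_cat M) X \<in> chom (unary_cat M) X X" if "X \<in> cobj (unary_cat M)" for X
    using that by (simp add: unary_cat_simps chom_unary_cat id_closed id_src id_tgt)
  show "ccomp (unary_cat M) g f \<in> chom (unary_cat M) X Z"
    if "f \<in> chom (unary_cat M) X Y" "g \<in> chom (unary_cat M) Y Z" for f g X Y Z
    using c[OF that] that
    by (simp add: unary_cat_simps chom_unary_cat comp_closed comp_src comp_tgt)
  show "ccomp (unary_cat M) f (cid (unary_cat M) X) = f" "ccomp (unary_cat M) (cid (unary_cat M) Y) f = f"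
    if "f \<in> chom (unary_cat M) X Y" for f X Y
    using that comp_id[of f] id_comp[of f] by (auto simp: unary_cat_simps chom_unary_cat)
  show "ccomp (unary_cat M) (ccomp (unary_cat M) h g) f = ccomp (unary_cat M) h (ccomp (unary_cat M) g f)"
    if "f \<in> chom (unary_cat M) X Y" "g \<in> chom (unary_cat M) Y Z" "h \<in> chom (unary_cat M) Z W" for f g h X Y Z W
    using c[OF that(1,2)] c[OF that(2,3)] by (simp add: unary_cat_simps comp_single_assoc)
qed

lemma seq_multicat_simps:
  "mobj (seq_multicat C) = cobj C"
  "(X, fs) \<in> marr (seq_multicat C) \<longleftrightarrow> X \<in> cobj C \<and> (\<forall>f\<in>set fs. f \<in> carr C \<and> ctgt C f = X)"
  "msrc (seq_multicat C) f = map (csrc C) (snd f)" "mtgt (seq_multicat C) = fst"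
  "mid (seq_multicat C) X = (X, [cid C X])"
  "mcomp (seq_multicat C) f gs = (fst f, concat (map2 (\<lambda>f g. map (ccomp C f) (snd g)) (snd f) gs))"
  by (simp_all add: seq_multicat_def case_prod_beta)

lemma composable_seq_multicat:
  "composable (seq_multicat C) (X, fs) gs \<longleftrightarrow> (X, fs) \<in> marr (seq_multicat C) \<and>
    list_all2 (\<lambda>f g. g \<in> marr (seq_multicat C) \<and> fst g = csrc C f) fs gs"
proof -
  have "set gs \<subseteq> A \<longleftrightarrow> (\<forall>i<length gs. gs ! i \<in> A)" for A
    by (auto simp: set_conv_nth)
  then show ?thesis
    by (auto simp: composable_def seq_multicat_simps(3,4) list_all2_conv_all_nth list_eq_iff_nth_eq)
qed

lemma (in category) multicategory_seq_multicat: "multicategory (seq_multicat C)"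
proof
  let ?S = "seq_multicat C"
  have comp: "ccomp C f g \<in> carr C \<and> csrc C (ccomp C f g) = csrc C g \<and> ctgt C (ccomp C f g) = ctgt C f"
    if "f \<in> carr C" "g \<in> carr C" "ctgt C g = csrc C f" for f g
    using comp_hom[of g "csrc C g" "csrc C f" f "ctgt C f"] that by (simp add: chom_def)
  show "set (msrc ?S f) \<subseteq> mobj ?S" "mtgt ?S f \<in> mobj ?S" if "f \<in> marr ?S" for f
    using that src_closed by (cases f, auto simp: seq_multicat_simps)+
  show "mid ?S X \<in> marr ?S" "msrc ?S (mid ?S X) = [X]" "mtgt ?S (mid ?S X) = X" if "X \<in> mobj ?S" for X
    using id_hom[of X] that by (auto simp: seq_multicat_simps chom_def)
  show "mcomp ?S f gs \<in> marr ?S" "msrc ?S (mcomp ?S f gs) = concat (map (msrc ?S) gs)"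
    "mtgt ?S (mcomp ?S f gs) = mtgt ?S f" if "composable ?S f gs" for f gs
  proof -
    obtain X fs where f: "f = (X, fs)" by fastforce
    have "list_all2 (\<lambda>f g. f \<in> carr C \<and> ctgt C f = X \<and> g \<in> marr ?S \<and> fst g = csrc C f) fs gs"
      using that by (auto simp: f composable_seq_multicat seq_multicat_simps(2) list_all2_conv_all_nth)
    then have *: "(\<forall>h\<in>set (concat (map2 (\<lambda>f g. map (ccomp C f) (snd g)) fs gs)). h \<in> carr C \<and> ctgt C h = X) \<and>
       map (csrc C) (concat (map2 (\<lambda>f g. map (ccomp C f) (snd g)) fs gs)) = concat (map (\<lambda>g. map (csrc C) (snd g)) gs)"
      by induction (use comp in \<open>auto simp: seq_multicat_simps(2)\<close>)
    moreover have "X \<in> cobj C"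
      using that by (simp add: f composable_seq_multicat seq_multicat_simps(2))
    ultimately show "mcomp ?S f gs \<in> marr ?S" "msrc ?S (mcomp ?S f gs) = concat (map (msrc ?S) gs)"
      "mtgt ?S (mcomp ?S f gs) = mtgt ?S f"
      by (simp_all add: f seq_multicat_simps(2-) seq_multicat_simps(3)[abs_def])
  qed
  show "mcomp ?S f (map (mid ?S) (msrc ?S f)) = f" if "f \<in> marr ?S" for f
  proof -
    obtain X fs where f: "f = (X, fs)" by fastforce
    have "\<forall>f\<in>set fs. f \<in> carr C"
      using that by (simp add: f seq_multicat_simps)
    then have "concat (map2 (\<lambda>f g. map (ccomp C f) (snd g)) fs (map (mid ?S) (map (csrc C) fs))) = fs"
      using comp_id by (induction fs) (auto simp: seq_multicat_simps(5) chom_def)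
    then show ?thesis
      by (simp add: f seq_multicat_simps(3,6))
  qed
  show "mcomp ?S (mid ?S (mtgt ?S f)) [f] = f" if "f \<in> marr ?S" for f
    using that id_comp by (cases f) (auto simp: seq_multicat_simps chom_def intro!: map_idI)
  show "mcomp ?S f (map2 (mcomp ?S) gs hss) = mcomp ?S (mcomp ?S f gs) (concat hss)"
    if "composable ?S f gs" "list_all2 (composable ?S) gs hss" for f gs hss
  proof -
    obtain X fs where f: "f = (X, fs)" by fastforce
    \<comment> \<open>Postcomposition with a single arrow \<open>k\<close> passes through one
      composite tuple; the induction on \<open>fs\<close> and \<open>gs\<close> below then treats
      the blocks one after the other.\<close>
    have *: "map (ccomp C k) (concat (map2 (\<lambda>f h. map (ccomp C f) (snd h)) gs hs))
      = concat (map2 (\<lambda>f h. map (ccomp C f) (snd h)) (map (ccomp C k) gs) hs)"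
      if "k \<in> carr C" "composable ?S (csrc C k, gs) hs" for k gs hs
    proof -
      have "list_all2 (\<lambda>g h. g \<in> carr C \<and> ctgt C g = csrc C k \<and> h \<in> marr ?S \<and> fst h = csrc C g) gs hs"
        using that(2) by (auto simp: composable_seq_multicat seq_multicat_simps(2) list_all2_conv_all_nth)
      then show ?thesis
      proof induction
        case (Cons g gs h hs)
        have "ccomp C k (ccomp C g u) = ccomp C (ccomp C k g) u" if "u \<in> set (snd h)" for u
          using that Cons.hyps(1) \<open>k \<in> carr C\<close> comp_assoc[of u "csrc C u" "csrc C g" g "csrc C k" k "ctgt C k"]
          by (cases h) (simp add: seq_multicat_simps(2) chom_def)
        then show ?case using Cons by simp
      qed simp
    qed
    have "list_all2 (\<lambda>f g. f \<in> carr C \<and> fst g = csrc C f) fs gs"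
      using that(1) by (auto simp: f composable_seq_multicat seq_multicat_simps(2) list_all2_conv_all_nth)
    then have "concat (map2 (\<lambda>f g. map (ccomp C f) (snd g)) fs (map2 (mcomp ?S) gs hss))
      = concat (map2 (\<lambda>f h. map (ccomp C f) (snd h)) (concat (map2 (\<lambda>f g. map (ccomp C f) (snd g)) fs gs)) (concat hss))"
      using that(2)
    proof (induction fs gs arbitrary: hss)
      case (Cons f fs g gs)
      then obtain hs hss' where hss: "hss = hs # hss'" "composable ?S g hs" "list_all2 (composable ?S) gs hss'"
        by (auto simp: list_all2_Cons1)
      have "length (snd g) = length hs"
        using hss(2) by (cases g) (auto simp: composable_seq_multicat list_all2_lengthD)
      moreover have "composable ?S (csrc C f, snd g) hs"
        using Cons.hyps(1) hss(2) by (cases g) simp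
      ultimately show ?case
        using Cons.IH[OF hss(3)] Cons.hyps(1) by (simp add: hss(1) seq_multicat_simps(6) *)
    qed simp
    then show ?thesis
      by (simp add: f seq_multicat_simps(6))
  qed
qed

text \<open>The inverse of a bijective functor is again a functor, so for the isomorphism only the
  passage from tuples to sums has to be checked for functoriality, not the taking of
  components.\<close>

lemma multicat_isomorphicI:
  assumes "multicategory M" and G: "multifunctor M N G"
    and obj: "bij_betw (fobj G) (mobj M) (mobj N)" and arr: "bij_betw (farr G) (marr M) (marr N)"
    and "multicategory N"
  shows "multicat_isomorphic N M"
proof -
  interpret M: multicategory M by fact
  interpret N: multicategory N by fact
  note G' = G[unfolded multifunctor_def]
  define F where "F = \<lparr>fobj = restrict (inv_into (mobj M) (fobj G)) (mobj N),
    farr = restrict (inv_into (marr M) (farr G)) (marr N)\<rparr>"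
  have obj_inv: "fobj G (fobj F Y) = Y" "fobj F Y \<in> mobj M" if "Y \<in> mobj N" for Y
    using that obj by (auto simp: F_def bij_betw_inv_into_right bij_betwE[OF bij_betw_inv_into])
  have arr_inv: "farr G (farr F g) = g" "farr F g \<in> marr M" if "g \<in> marr N" for g
    using that arr by (auto simp: F_def bij_betw_inv_into_right bij_betwE[OF bij_betw_inv_into])
  have obj_eq: "fobj F (fobj G X) = X" if "X \<in> mobj M" for X
    using that obj bij_betwE[OF obj] by (simp add: F_def bij_betw_inv_into_left)
  have arr_eq: "farr F (farr G f) = f" if "f \<in> marr M" for f
    using that arr bij_betwE[OF arr] by (simp add: F_def bij_betw_inv_into_left)
  have src: "msrc M (farr F g) = map (fobj F) (msrc N g)" and tgt: "mtgt M (farr F g) = fobj F (mtgt N g)"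
    if g: "g \<in> marr N" for g
  proof -
    have "msrc N g = map (fobj G) (msrc M (farr F g))" "mtgt N g = fobj G (mtgt M (farr F g))"
      using arr_inv[OF g] G' by metis+
    then show "msrc M (farr F g) = map (fobj F) (msrc N g)" "mtgt M (farr F g) = fobj F (mtgt N g)"
      using M.src_closed[OF arr_inv(2)[OF g]] M.tgt_closed[OF arr_inv(2)[OF g]]
      by (auto simp: obj_eq map_idI subset_iff)
  qed
  have "farr F (mid N Y) = mid M (fobj F Y)" if "Y \<in> mobj N" for Y
  proof -
    have "farr G (mid M (fobj F Y)) = mid N Y"
      using G' obj_inv[OF that] by simp
    then show ?thesis
      using arr_eq[OF M.id_closed[OF obj_inv(2)[OF that]]] by simp
  qed
  moreover have "farr F (mcomp N g hs) = mcomp M (farr F g) (map (farr F) hs)" if c: "composable N g hs" for g hs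
  proof -
    have hs: "g \<in> marr N" "set hs \<subseteq> marr N" "map (mtgt N) hs = msrc N g"
      using c by (auto simp: composable_def)
    have "map (mtgt M) (map (farr F) hs) = map (fobj F) (map (mtgt N) hs)"
      using hs(2) tgt by auto
    then have c': "composable M (farr F g) (map (farr F) hs)"
      using hs arr_inv by (auto simp: composable_def src)
    have "map (farr G) (map (farr F) hs) = hs"
      using hs(2) arr_inv by (auto simp: map_idI subset_iff)
    then have "farr G (mcomp M (farr F g) (map (farr F) hs)) = mcomp N g hs"
      using G' c' arr_inv hs(1) by metis
    then show ?thesis
      using arr_eq[OF M.comp_closed[OF c']] by simp
  qed
  ultimately have F: "multifunctor N M F"
    using obj_inv arr_inv src tgt by (auto simp: multifunctor_def F_def)
  have "comp_fctr N G F = id_fctr N" "comp_fctr M F G = id_fctr M"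
    using obj_inv arr_inv obj_eq arr_eq
    by (auto simp: comp_fctr_def id_fctr_def compose_def fun_eq_iff)
  then show ?thesis
    using F G unfolding multicat_isomorphic_def by blast
qed

context plain_cartesian_multicategory
begin

section \<open>Arrows of monoids as tuples of unary arrows\<close>

lemma component_sum:
  assumes arr: "list_all2 (\<lambda>X f. ([X], Y, f) \<in> marr (cmonoids M)) Xs fs" and Y: "Y \<in> mobj (cmonoids M)"
    and i: "i < length Xs"
  shows "component Xs (mcomp M (str_arr Y (length Xs)) fs) i = fs ! i"
proof -
  let ?n = "length Xs"
  let ?u = "\<lambda>l. if l = i then mid M (under_obj (Xs ! l)) else str_arr (Xs ! l) 0"
  have fs: "([Xs ! l], Y, fs ! l) \<in> marr (cmonoids M)" if "l < ?n" for l
    using arr that by (auto simp: list_all2_conv_all_nth)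
  note fs' = fs[unfolded cmonoids_unary_iff]
  have len: "length fs = ?n"
    using arr by (simp add: list_all2_lengthD)
  have unit: "mcomp M (fs ! l) [?u l] = (if l = i then fs ! i else str_arr Y 0)" if "l < ?n" for l
  proof (cases "l = i")
    case True
    then show ?thesis
      using fs'[OF that] comp_id[of "fs ! l"] by simp
  next
    case False
    \<comment> \<open>Commutation for \<open>k = 0\<close>: a morphism preserves the neutral
      element.\<close>
    have "mcomp M (str_arr Y 0) (replicate 0 (fs ! l)) = mcomp M (fs ! l) [str_arr (Xs ! l) 0]"
      using fs'[OF that] by blast
    then show ?thesis
      using False Y by (simp add: comp_nil cmonoidD)
  qed
  have "component Xs (mcomp M (str_arr Y ?n) fs) i
    = mcomp M (mcomp M (str_arr Y ?n) (map ((!) fs) [0..<?n])) (concat (map (\<lambda>l. [?u l]) [0..<?n]))"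
    using len map_nth[of fs] by (simp add: component_def unit_arrs_def concat_map_singleton)
  also have "\<dots> = mcomp M (str_arr Y ?n) (map (\<lambda>l. mcomp M (fs ! l) [?u l]) [0..<?n])"
  proof (rule comp_assoc_map[symmetric])
    show "composable M (str_arr Y ?n) (map ((!) fs) [0..<?n])"
      using Y fs' by (auto simp: composable_str)
    show "composable M (fs ! l) [?u l]" if "l \<in> set [0..<?n]" for l
      using that fs'[of l] cmonoidD[of "Xs ! l"] by (auto simp: composable_def id_closed id_tgt)
  qed
  also have "map (\<lambda>l. mcomp M (fs ! l) [?u l]) [0..<?n] = map (\<lambda>l. if l = i then fs ! i else str_arr Y 0) [0..<?n]"
    using unit by (intro map_cong) auto
  also have "mcomp M (str_arr Y ?n) \<dots> = fs ! i"
    using fs'[OF i] by (intro str_unit[OF Y _ _ i]) auto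
  finally show ?thesis .
qed

text \<open>Sums are the convenient direction, because \<open>cmonoids_comp_sum\<close> already
  computes their composites. The entries of a tuple are unary, so \<open>hd\<close> recovers their
  sources.\<close>

definition sum_functor where
  "sum_functor = \<lparr>fobj = restrict id (mobj (cmonoids M)),
     farr = (\<lambda>(X, fs)\<in>marr (seq_multicat (unary_cat (cmonoids M))).
       (map (hd \<circ> fst) fs, X, mcomp M (str_arr X (length fs)) (map under_arr fs)))\<rparr>"

lemma seq_unary_arr_iff:
  "(X, fs) \<in> marr (seq_multicat (unary_cat (cmonoids M))) \<longleftrightarrow> X \<in> mobj (cmonoids M) \<and>
    (\<forall>f\<in>set fs. \<exists>Z \<alpha>. f = ([Z], X, \<alpha>) \<and> ([Z], X, \<alpha>) \<in> marr (cmonoids M))"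
proof -
  have "f \<in> carr (unary_cat (cmonoids M)) \<and> ctgt (unary_cat (cmonoids M)) f = X \<longleftrightarrow>
    (\<exists>Z \<alpha>. f = ([Z], X, \<alpha>) \<and> ([Z], X, \<alpha>) \<in> marr (cmonoids M))" for f
    by (cases f) (auto simp: unary_cat_simps cmonoids_simps(3,4) length_Suc_conv)
  then show ?thesis
    by (simp add: seq_multicat_simps(2) unary_cat_simps(1))
qed

lemma seq_unary_arr_list_all2:
  assumes "(X, fs) \<in> marr (seq_multicat (unary_cat (cmonoids M)))"
  shows "list_all2 (\<lambda>Z \<alpha>. ([Z], X, \<alpha>) \<in> marr (cmonoids M)) (map (hd \<circ> fst) fs) (map under_arr fs)"
proof -
  have "([(hd \<circ> fst) f], X, under_arr f) \<in> marr (cmonoids M)" if "f \<in> set fs" for f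
    using assms that unfolding seq_unary_arr_iff by fastforce
  then show ?thesis
    by (simp add: list.rel_map list_all2_same)
qed

text \<open>Injective since the components of a sum are its summands, surjective since an arrow is
  the sum of its components.\<close>

lemma bij_sum_functor:
  "bij_betw (farr sum_functor) (marr (seq_multicat (unary_cat (cmonoids M)))) (marr (cmonoids M))"
proof (rule bij_betwI')
  let ?S = "seq_multicat (unary_cat (cmonoids M))"
  show "farr sum_functor f \<in> marr (cmonoids M)" if "f \<in> marr ?S" for f
  proof -
    obtain X fs where f: "f = (X, fs)" by fastforce
    then show ?thesis
      using str_sum_commutes[OF seq_unary_arr_list_all2[of X fs]] that seq_unary_arr_iff[of X fs]
      by (simp add: sum_functor_def)
  qed
  show "(farr sum_functor f = farr sum_functor g) = (f = g)" if "f \<in> marr ?S" "g \<in> marr ?S" for f g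
  proof
    assume eq: "farr sum_functor f = farr sum_functor g"
    obtain X fs Y gs where f: "f = (X, fs)" and g: "g = (Y, gs)" by fastforce
    from eq that have "X = Y" and src: "map (hd \<circ> fst) fs = map (hd \<circ> fst) gs"
      and sum: "mcomp M (str_arr X (length fs)) (map under_arr fs) = mcomp M (str_arr X (length gs)) (map under_arr gs)"
      by (auto simp: sum_functor_def f g)
    have len: "length gs = length fs"
      using arg_cong[OF src, of length] by simp
    have f': "(X, fs) \<in> marr ?S" and g': "(X, gs) \<in> marr ?S"
      using that by (simp_all add: f g \<open>X = Y\<close>)
    note fi = f'[unfolded seq_unary_arr_iff] and gi = g'[unfolded seq_unary_arr_iff]
    have "fs ! i = gs ! i" if i: "i < length fs" for i
    proof -
      have "component (map (hd \<circ> fst) fs) (mcomp M (str_arr X (length fs)) (map under_arr fs)) i = under_arr (fs ! i)"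
        using component_sum[OF seq_unary_arr_list_all2[OF f'], of i] fi i by simp
      moreover have "component (map (hd \<circ> fst) gs) (mcomp M (str_arr X (length gs)) (map under_arr gs)) i = under_arr (gs ! i)"
        using component_sum[OF seq_unary_arr_list_all2[OF g'], of i] gi i len by simp
      ultimately have "under_arr (fs ! i) = under_arr (gs ! i)"
        using src sum by simp
      moreover have "hd (fst (fs ! i)) = hd (fst (gs ! i))"
        using arg_cong[OF src, of "\<lambda>xs. xs ! i"] i len by simp
      moreover obtain Z \<alpha> Z' \<alpha>' where "fs ! i = ([Z], X, \<alpha>)" "gs ! i = ([Z'], X, \<alpha>')"
        using fi gi i len nth_mem[of i] by metis
      ultimately show ?thesis by simp
    qed
    then have "fs = gs"
      using len by (intro nth_equalityI) auto
    with \<open>X = Y\<close> show "f = g" by (simp add: f g)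
  qed simp
  show "\<exists>f\<in>marr ?S. h = farr sum_functor f" if h: "h \<in> marr (cmonoids M)" for h
  proof (rule cmonoids_arr_cases[OF h])
    fix Xs X \<alpha> assume h: "h = (Xs, X, \<alpha>)" and \<alpha>: "(Xs, X, \<alpha>) \<in> marr (cmonoids M)"
    define fs where "fs = map (\<lambda>i. ([Xs ! i], X, component Xs \<alpha> i)) [0..<length Xs]"
    have *: "map (hd \<circ> fst) fs = Xs" "map under_arr fs = map (component Xs \<alpha>) [0..<length Xs]" "length fs = length Xs"
      by (auto simp: fs_def o_def map_nth)
    have "(X, fs) \<in> marr ?S"
      unfolding seq_unary_arr_iff using cmonoids_arrD(2)[OF \<alpha>] component_closed[OF \<alpha>]
      by (auto simp: fs_def)
    moreover from this have "h = farr sum_functor (X, fs)"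
      using str_component[OF \<alpha>] by (simp add: sum_functor_def h *)
    ultimately show ?thesis by blast
  qed
qed

lemma multifunctor_sum_functor:
  "multifunctor (seq_multicat (unary_cat (cmonoids M))) (cmonoids M) sum_functor"
proof -
  let ?U = "unary_cat (cmonoids M)"
  let ?S = "seq_multicat ?U"
  interpret C: cartesian_multicategory "cmonoids M" by (rule cmonoids_cartesian)
  interpret U: category ?U by (rule C.category_unary_cat)
  interpret S: multicategory ?S by (rule U.multicategory_seq_multicat)
  have arr: "farr sum_functor (X, fs) = (map (hd \<circ> fst) fs, X, mcomp M (str_arr X (length fs)) (map under_arr fs))"
    if "(X, fs) \<in> marr ?S" for X fs
    using that by (simp add: sum_functor_def)
  have st: "msrc (cmonoids M) (farr sum_functor f) = map (fobj sum_functor) (msrc ?S f) \<and>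
        mtgt (cmonoids M) (farr sum_functor f) = fobj sum_functor (mtgt ?S f)" if f: "f \<in> marr ?S" for f
    using S.src_closed[OF f] S.tgt_closed[OF f] f
    by (cases f) (auto simp: arr sum_functor_def cmonoids_simps(3,4) seq_multicat_simps unary_cat_simps)
  have id: "farr sum_functor (mid ?S X) = mid (cmonoids M) (fobj sum_functor X)" if "X \<in> mobj ?S" for X
  proof -
    have X: "X \<in> mobj (cmonoids M)"
      using that by (simp add: seq_multicat_simps unary_cat_simps)
    have "mcomp M (mid M (under_obj X)) [mid M (under_obj X)] = mid M (under_obj X)"
      using id_comp[of "mid M (under_obj X)"] cmonoidD(1)[OF X] by (simp add: id_closed id_tgt)
    then show ?thesis
      using S.id_closed[OF that] X cmonoidD(5)[OF X]
      by (simp add: seq_multicat_simps(5) arr unary_cat_simps cmonoids_simps(5)) (simp add: sum_functor_def)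
  qed
  have "farr sum_functor (mcomp ?S f gs) = mcomp (cmonoids M) (farr sum_functor f) (map (farr sum_functor) gs)"
    if c: "composable ?S f gs" for f gs
  proof -
    obtain X fs where f: "f = (X, fs)" by fastforce
    let ?n = "length fs" and ?Xs = "map (hd \<circ> fst) fs"
    have fs: "(X, fs) \<in> marr ?S" and gs: "set gs \<subseteq> marr ?S"
      using c by (simp_all add: f composable_def)
    have gi: "fst (gs ! i) = ?Xs ! i" "gs ! i \<in> marr ?S" if "i < ?n" for i
      using c that by (auto simp: f composable_seq_multicat list_all2_conv_all_nth unary_cat_simps cmonoids_simps(3))
    have len: "length gs = ?n"
      using c by (auto simp: f composable_seq_multicat dest: list_all2_lengthD)
    have X: "X \<in> mobj (cmonoids M)"
      using fs by (simp add: seq_unary_arr_iff)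
    have fi: "([?Xs ! i], X, under_arr (fs ! i)) \<in> marr (cmonoids M)" if "i < ?n" for i
      using seq_unary_arr_list_all2[OF fs] that by (simp add: list_all2_conv_all_nth)
    define g where "g = (\<lambda>i. map under_arr (snd (gs ! i)))"
    have g: "set (g i) \<subseteq> {h \<in> marr M. mtgt M h = under_obj (?Xs ! i)}" if "i < ?n" for i
      using gi[OF that] cmonoids_arrD(3,5) unfolding g_def
      by (cases "gs ! i") (fastforce simp: seq_unary_arr_iff)
    define ks where "ks = concat (map2 (\<lambda>f g. map (ccomp ?U f) (snd g)) fs gs)"
    have k: "mcomp ?S f gs = (X, ks)" "(X, ks) \<in> marr ?S"
      using S.comp_closed[OF c] by (simp_all add: f seq_multicat_simps(6) ks_def)
    \<comment> \<open>The entries of the composite tuple are exactly the summands that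
      distributivity produces, in the same order.\<close>
    have uks: "map under_arr ks = concat (map (\<lambda>i. map (\<lambda>h. mcomp M (under_arr (fs ! i)) [h]) (g i)) [0..<?n])"
      unfolding ks_def map_concat using len
      by (intro arg_cong[where f = concat] nth_equalityI)
         (auto simp: g_def unary_cat_simps cmonoids_simps(6))
    have Gg: "map (under_arr \<circ> farr sum_functor) gs = map (\<lambda>i. mcomp M (str_arr (?Xs ! i) (length (g i))) (g i)) [0..<?n]"
    proof (rule nth_equalityI)
      fix i assume "i < length (map (under_arr \<circ> farr sum_functor) gs)"
      then show "map (under_arr \<circ> farr sum_functor) gs ! i = map (\<lambda>i. mcomp M (str_arr (?Xs ! i) (length (g i))) (g i)) [0..<?n] ! i"
        using gi[of i] len by (cases "gs ! i") (simp add: arr g_def)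
    qed (simp add: len)
    \<comment> \<open>The sources follow from typing: \<open>sum_functor\<close> keeps the source of
      a tuple, and the source of a composite in \<open>seq_multicat\<close> is known.\<close>
    have "fst (farr sum_functor (X, ks)) = concat (map (fst \<circ> farr sum_functor) gs)"
    proof -
      have *: "fst (farr sum_functor h) = msrc ?S h" if "h \<in> marr ?S" for h
        using st[OF that] S.src_closed[OF that]
        by (simp add: cmonoids_simps(3) sum_functor_def seq_multicat_simps unary_cat_simps map_idI subset_iff)
      have "map (fst \<circ> farr sum_functor) gs = map (msrc ?S) gs"
        using gs by (auto simp: *)
      then show ?thesis
        using S.comp_src[OF c] k * by (simp cong: map_cong)
    qed
    moreover have "fst (snd (farr sum_functor (X, ks))) = X"
      using k by (simp add: arr)
    moreover have "under_arr (farr sum_functor (X, ks)) = mcomp M (under_arr (farr sum_functor f)) (map (under_arr \<circ> farr sum_functor) gs)"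
      using cmonoids_comp_sum[where n = ?n, OF fi X g uks] map_nth_upt_length[of fs ?n under_arr]
      unfolding Gg using k fs by (simp add: arr f)
    ultimately have "farr sum_functor (X, ks) = mcomp (cmonoids M) (farr sum_functor f) (map (farr sum_functor) gs)"
      using fs by (intro prod_eqI) (simp_all add: cmonoids_simps(6) arr f)
    then show ?thesis
      by (simp add: k)
  qed
  then show ?thesis
    using st id bij_betwE[OF bij_sum_functor]
    by (auto simp: multifunctor_def) (auto simp: sum_functor_def seq_multicat_simps unary_cat_simps)
qed

lemma sequential_cmonoids: "sequential (cmonoids M)"
proof -
  interpret C: cartesian_multicategory "cmonoids M" by (rule cmonoids_cartesian)
  interpret U: category "unary_cat (cmonoids M)" by (rule C.category_unary_cat)
  have "bij_betw (fobj sum_functor) (mobj (seq_multicat (unary_cat (cmonoids M)))) (mobj (cmonoids M))"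
    by (auto simp: sum_functor_def seq_multicat_simps unary_cat_simps bij_betw_def inj_on_def)
  then have "multicat_isomorphic (cmonoids M) (seq_multicat (unary_cat (cmonoids M)))"
    by (rule multicat_isomorphicI[OF U.multicategory_seq_multicat multifunctor_sum_functor _ bij_sum_functor
      C.multicategory_axioms])
  then show ?thesis
    using U.category_axioms unfolding sequential_def by blast
qed

end

section \<open>Sums of monoid morphisms\<close>

lemma cMon_simps:
  "cobj (cMon M) = mobj (cmonoids M)" "carr (cMon M) = {f \<in> marr (cmonoids M). length (fst f) = 1}"
  "csrc (cMon M) f = hd (fst f)" "ctgt (cMon M) f = fst (snd f)" "cid (cMon M) = mid (cmonoids M)"
  "ccomp (cMon M) g f = mcomp (cmonoids M) g [f]"
  "czero (cMon M) X Y = cMon_sum M X Y []"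
  "cadd (cMon M) f g = cMon_sum M (hd (fst f)) (fst (snd f)) [f, g]"
  by (simp_all add: cMon_def Let_def cat.defs preadd_cat.defs unary_cat_def cmonoids_simps(3,4))

lemma chom_cMon: "f \<in> chom (cMon M) X Y \<longleftrightarrow> (\<exists>\<alpha>. f = ([X], Y, \<alpha>) \<and> ([X], Y, \<alpha>) \<in> marr (cmonoids M))"
  by (cases f) (auto simp: chom_def cMon_simps length_Suc_conv)

context plain_cartesian_multicategory
begin

lemma category_cMon: "category (cMon M)"
proof -
  interpret C: cartesian_multicategory "cmonoids M" by (rule cmonoids_cartesian)
  have "chom (cMon M) = chom (unary_cat (cmonoids M))"
    by (auto simp: fun_eq_iff chom_def cMon_simps unary_cat_simps cmonoids_simps(3,4))
  then show ?thesis
    using C.category_unary_cat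
    by (simp add: category_def cMon_simps unary_cat_simps cmonoids_simps(3,4))
qed

text \<open>Sums of lists rather than of two arrows, so that one flattening law yields associativity
  and neutrality together: it is applied to the nested lists of shapes 2 + 1, 1 + 2 and 0 +
  1.\<close>

definition hom_sum :: "('o, 'a) cmonoid \<Rightarrow> ('o, 'a) cmonoid \<Rightarrow> 'a list \<Rightarrow> 'a" where
  "hom_sum X Y \<alpha>s = mact M (replicate (length \<alpha>s) 0) [under_obj X] (mcomp M (str_arr Y (length \<alpha>s)) \<alpha>s)"

lemma cMon_sum_eq: "cMon_sum M X Y fs = ([X], Y, hom_sum X Y (map under_arr fs))"
  by (simp add: cMon_sum_def hom_sum_def)

lemma str_comp_hom:
  assumes Y: "Y \<in> mobj (cmonoids M)" and \<alpha>s: "\<forall>\<alpha>\<in>set \<alpha>s. ([X], Y, \<alpha>) \<in> marr (cmonoids M)"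
  defines "u \<equiv> mcomp M (str_arr Y (length \<alpha>s)) \<alpha>s"
  shows "set \<alpha>s \<subseteq> {\<alpha> \<in> marr M. mtgt M \<alpha> = under_obj Y}" "composable M (str_arr Y (length \<alpha>s)) \<alpha>s"
    "(replicate (length \<alpha>s) X, Y, u) \<in> marr (cmonoids M)"
    "u \<in> marr M" "msrc M u = replicate (length \<alpha>s) (under_obj X)" "mtgt M u = under_obj Y"
proof -
  show "set \<alpha>s \<subseteq> {\<alpha> \<in> marr M. mtgt M \<alpha> = under_obj Y}"
    using \<alpha>s by (auto simp: cmonoids_unary_iff)
  then show "composable M (str_arr Y (length \<alpha>s)) \<alpha>s"
    using Y by (simp add: composable_str)
  have "list_all2 (\<lambda>X f. ([X], Y, f) \<in> marr (cmonoids M)) (replicate (length \<alpha>s) X) \<alpha>s"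
    using \<alpha>s by (simp add: list_all2_conv_all_nth)
  from str_sum_commutes[OF this Y] show u: "(replicate (length \<alpha>s) X, Y, u) \<in> marr (cmonoids M)"
    by (simp add: u_def)
  show "u \<in> marr M" "msrc M u = replicate (length \<alpha>s) (under_obj X)" "mtgt M u = under_obj Y"
    using cmonoids_arrD(3-5)[OF u] by simp_all
qed

lemma hom_sum_closed:
  assumes "X \<in> mobj (cmonoids M)" "Y \<in> mobj (cmonoids M)" "\<forall>\<alpha>\<in>set \<alpha>s. ([X], Y, \<alpha>) \<in> marr (cmonoids M)"
  shows "actable M (replicate (length \<alpha>s) 0) [under_obj X] (mcomp M (str_arr Y (length \<alpha>s)) \<alpha>s)"
    "([X], Y, hom_sum X Y \<alpha>s) \<in> marr (cmonoids M)"
  using cmonoids_arr_act[OF str_comp_hom(3)[OF assms(2,3)], of "[X]" "replicate (length \<alpha>s) 0"] assms(1)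
  by (auto simp: reindexes_def hom_sum_def map_replicate_const set_replicate_conv_if)

text \<open>A juxtaposition followed by the mapping to one place is again the mapping to one place,
  so the inner contractions merge with the outer one; the sums below them are merged by
  \<open>str_flatten\<close>.\<close>

lemma hom_sum_flatten:
  assumes X: "X \<in> mobj (cmonoids M)" and Y: "Y \<in> mobj (cmonoids M)"
    and \<alpha>ss: "\<forall>\<alpha>s\<in>set \<alpha>ss. \<forall>\<alpha>\<in>set \<alpha>s. ([X], Y, \<alpha>) \<in> marr (cmonoids M)"
  shows "hom_sum X Y (map (hom_sum X Y) \<alpha>ss) = hom_sum X Y (concat \<alpha>ss)"
proof -
  let ?N = "length \<alpha>ss" and ?A = "under_obj X" and ?T = "length (concat \<alpha>ss)"
  let ?fs = "map (\<lambda>\<alpha>s. mcomp M (str_arr Y (length \<alpha>s)) \<alpha>s) \<alpha>ss"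
  let ?\<sigma>s = "map (\<lambda>\<alpha>s. replicate (length \<alpha>s) 0) \<alpha>ss"
  let ?J = "juxtapose (zip ?\<sigma>s (map length (replicate ?N [?A])))"
  note \<alpha>s = str_comp_hom[OF Y bspec[OF \<alpha>ss]]
  have flat: "mcomp M (str_arr Y ?N) ?fs = mcomp M (str_arr Y ?T) (concat \<alpha>ss)"
    using \<alpha>ss \<alpha>s(1) by (intro str_flatten[OF Y]) blast
  have "map (\<lambda>i. mact M (?\<sigma>s ! i) (replicate ?N [?A] ! i) (?fs ! i)) [0..<?N] = map (hom_sum X Y) \<alpha>ss"
    by (auto simp: hom_sum_def intro: nth_equalityI)
  moreover have "mcomp M (str_arr Y ?N) (map (\<lambda>i. mact M (?\<sigma>s ! i) (replicate ?N [?A] ! i) (?fs ! i)) [0..<length ?fs])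
    = mact M ?J (concat (replicate ?N [?A])) (mcomp M (str_arr Y ?N) ?fs)"
  proof (rule comp_act_args)
    show "composable M (str_arr Y ?N) ?fs"
      using Y \<alpha>s(4,6) \<alpha>ss by (auto simp: composable_str)
    show "\<forall>i<length ?fs. actable M (?\<sigma>s ! i) (replicate ?N [?A] ! i) (?fs ! i)"
      using hom_sum_closed(1)[OF X Y bspec[OF \<alpha>ss nth_mem]] by simp
  qed simp_all
  ultimately have sum: "hom_sum X Y (map (hom_sum X Y) \<alpha>ss)
    = mact M (replicate ?N 0) [?A] (mact M ?J (replicate ?N ?A) (mcomp M (str_arr Y ?T) (concat \<alpha>ss)))"
    by (simp add: hom_sum_def flat concat_replicate_singleton)
  \<comment> \<open>Each inner sum leaves one copy of \<open>?A\<close>, so the juxtaposed mapping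
    ends in \<open>?N\<close> places; an empty inner sum contributes a place outside its
    image.\<close>
  have J: "reindexes ?J (replicate ?T ?A) (replicate ?N ?A)"
  proof -
    have "\<forall>i<?N. reindexes (?\<sigma>s ! i) (map (\<lambda>\<alpha>s. replicate (length \<alpha>s) ?A) \<alpha>ss ! i) (replicate ?N [?A] ! i)"
      by (simp add: reindexes_def map_replicate_const set_replicate_conv_if)
    then have "reindexes ?J (concat (map (\<lambda>\<alpha>s. replicate (length \<alpha>s) ?A) \<alpha>ss)) (concat (replicate ?N [?A]))"
      by (intro reindexes_juxtapose) simp_all
    moreover have "concat (map (\<lambda>\<alpha>s. replicate (length \<alpha>s) ?A) \<alpha>ss) = replicate ?T ?A"
      by (induction \<alpha>ss) (auto simp: replicate_add)
    ultimately show ?thesis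
      by (simp add: concat_replicate_singleton)
  qed
  have act: "mact M (replicate ?N 0) [?A] (mact M ?J (replicate ?N ?A) (mcomp M (str_arr Y ?T) (concat \<alpha>ss)))
    = mact M (map ((!) (replicate ?N 0)) ?J) [?A] (mcomp M (str_arr Y ?T) (concat \<alpha>ss))"
  proof (rule act_act)
    have "\<forall>\<alpha>\<in>set (concat \<alpha>ss). ([X], Y, \<alpha>) \<in> marr (cmonoids M)"
      using \<alpha>ss by auto
    note u = str_comp_hom[OF Y this]
    show "actable M ?J (replicate ?N ?A) (mcomp M (str_arr Y ?T) (concat \<alpha>ss))"
      using u(4,5) J cmonoidD(1)[OF X] by (simp add: actable_def set_replicate_conv_if)
    show "set [?A] \<subseteq> mobj M" "reindexes (replicate ?N 0) (replicate ?N ?A) [?A]"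
      using cmonoidD(1)[OF X] by (auto simp: reindexes_def map_replicate_const)
  qed
  have const: "map ((!) (replicate ?N 0)) ?J = replicate ?T 0"
    using J by (auto simp: map_eq_replicate_iff reindexes_def subset_iff)
  show ?thesis
    unfolding sum act const by (simp only: hom_sum_def)
qed

lemma hom_sum_single:
  assumes "([X], Y, \<alpha>) \<in> marr (cmonoids M)"
  shows "hom_sum X Y [\<alpha>] = \<alpha>"
  using assms act_id[of \<alpha>] id_comp[of \<alpha>] by (auto simp: hom_sum_def cmonoids_unary_iff cmonoidD(5))

text \<open>The structure arrow absorbs a swap of its arguments, and a swap followed by the mapping
  to one place is that mapping.\<close>

lemma hom_sum_swap:
  assumes X: "X \<in> mobj (cmonoids M)" and "([X], Y, \<alpha>) \<in> marr (cmonoids M)" "([X], Y, \<beta>) \<in> marr (cmonoids M)"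
  shows "hom_sum X Y [\<alpha>, \<beta>] = hom_sum X Y [\<beta>, \<alpha>]"
proof -
  let ?A = "under_obj X"
  have Y: "Y \<in> mobj (cmonoids M)" and \<alpha>\<beta>: "\<forall>\<gamma>\<in>set [\<beta>, \<alpha>]. ([X], Y, \<gamma>) \<in> marr (cmonoids M)"
    using assms by (auto simp: cmonoids_unary_iff)
  note u = str_comp_hom[OF Y \<alpha>\<beta>]
  have "bijective_map [1, 0] 2"
    by (auto simp: bijective_map_iff)
  then have "mact M [1, 0] [?A, ?A] (mcomp M (str_arr Y 2) [\<beta>, \<alpha>]) = mcomp M (str_arr Y 2) [\<alpha>, \<beta>]"
    using str_permute[OF Y, of "[1, 0]" "[\<alpha>, \<beta>]" "[?A, ?A]"] assms(2,3)
    by (simp add: cmonoids_unary_iff numeral_2_eq_2)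
  then have "hom_sum X Y [\<alpha>, \<beta>] = mact M [0, 0] [?A] (mact M [1, 0] [?A, ?A] (mcomp M (str_arr Y 2) [\<beta>, \<alpha>]))"
    by (simp add: hom_sum_def numeral_2_eq_2)
  also have "\<dots> = mact M (map ((!) [0, 0]) [1, 0]) [?A] (mcomp M (str_arr Y 2) [\<beta>, \<alpha>])"
    using u(4,5) cmonoidD(1)[OF X]
    by (intro act_act) (auto simp: actable_def reindexes_def numeral_2_eq_2)
  finally show ?thesis
    by (simp add: hom_sum_def numeral_2_eq_2)
qed

text \<open>Axiom \<open>comp_act_args\<close> for a single argument moves the contraction out of
  the composite, and \<open>h\<close> preserves the sum below it.\<close>

lemma comp_hom_sum:
  assumes X: "X \<in> mobj (cmonoids M)" and \<alpha>s: "\<forall>\<alpha>\<in>set \<alpha>s. ([X], Y, \<alpha>) \<in> marr (cmonoids M)"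
    and h: "([Y], Z, h) \<in> marr (cmonoids M)"
  shows "mcomp M h [hom_sum X Y \<alpha>s] = hom_sum X Z (map (\<lambda>\<alpha>. mcomp M h [\<alpha>]) \<alpha>s)"
proof -
  have Y: "Y \<in> mobj (cmonoids M)"
    using h by (simp add: cmonoids_unary_iff)
  note u = str_comp_hom[OF Y \<alpha>s]
  let ?u = "mcomp M (str_arr Y (length \<alpha>s)) \<alpha>s"
  have "composable M h [?u]"
    using h u(4,6) by (simp add: composable_def cmonoids_unary_iff)
  from comp_act_args[OF this, of "[replicate (length \<alpha>s) 0]" "[[under_obj X]]"]
  show ?thesis
    using hom_sum_closed(1)[OF X Y \<alpha>s] cmonoids_unary_comp_str[OF h u(1)] by (simp add: hom_sum_def)
qed

text \<open>By \<open>comp_act_fun\<close> the contraction supplies each summand with its own copy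
  of \<open>h\<close>; as \<open>h\<close> is unary, the resulting block mapping is the same
  contraction.\<close>

lemma hom_sum_comp:
  assumes Y: "Y \<in> mobj (cmonoids M)" and \<alpha>s: "\<forall>\<alpha>\<in>set \<alpha>s. ([X], Y, \<alpha>) \<in> marr (cmonoids M)"
    and h: "([W], X, h) \<in> marr (cmonoids M)"
  shows "mcomp M (hom_sum X Y \<alpha>s) [h] = hom_sum W Y (map (\<lambda>\<alpha>. mcomp M \<alpha> [h]) \<alpha>s)"
proof -
  note h' = h[unfolded cmonoids_unary_iff]
  note u = str_comp_hom[OF Y \<alpha>s]
  let ?n = "length \<alpha>s"
  have "mcomp M (hom_sum X Y \<alpha>s) [h] = mact M (block_map (replicate ?n 0) (replicate 1 (Suc 0))) [under_obj W]
      (mcomp M (mcomp M (str_arr Y ?n) \<alpha>s) (map ((!) [h]) (replicate ?n 0)))"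
    using comp_act_fun[OF hom_sum_closed(1)[OF _ Y \<alpha>s], of "[h]"] h' by (simp add: hom_sum_def)
  also have "block_map (replicate ?n 0) (replicate 1 (Suc 0)) = replicate ?n 0"
    by (rule block_map_ones) auto
  also have "map ((!) [h]) (replicate ?n 0) = concat (map (\<lambda>\<alpha>. [h]) \<alpha>s)"
    by (simp add: map_replicate_const)
  also have "mcomp M (mcomp M (str_arr Y ?n) \<alpha>s) (concat (map (\<lambda>\<alpha>. [h]) \<alpha>s)) = mcomp M (str_arr Y ?n) (map (\<lambda>\<alpha>. mcomp M \<alpha> [h]) \<alpha>s)"
    using u(2) \<alpha>s h' comp_assoc_map[of "str_arr Y ?n" "\<lambda>\<alpha>. \<alpha>" \<alpha>s "\<lambda>_. [h]"]
    by (simp add: composable_def[of _ _ "[h]"] cmonoids_unary_iff)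
  finally show ?thesis
    by (simp add: hom_sum_def)
qed

lemma preadditive_cMon: "preadditive_category (cMon M)"
proof (intro preadditive_category.intro category_cMon preadditive_category_axioms.intro)
  note mcomp_simps = cMon_simps(6-8) cmonoids_simps(6) cMon_sum_eq
  show "Group.comm_monoid \<lparr>carrier = chom (cMon M) X Y, monoid.mult = cadd (cMon M), one = czero (cMon M) X Y\<rparr>"
    if "X \<in> cobj (cMon M)" "Y \<in> cobj (cMon M)" for X Y
  proof -
    have X: "X \<in> mobj (cmonoids M)" and Y: "Y \<in> mobj (cmonoids M)"
      using that by (simp_all add: cMon_simps)
    note flat = hom_sum_flatten[OF X Y] and single = hom_sum_single[of X Y]
    have "hom_sum X Y [hom_sum X Y [\<alpha>, \<beta>], \<gamma>] = hom_sum X Y [\<alpha>, hom_sum X Y [\<beta>, \<gamma>]]"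
      if "([X], Y, \<alpha>) \<in> marr (cmonoids M)" "([X], Y, \<beta>) \<in> marr (cmonoids M)" "([X], Y, \<gamma>) \<in> marr (cmonoids M)"
      for \<alpha> \<beta> \<gamma>
      using flat[of "[[\<alpha>, \<beta>], [\<gamma>]]"] flat[of "[[\<alpha>], [\<beta>, \<gamma>]]"] that single by simp
    moreover have "hom_sum X Y [hom_sum X Y [], \<alpha>] = \<alpha>" if "([X], Y, \<alpha>) \<in> marr (cmonoids M)" for \<alpha>
      using flat[of "[[], [\<alpha>]]"] that single by simp
    ultimately show ?thesis
      using hom_sum_closed(2)[OF X Y] hom_sum_swap[OF X]
      by (intro comm_monoidI) (auto simp: chom_cMon mcomp_simps)
  qed
  show "ccomp (cMon M) h (cadd (cMon M) f g) = cadd (cMon M) (ccomp (cMon M) h f) (ccomp (cMon M) h g)"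
    if fgh: "f \<in> chom (cMon M) X Y" "g \<in> chom (cMon M) X Y" "h \<in> chom (cMon M) Y Z" for f X Y g h Z
  proof -
    obtain \<alpha> \<beta> \<gamma> where eq: "f = ([X], Y, \<alpha>)" "g = ([X], Y, \<beta>)" "h = ([Y], Z, \<gamma>)"
      using fgh by (auto simp: chom_cMon)
    show ?thesis
      using fgh comp_hom_sum[of X "[\<alpha>, \<beta>]" Y Z \<gamma>]
      by (simp add: eq chom_cMon mcomp_simps) (simp add: cmonoids_unary_iff)
  qed
  show "ccomp (cMon M) (cadd (cMon M) f g) h = cadd (cMon M) (ccomp (cMon M) f h) (ccomp (cMon M) g h)"
    if fgh: "h \<in> chom (cMon M) X Y" "f \<in> chom (cMon M) Y Z" "g \<in> chom (cMon M) Y Z" for f g h X Y Z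
  proof -
    obtain \<alpha> \<beta> \<gamma> where eq: "f = ([Y], Z, \<alpha>)" "g = ([Y], Z, \<beta>)" "h = ([X], Y, \<gamma>)"
      using fgh by (auto simp: chom_cMon)
    show ?thesis
      using fgh hom_sum_comp[of Z "[\<alpha>, \<beta>]" Y X \<gamma>]
      by (simp add: eq chom_cMon mcomp_simps) (simp add: cmonoids_unary_iff)
  qed
  \<comment> \<open>Zero is the empty sum, so this law and the next one are distributivity for the
    empty list.\<close>
  show "ccomp (cMon M) h (czero (cMon M) X Y) = czero (cMon M) X Z"
    if "X \<in> cobj (cMon M)" "h \<in> chom (cMon M) Y Z" for h X Y Z
    using that comp_hom_sum[of X "[]" Y Z "under_arr h"]
    by (auto simp: chom_cMon mcomp_simps cMon_simps(1))
  show "ccomp (cMon M) (czero (cMon M) Y Z) h = czero (cMon M) X Z"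
    if "h \<in> chom (cMon M) X Y" "Z \<in> cobj (cMon M)" for h X Y Z
    using that hom_sum_comp[of Z "[]" Y X "under_arr h"]
    by (auto simp: chom_cMon mcomp_simps cMon_simps(1))
qed

end

section \<open>Functors induced on commutative monoids\<close>

lemma comp_fctr_simps:
  "X \<in> mobj M \<Longrightarrow> fobj (comp_fctr M G F) X = fobj G (fobj F X)"
  "f \<in> marr M \<Longrightarrow> farr (comp_fctr M G F) f = farr G (farr F f)"
  by (simp_all add: comp_fctr_def compose_def)

lemma comp_fctr_eqI:
  assumes "\<And>X. X \<in> mobj M \<Longrightarrow> fobj G (fobj F X) = fobj H X" "\<And>f. f \<in> marr M \<Longrightarrow> farr G (farr F f) = farr H f"
    and "fobj H \<in> extensional (mobj M)" "farr H \<in> extensional (marr M)"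
  shows "comp_fctr M G F = H"
  using assms by (auto intro!: fctr.equality simp: comp_fctr_def compose_def extensional_def fun_eq_iff)

lemma fctr_cmonoid:
  "under_obj (comp_fctr one_seq F X) = fobj F (under_obj X)"
  "str_arr (comp_fctr one_seq F X) n = farr F (str_arr X n)"
  by (simp_all add: under_obj_def str_arr_def comp_fctr_simps one_seq_simps)

lemma multifunctorD:
  assumes "multifunctor M N F"
  shows "X \<in> mobj M \<Longrightarrow> fobj F X \<in> mobj N" "f \<in> marr M \<Longrightarrow> farr F f \<in> marr N"
    "f \<in> marr M \<Longrightarrow> msrc N (farr F f) = map (fobj F) (msrc M f)"
    "f \<in> marr M \<Longrightarrow> mtgt N (farr F f) = fobj F (mtgt M f)"
    "X \<in> mobj M \<Longrightarrow> farr F (mid M X) = mid N (fobj F X)"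
    "composable M f gs \<Longrightarrow> farr F (mcomp M f gs) = mcomp N (farr F f) (map (farr F) gs)"
    "composable M f gs \<Longrightarrow> composable N (farr F f) (map (farr F) gs)"
    "fobj F \<in> extensional (mobj M)" "farr F \<in> extensional (marr M)"
proof -
  note F = assms[unfolded multifunctor_def]
  show "X \<in> mobj M \<Longrightarrow> fobj F X \<in> mobj N" "f \<in> marr M \<Longrightarrow> farr F f \<in> marr N"
    "f \<in> marr M \<Longrightarrow> msrc N (farr F f) = map (fobj F) (msrc M f)"
    "f \<in> marr M \<Longrightarrow> mtgt N (farr F f) = fobj F (mtgt M f)"
    "X \<in> mobj M \<Longrightarrow> farr F (mid M X) = mid N (fobj F X)"
    "composable M f gs \<Longrightarrow> farr F (mcomp M f gs) = mcomp N (farr F f) (map (farr F) gs)"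
    "fobj F \<in> extensional (mobj M)" "farr F \<in> extensional (marr M)"
    using F by (auto simp: PiE_def)
  show "composable N (farr F f) (map (farr F) gs)" if "composable M f gs"
  proof -
    have gs: "f \<in> marr M" "set gs \<subseteq> marr M" "map (mtgt M) gs = msrc M f"
      using that by (auto simp: composable_def)
    have "map (mtgt N) (map (farr F) gs) = map (fobj F) (map (mtgt M) gs)"
      using F gs(2) by auto
    then show ?thesis
      using F gs by (auto simp: composable_def)
  qed
qed

lemma actable_functor:
  assumes F: "multifunctor M N F" and act: "actable M \<sigma> Bs f"
  shows "actable N \<sigma> (map (fobj F) Bs) (farr F f)"
proof -
  have f: "f \<in> marr M" "set Bs \<subseteq> mobj M" "set \<sigma> \<subseteq> {..<length Bs}" "map ((!) Bs) \<sigma> = msrc M f"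
    using act by (auto simp: actable_def reindexes_def)
  then show ?thesis
    using multifunctorD(1-3)[OF F] by (auto simp: actable_def reindexes_def map_nth_map[OF f(3)])
qed

text \<open>A composite is restricted to the arrows of \<open>M\<close>, so its value at
  \<open>mact M \<sigma> Bs f\<close> can be computed only when that is an arrow of
  \<open>M\<close>; hence the closure hypothesis.\<close>

lemma comp_cartesian_functor:
  assumes M: "multicategory M" and F: "cartesian_functor M N F" and G: "cartesian_functor N P G"
    and act: "\<And>\<sigma> Bs f. actable M \<sigma> Bs f \<Longrightarrow> mact M \<sigma> Bs f \<in> marr M"
  shows "cartesian_functor M P (comp_fctr M G F)"
proof -
  interpret multicategory M by fact
  have mF: "multifunctor M N F" and mG: "multifunctor N P G"
    using F G by (auto simp: cartesian_functor_def)
  note F' = multifunctorD[OF mF] and G' = multifunctorD[OF mG]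
  have "multifunctor M P (comp_fctr M G F)"
    unfolding multifunctor_def
  proof (intro conjI allI ballI impI)
    show "fobj (comp_fctr M G F) \<in> mobj M \<rightarrow>\<^sub>E mobj P" "farr (comp_fctr M G F) \<in> marr M \<rightarrow>\<^sub>E marr P"
      using F' G' by (auto simp: comp_fctr_def compose_def)
    show "msrc P (farr (comp_fctr M G F) f) = map (fobj (comp_fctr M G F)) (msrc M f)"
      "mtgt P (farr (comp_fctr M G F) f) = fobj (comp_fctr M G F) (mtgt M f)" if "f \<in> marr M" for f
      using that F' G' src_closed[of f] tgt_closed[of f] by (auto simp: comp_fctr_simps subset_iff)
    show "farr (comp_fctr M G F) (mid M X) = mid P (fobj (comp_fctr M G F) X)" if "X \<in> mobj M" for X
      using that F' G' by (simp add: comp_fctr_simps id_closed)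
    show "farr (comp_fctr M G F) (mcomp M f gs) = mcomp P (farr (comp_fctr M G F) f) (map (farr (comp_fctr M G F)) gs)"
      if c: "composable M f gs" for f gs
    proof -
      have "map (farr (comp_fctr M G F)) gs = map (farr G) (map (farr F) gs)"
        using c by (auto simp: composable_def comp_fctr_simps)
      then show ?thesis
        using c comp_closed[OF c] F'(6)[OF c] G'(6)[OF F'(7)[OF c]]
        by (simp add: comp_fctr_simps composable_def[of M] cong: map_cong)
    qed
  qed
  moreover have "farr (comp_fctr M G F) (mact M \<sigma> Bs f) = mact P \<sigma> (map (fobj (comp_fctr M G F)) Bs) (farr (comp_fctr M G F) f)"
    if a: "actable M \<sigma> Bs f" for \<sigma> Bs f
  proof -
    have "map (fobj (comp_fctr M G F)) Bs = map (fobj G) (map (fobj F) Bs)"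
      using a by (auto simp: actable_def comp_fctr_simps)
    then show ?thesis
      using a act[OF a] actable_functor[OF mF a] F G
      by (simp add: cartesian_functor_def comp_fctr_simps) (simp add: actable_def comp_fctr_simps cong: map_cong)
  qed
  ultimately show ?thesis
    by (simp add: cartesian_functor_def)
qed

lemma comp_fctr_assoc:
  assumes "multifunctor S T F"
  shows "comp_fctr S H (comp_fctr S G F) = comp_fctr S (comp_fctr T H G) F"
  using multifunctorD(1,2)[OF assms]
  by (auto intro!: fctr.equality simp: comp_fctr_def compose_def fun_eq_iff)

context plain_cartesian_multicategory
begin

lemma actable_str:
  assumes X: "X \<in> mobj (cmonoids M)" and \<sigma>: "bijective_map \<sigma> n"
  shows "actable M \<sigma> (replicate n (under_obj X)) (str_arr X n)"
  using \<sigma> bijective_map_length[OF \<sigma>] cmonoidD(1-4)[OF X]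
  by (auto simp: actable_def reindexes_def bijective_map_iff map_eq_replicate_iff set_replicate_conv_if)

lemma cmonoid_image:
  assumes F: "cartesian_functor M N F" and X: "X \<in> mobj (cmonoids M)"
  shows "comp_fctr one_seq F X \<in> mobj (cmonoids N)"
proof -
  have mF: "multifunctor M N F"
    using F by (simp add: cartesian_functor_def)
  note F' = multifunctorD[OF mF] and X' = cmonoidD[OF X]
  have "mcomp N (farr F (str_arr X (length ks))) (map (\<lambda>k. farr F (str_arr X k)) ks) = farr F (str_arr X (sum_list ks))" for ks
  proof -
    have "composable M (str_arr X (length ks)) (map (str_arr X) ks)"
      using X X' by (auto simp: composable_str)
    from F'(6)[OF this] show ?thesis
      using X'(6)[OF refl] by (simp add: o_def)
  qed
  moreover have "mact N \<sigma> (replicate (length \<sigma>) (fobj F (under_obj X))) (farr F (str_arr X (length \<sigma>))) = farr F (str_arr X (length \<sigma>))"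
    if "bijective_map \<sigma> (length \<sigma>)" for \<sigma>
  proof -
    have "farr F (mact M \<sigma> (replicate (length \<sigma>) (under_obj X)) (str_arr X (length \<sigma>)))
      = mact N \<sigma> (map (fobj F) (replicate (length \<sigma>) (under_obj X))) (farr F (str_arr X (length \<sigma>)))"
      using F actable_str[OF X that] unfolding cartesian_functor_def by blast
    then show ?thesis
      using X'(7)[OF that] by simp
  qed
  ultimately show ?thesis
    unfolding cmonoids_simps(1) mem_Collect_eq symmetric_functor_one_seq_iff fctr_cmonoid
    using F' X' by (simp add: fctr_cmonoid[abs_def])
qed

text \<open>The commutation condition is an equation between composites and the action of a
  transposition, all of which \<open>F\<close> preserves.\<close>

lemma cmonoids_arr_image:
  assumes F: "cartesian_functor M N F" and \<alpha>: "(Xs, X, \<alpha>) \<in> marr (cmonoids M)"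
  shows "(map (comp_fctr one_seq F) Xs, comp_fctr one_seq F X, farr F \<alpha>) \<in> marr (cmonoids N)"
proof -
  have mF: "multifunctor M N F"
    using F by (simp add: cartesian_functor_def)
  note F' = multifunctorD[OF mF] and \<alpha>' = cmonoids_arrD[OF \<alpha>]
  have "mcomp N (farr F (str_arr X k)) (replicate k (farr F \<alpha>)) =
    mact N (transpose_map (length Xs) k) (concat (replicate k (map (\<lambda>X. fobj F (under_obj X)) Xs)))
      (mcomp N (farr F \<alpha>) (map (\<lambda>X. farr F (str_arr X k)) Xs))" for k
  proof -
    let ?\<beta> = "mcomp M \<alpha> (map (\<lambda>Y. str_arr Y k) Xs)"
    have c: "composable M (str_arr X k) (replicate k \<alpha>)"
      using \<alpha>' by (simp add: composable_str set_replicate_conv_if)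
    have c': "composable M \<alpha> (map (\<lambda>Y. str_arr Y k) Xs)"
      using \<alpha>' by (auto simp: composable_def cmonoidD subset_iff)
    have "map (msrc M \<circ> (\<lambda>X. str_arr X k)) Xs = map (\<lambda>X. replicate k (under_obj X)) Xs"
      using \<alpha>'(1) by (auto simp: cmonoidD)
    then have "actable M (transpose_map (length Xs) k) (concat (replicate k (map under_obj Xs))) ?\<beta>"
      using comp_closed[OF c'] comp_src[OF c'] by (intro actable_transpose_map[OF \<alpha>'(1)]) (simp_all cong: map_cong)
    then have "farr F (mact M (transpose_map (length Xs) k) (concat (replicate k (map under_obj Xs))) ?\<beta>)
      = mact N (transpose_map (length Xs) k) (map (fobj F) (concat (replicate k (map under_obj Xs)))) (farr F ?\<beta>)"
      using F by (simp add: cartesian_functor_def)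
    then show ?thesis
      using F'(6)[OF c] F'(6)[OF c'] \<alpha>'(7)[of k] by (simp add: map_concat o_def)
  qed
  then show ?thesis
    using \<alpha>' F' cmonoid_image[OF F]
    by (auto simp: cmonoids_simps(2) commutes_with_str_def fctr_cmonoid o_def subset_iff)
qed

lemma cmonoids_map_arr:
  "(Xs, X, \<alpha>) \<in> marr (cmonoids M) \<Longrightarrow>
    farr (cmonoids_map M F) (Xs, X, \<alpha>) = (map (comp_fctr one_seq F) Xs, comp_fctr one_seq F X, farr F \<alpha>)"
  by (simp add: cmonoids_map_def)

lemma cmonoids_map_cartesian:
  assumes F: "cartesian_functor M N F"
  shows "cartesian_functor (cmonoids M) (cmonoids N) (cmonoids_map M F)"
proof -
  let ?G = "cmonoids_map M F"
  interpret C: cartesian_multicategory "cmonoids M" by (rule cmonoids_cartesian)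
  have mF: "multifunctor M N F"
    using F by (simp add: cartesian_functor_def)
  note F' = multifunctorD[OF mF]
  have obj: "fobj ?G X = comp_fctr one_seq F X" if "X \<in> mobj (cmonoids M)" for X
    using that by (simp add: cmonoids_map_def)
  have arr: "farr ?G f = (map (comp_fctr one_seq F) (fst f), comp_fctr one_seq F (fst (snd f)), farr F (under_arr f))"
    if "f \<in> marr (cmonoids M)" for f
    using that by (cases f) (simp add: cmonoids_map_arr)
  have objs: "map (fobj ?G) Xs = map (comp_fctr one_seq F) Xs" if "set Xs \<subseteq> mobj (cmonoids M)" for Xs
    using that obj by auto
  have under: "map under_obj (map (comp_fctr one_seq F) Xs) = map (fobj F) (map under_obj Xs)" for Xs
    by (simp add: fctr_cmonoid)
  have "multifunctor (cmonoids M) (cmonoids N) ?G"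
    unfolding multifunctor_def
  proof (intro conjI allI ballI impI)
    show "fobj ?G \<in> mobj (cmonoids M) \<rightarrow>\<^sub>E mobj (cmonoids N)"
      using cmonoid_image[OF F] by (auto simp: cmonoids_map_def)
    show "farr ?G \<in> marr (cmonoids M) \<rightarrow>\<^sub>E marr (cmonoids N)"
      using cmonoids_arr_image[OF F] by (auto simp: cmonoids_map_def)
    show "msrc (cmonoids N) (farr ?G f) = map (fobj ?G) (msrc (cmonoids M) f)"
      "mtgt (cmonoids N) (farr ?G f) = fobj ?G (mtgt (cmonoids M) f)" if f: "f \<in> marr (cmonoids M)" for f
      using C.src_closed[OF f] C.tgt_closed[OF f] by (simp_all add: arr f cmonoids_simps(3,4) obj objs)
    show "farr ?G (mid (cmonoids M) X) = mid (cmonoids N) (fobj ?G X)" if X: "X \<in> mobj (cmonoids M)" for X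
      using C.id_closed[OF X] X F'(5) cmonoidD(1)[OF X] by (simp add: arr obj cmonoids_simps(5) fctr_cmonoid)
    show "farr ?G (mcomp (cmonoids M) f gs) = mcomp (cmonoids N) (farr ?G f) (map (farr ?G) gs)"
      if c: "composable (cmonoids M) f gs" for f gs
    proof -
      note c' = composable_cmonoidsD[OF c]
      have "map (farr ?G) gs = map (\<lambda>f. (map (comp_fctr one_seq F) (fst f), comp_fctr one_seq F (fst (snd f)), farr F (under_arr f))) gs"
        using c'(3) arr by auto
      then show ?thesis
        using C.comp_closed[OF c] c'(2) F'(6)[OF c'(1)]
        by (simp add: arr cmonoids_simps(6) map_concat o_def cong: map_cong)
    qed
  qed
  moreover have "farr ?G (mact (cmonoids M) \<sigma> Ys f) = mact (cmonoids N) \<sigma> (map (fobj ?G) Ys) (farr ?G f)"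
    if a: "actable (cmonoids M) \<sigma> Ys f" for \<sigma> Ys f
  proof -
    have "set Ys \<subseteq> mobj (cmonoids M)" "f \<in> marr (cmonoids M)"
      using a by (auto simp: actable_def)
    moreover have "farr F (mact M \<sigma> (map under_obj Ys) (under_arr f))
      = mact N \<sigma> (map (fobj F) (map under_obj Ys)) (farr F (under_arr f))"
      using F actable_cmonoidsD(1)[OF a] unfolding cartesian_functor_def by blast
    ultimately show ?thesis
      using actable_cmonoidsD(2)[OF a] by (simp add: arr objs cmonoids_simps(7) under del: map_map)
  qed
  ultimately show ?thesis
    by (simp add: cartesian_functor_def)
qed

lemma forget_cartesian: "cartesian_functor (cmonoids M) M (forget M)"
proof -
  let ?F = "forget M"
  interpret C: cartesian_multicategory "cmonoids M" by (rule cmonoids_cartesian)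
  have obj: "fobj ?F X = under_obj X" if "X \<in> mobj (cmonoids M)" for X
    using that by (simp add: forget_def)
  have arr: "farr ?F f = under_arr f" if "f \<in> marr (cmonoids M)" for f
    using that by (simp add: forget_def)
  have objs: "map (fobj ?F) Xs = map under_obj Xs" if "set Xs \<subseteq> mobj (cmonoids M)" for Xs
    using that obj by auto
  have "multifunctor (cmonoids M) M ?F"
    unfolding multifunctor_def
  proof (intro conjI allI ballI impI)
    show "fobj ?F \<in> mobj (cmonoids M) \<rightarrow>\<^sub>E mobj M"
      using cmonoidD(1) by (auto simp: forget_def)
    show "farr ?F \<in> marr (cmonoids M) \<rightarrow>\<^sub>E marr M"
      using cmonoids_arrD(3) by (auto simp: forget_def)
    show "msrc M (farr ?F f) = map (fobj ?F) (msrc (cmonoids M) f)"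
      "mtgt M (farr ?F f) = fobj ?F (mtgt (cmonoids M) f)" if f: "f \<in> marr (cmonoids M)" for f
      using C.src_closed[OF f] C.tgt_closed[OF f] cmonoids_arrD(4,5)[of "fst f" "fst (snd f)" "under_arr f"] f
      by (simp_all add: arr f cmonoids_simps(3,4) obj objs)
    show "farr ?F (mid (cmonoids M) X) = mid M (fobj ?F X)" if X: "X \<in> mobj (cmonoids M)" for X
      using C.id_closed[OF X] X by (simp add: arr obj cmonoids_simps(5))
    show "farr ?F (mcomp (cmonoids M) f gs) = mcomp M (farr ?F f) (map (farr ?F) gs)"
      if c: "composable (cmonoids M) f gs" for f gs
    proof -
      note c' = composable_cmonoidsD[OF c]
      have "map (farr ?F) gs = map under_arr gs"
        using c'(3) arr by auto
      then show ?thesis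
        using C.comp_closed[OF c] c'(2) by (simp add: arr cmonoids_simps(6) cong: map_cong)
    qed
  qed
  moreover have "farr ?F (mact (cmonoids M) \<sigma> Ys f) = mact M \<sigma> (map (fobj ?F) Ys) (farr ?F f)"
    if a: "actable (cmonoids M) \<sigma> Ys f" for \<sigma> Ys f
    using a actable_cmonoidsD(2)[OF a] by (simp add: arr objs cmonoids_simps(7) actable_def)
  ultimately show ?thesis
    by (simp add: cartesian_functor_def)
qed

lemma cmonoids_map_id: "cmonoids_map M (id_fctr M) = id_fctr (cmonoids M)"
proof -
  have obj: "comp_fctr one_seq (id_fctr M) X = X" if "X \<in> mobj (cmonoids M)" for X
    by (rule cmonoid_eqI) (simp_all add: fctr_cmonoid id_fctr_def cmonoidD[OF that])
  have objs: "map (comp_fctr one_seq (id_fctr M)) Xs = Xs" if "set Xs \<subseteq> mobj (cmonoids M)" for Xs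
    using that obj by (auto intro!: map_idI)
  show ?thesis
    unfolding cmonoids_map_def id_fctr_def[of "cmonoids M"]
    using obj objs cmonoids_arrD(1-3)
    by (auto simp: fun_eq_iff restrict_def id_fctr_def split: prod.splits)
qed

lemma cmonoids_map_comp:
  assumes F: "cartesian_functor M N F"
  shows "cmonoids_map M (comp_fctr M G F) = comp_fctr (cmonoids M) (cmonoids_map N G) (cmonoids_map M F)"
proof -
  have mF: "multifunctor M N F"
    using F by (simp add: cartesian_functor_def)
  have obj: "comp_fctr one_seq (comp_fctr M G F) X = comp_fctr one_seq G (comp_fctr one_seq F X)"
    if "X \<in> mobj (cmonoids M)" for X
    by (rule cmonoid_eqI) (simp_all add: fctr_cmonoid comp_fctr_simps cmonoidD[OF that])
  show ?thesis
  proof (rule comp_fctr_eqI[symmetric])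
    show "fobj (cmonoids_map N G) (fobj (cmonoids_map M F) X) = fobj (cmonoids_map M (comp_fctr M G F)) X"
      if "X \<in> mobj (cmonoids M)" for X
      using that obj cmonoid_image[OF F] by (simp add: cmonoids_map_def)
    show "farr (cmonoids_map N G) (farr (cmonoids_map M F) f) = farr (cmonoids_map M (comp_fctr M G F)) f"
      if f: "f \<in> marr (cmonoids M)" for f
    proof (rule cmonoids_arr_cases[OF f])
      fix Xs X \<alpha> assume "f = (Xs, X, \<alpha>)" and \<alpha>: "(Xs, X, \<alpha>) \<in> marr (cmonoids M)"
      then show ?thesis
        using cmonoids_arr_image[OF F \<alpha>] cmonoids_arrD(1-3)[OF \<alpha>] obj
        by (auto simp: cmonoids_map_def comp_fctr_simps)
    qed
  qed (simp_all add: cmonoids_map_def)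
qed

text \<open>Stated after precomposition with \<open>G\<close>, which is naturality of the bijection
  of hom-sets in \<open>M\<close>. With \<open>lift\<close> as \<open>G\<close> it also shows that
  the lift of a functor lies over it.\<close>

lemma forget_natural:
  assumes F: "cartesian_functor M N F" and G: "multifunctor S (cmonoids M) G"
  shows "comp_fctr S (forget N) (comp_fctr S (cmonoids_map M F) G) = comp_fctr S F (comp_fctr S (forget M) G)"
proof (rule comp_fctr_eqI)
  note G' = multifunctorD(1,2)[OF G]
  show "fobj (forget N) (fobj (comp_fctr S (cmonoids_map M F) G) X) = fobj (comp_fctr S F (comp_fctr S (forget M) G)) X"
    if "X \<in> mobj S" for X
    using G'(1)[OF that] that cmonoid_image[OF F]
    by (simp add: comp_fctr_simps forget_def cmonoids_map_def fctr_cmonoid)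
  show "farr (forget N) (farr (comp_fctr S (cmonoids_map M F) G) f) = farr (comp_fctr S F (comp_fctr S (forget M) G)) f"
    if f: "f \<in> marr S" for f
  proof (rule cmonoids_arr_cases[OF G'(2)[OF f]])
    fix Xs X \<alpha> assume "farr G f = (Xs, X, \<alpha>)" and \<alpha>: "(Xs, X, \<alpha>) \<in> marr (cmonoids M)"
    then show ?thesis
      using cmonoids_arr_image[OF F \<alpha>] f by (simp add: comp_fctr_simps forget_def cmonoids_map_def)
  qed
qed (auto simp: comp_fctr_def)

section \<open>Sequential cartesian multicategories\<close>

text \<open>An Eckmann--Hilton argument.\<close>

lemma cmonoid_unique:
  assumes Y: "Y \<in> mobj (cmonoids M)" and Z: "Z \<in> mobj (cmonoids M)" and under: "under_obj Z = under_obj Y"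
    and arr: "\<And>n. (replicate n Y, Y, str_arr Z n) \<in> marr (cmonoids M)"
  shows "Z = Y"
proof (rule cmonoid_eqI[OF under])
  fix n
  note Y' = cmonoidD[OF Y] and Z' = cmonoidD[OF Z]
  \<comment> \<open>The nullary operations of \<open>Y\<close> and \<open>Z\<close> commute, and
    there are no arguments to transpose: the neutral elements coincide.\<close>
  have "str_arr Y 0 = mact M [] [] (str_arr Z 0)"
    using cmonoids_arrD(7)[OF arr[of 0], of 0] Y' Z' by (simp add: transpose_map_0 comp_nil)
  then have zero: "str_arr Y 0 = str_arr Z 0"
    using act_id[OF Z'(2)[of 0]] Z'(3)[of 0] by simp
  have "component (replicate n Y) (str_arr Z n) i = mid M (under_obj Y)" if i: "i < n" for i
  proof -
    have "unit_arrs (replicate n Y) i = map (\<lambda>l. if l = i then mid M (under_obj Y) else str_arr Z 0) [0..<n]"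
      by (simp add: unit_arrs_def zero)
    then show ?thesis
      using str_unit[OF Z _ _ i, of "mid M (under_obj Y)"] Y'(1) under
      by (simp add: component_def id_closed id_tgt)
  qed
  \<comment> \<open>So the n-ary operation of \<open>Z\<close> is the sum, formed in
    \<open>Y\<close>, of \<open>n\<close> identities.\<close>
  then have "map (component (replicate n Y) (str_arr Z n)) [0..<n] = map (mid M) (msrc M (str_arr Y n))"
    by (intro nth_equalityI) (simp_all add: Y')
  then show "str_arr Z n = str_arr Y n"
    using str_component[OF arr[of n]] comp_id[OF Y'(2)] by simp
qed

end

section \<open>Coordinates of arrows in a sequential multicategory\<close>

lemma bijective_map_nth_inject:
  assumes "bijective_map \<sigma> n" "length xs = n" "length ys = n" "map ((!) xs) \<sigma> = map ((!) ys) \<sigma>"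
  shows "xs = ys"
proof (rule nth_equalityI)
  fix i assume "i < length xs"
  then have "i \<in> set \<sigma>"
    using assms(1,2) by (simp add: bijective_map_iff)
  then show "xs ! i = ys ! i"
    using assms(4) by simp
qed (simp add: assms)

text \<open>The types of \<open>C\<close> are independent of those of \<open>M\<close>: in
  \<open>preadd_isomorphic_cMon\<close> the arrows of \<open>M\<close> are tuples of arrows of
  \<open>C\<close>, and both functors are identities.\<close>

locale sequential_cartesian_multicategory = plain_cartesian_multicategory M + C: category C
  for M :: "('o, 'a) act_multicat" and C :: "('p, 'b, 'c) cat_scheme" +
  fixes \<Phi> :: "('o, 'a, 'p, 'p \<times> 'b list) fctr" and \<Psi> :: "('p, 'p \<times> 'b list, 'o, 'a) fctr"
  assumes \<Phi>: "multifunctor M (seq_multicat C) \<Phi>" and \<Psi>: "multifunctor (seq_multicat C) M \<Psi>"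
    and \<Psi>\<Phi>: "comp_fctr M \<Psi> \<Phi> = id_fctr M" and \<Phi>\<Psi>: "comp_fctr (seq_multicat C) \<Phi> \<Psi> = id_fctr (seq_multicat C)"
begin

lemma inverse:
  "X \<in> mobj M \<Longrightarrow> fobj \<Psi> (fobj \<Phi> X) = X" "f \<in> marr M \<Longrightarrow> farr \<Psi> (farr \<Phi> f) = f"
  "Y \<in> cobj C \<Longrightarrow> fobj \<Phi> (fobj \<Psi> Y) = Y" "g \<in> marr (seq_multicat C) \<Longrightarrow> farr \<Phi> (farr \<Psi> g) = g"
  using comp_fctr_simps[of _ M \<Psi> \<Phi>] comp_fctr_simps[of _ "seq_multicat C" \<Phi> \<Psi>]
  by (simp_all add: \<Psi>\<Phi> \<Phi>\<Psi> id_fctr_def seq_multicat_simps(1))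

text \<open>The arrow \<open>f\<close> corresponds to the tuple \<open>coords f\<close>, and \<open>diag X n\<close> to a tuple of \<open>n\<close> identities.\<close>

definition coords :: "'a \<Rightarrow> 'b list" where
  "coords f = snd (farr \<Phi> f)"

definition diag :: "'o \<Rightarrow> nat \<Rightarrow> 'a" where
  "diag X n = farr \<Psi> (fobj \<Phi> X, replicate n (cid C (fobj \<Phi> X)))"

lemma farr_\<Phi>: "f \<in> marr M \<Longrightarrow> farr \<Phi> f = (fobj \<Phi> (mtgt M f), coords f)"
  using multifunctorD(4)[OF \<Phi>, of f] by (simp add: coords_def seq_multicat_simps(4) prod_eq_iff)

lemma coords_arr:
  assumes "f \<in> marr M"
  shows "map (csrc C) (coords f) = map (fobj \<Phi>) (msrc M f)" "length (coords f) = length (msrc M f)"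
    "\<forall>a\<in>set (coords f). a \<in> carr C \<and> ctgt C a = fobj \<Phi> (mtgt M f)"
proof -
  show src: "map (csrc C) (coords f) = map (fobj \<Phi>) (msrc M f)"
    using multifunctorD(3)[OF \<Phi> assms] by (simp add: coords_def seq_multicat_simps(3))
  show "length (coords f) = length (msrc M f)"
    using arg_cong[OF src, of length] by simp
  show "\<forall>a\<in>set (coords f). a \<in> carr C \<and> ctgt C a = fobj \<Phi> (mtgt M f)"
    using multifunctorD(2)[OF \<Phi> assms] by (simp add: farr_\<Phi>[OF assms] seq_multicat_simps(2))
qed

lemma coords_inject:
  "\<lbrakk>f \<in> marr M; g \<in> marr M; mtgt M f = mtgt M g; coords f = coords g\<rbrakk> \<Longrightarrow> f = g"
  using farr_\<Phi>[of f] farr_\<Phi>[of g] inverse(2)[of f] inverse(2)[of g] by simp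

lemma coords_comp:
  assumes "composable M f gs"
  shows "coords (mcomp M f gs) = concat (map2 (\<lambda>a g. map (ccomp C a) (coords g)) (coords f) gs)"
  using multifunctorD(6)[OF \<Phi> assms]
  by (simp add: coords_def seq_multicat_simps(6) zip_map2 o_def case_prod_unfold)

lemma id_arr: "X \<in> mobj M \<Longrightarrow> cid C (fobj \<Phi> X) \<in> carr C \<and> csrc C (cid C (fobj \<Phi> X)) = fobj \<Phi> X \<and>
    ctgt C (cid C (fobj \<Phi> X)) = fobj \<Phi> X"
  using C.id_hom[of "fobj \<Phi> X"] multifunctorD(1)[OF \<Phi>] by (auto simp: seq_multicat_simps(1) chom_def)

lemma coords_id: "X \<in> mobj M \<Longrightarrow> coords (mid M X) = [cid C (fobj \<Phi> X)]"
  using multifunctorD(5)[OF \<Phi>] by (simp add: coords_def seq_multicat_simps(5))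

lemma diag_arr:
  assumes X: "X \<in> mobj M"
  shows "diag X n \<in> marr M" "msrc M (diag X n) = replicate n X" "mtgt M (diag X n) = X"
    "coords (diag X n) = replicate n (cid C (fobj \<Phi> X))"
proof -
  let ?d = "(fobj \<Phi> X, replicate n (cid C (fobj \<Phi> X)))"
  have d: "?d \<in> marr (seq_multicat C)"
    using id_arr[OF X] multifunctorD(1)[OF \<Phi> X] by (simp add: seq_multicat_simps)
  show "diag X n \<in> marr M"
    using multifunctorD(2)[OF \<Psi> d] by (simp add: diag_def)
  show "msrc M (diag X n) = replicate n X" "mtgt M (diag X n) = X"
    using multifunctorD(3,4)[OF \<Psi> d] id_arr[OF X] inverse(1)[OF X]
    by (simp_all add: diag_def seq_multicat_simps(3,4))
  show "coords (diag X n) = replicate n (cid C (fobj \<Phi> X))"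
    using inverse(4)[OF d] by (simp add: coords_def diag_def)
qed

lemma comp_id_coords:
  assumes "f \<in> marr M" "i < length (msrc M f)"
  shows "ccomp C (coords f ! i) (cid C (fobj \<Phi> (msrc M f ! i))) = coords f ! i"
proof -
  have i: "i < length (coords f)"
    using assms by (simp add: coords_arr(2))
  have "coords f ! i \<in> chom C (fobj \<Phi> (msrc M f ! i)) (fobj \<Phi> (mtgt M f))"
    using coords_arr(3)[OF assms(1)] nth_mem[OF i] arg_cong[OF coords_arr(1)[OF assms(1)], of "\<lambda>xs. xs ! i"] i assms(2)
    by (simp add: chom_def)
  then show ?thesis
    by (rule C.comp_id)
qed

text \<open>A tuple of \<open>k i\<close> identities inserted at place \<open>i\<close> repeats
  coordinate \<open>i\<close> that many times; the empty tuple deletes it.\<close>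

lemma coords_comp_diag_args:
  assumes f: "f \<in> marr M" and h: "\<And>i. i < length (msrc M f) \<Longrightarrow> h i \<in> marr M \<and>
     mtgt M (h i) = msrc M f ! i \<and> coords (h i) = replicate (k i) (cid C (fobj \<Phi> (msrc M f ! i)))"
  shows "coords (mcomp M f (map h [0..<length (msrc M f)]))
    = concat (map (\<lambda>i. replicate (k i) (coords f ! i)) [0..<length (msrc M f)])"
proof -
  let ?n = "length (msrc M f)"
  have "map (mtgt M) (map h [0..<?n]) = msrc M f"
    using h by (intro nth_equalityI) simp_all
  then have "composable M f (map h [0..<?n])"
    using f h by (auto simp: composable_def)
  moreover have "map2 (\<lambda>a g. map (ccomp C a) (coords g)) (coords f) (map h [0..<?n])
    = map (\<lambda>i. replicate (k i) (coords f ! i)) [0..<?n]"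
    using h coords_arr(2)[OF f] comp_id_coords[OF f] by (intro nth_equalityI) simp_all
  ultimately show ?thesis
    by (simp add: coords_comp)
qed

text \<open>The analogue of \<open>unit_arrs\<close> before any monoid is available: the empty tuple
  takes the role of the neutral element.\<close>

definition unit_args :: "'o list \<Rightarrow> nat \<Rightarrow> 'a list" where
  "unit_args Bs j = map (\<lambda>l. if l = j then mid M (Bs ! l) else diag (Bs ! l) 0) [0..<length Bs]"

lemma coords_comp_unit_args:
  assumes f: "f \<in> marr M" and i: "i < length (msrc M f)"
  shows "coords (mcomp M f (unit_args (msrc M f) i)) = [coords f ! i]"
proof -
  let ?n = "length (msrc M f)"
  have B: "msrc M f ! l \<in> mobj M" if "l < ?n" for l
    using src_closed[OF f] that by auto
  have "coords (mcomp M f (unit_args (msrc M f) i))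
    = concat (map (\<lambda>l. replicate (if l = i then 1 else 0) (coords f ! l)) [0..<?n])"
    unfolding unit_args_def
    using B by (intro coords_comp_diag_args[OF f]) (auto simp: id_closed id_tgt coords_id diag_arr)
  also have "\<dots> = concat (map (\<lambda>l. if l = i then [coords f ! l] else []) [0..<?n])"
    by (intro arg_cong[where f = concat] map_cong) auto
  finally show ?thesis
    using concat_map_if_eq[OF i, of "\<lambda>l. [coords f ! l]"] by simp
qed

lemma unit_args:
  assumes "set Bs \<subseteq> mobj M" "j < length Bs"
  shows "set (unit_args Bs j) \<subseteq> marr M" "map (mtgt M) (unit_args Bs j) = Bs"
    "concat (map (msrc M) (unit_args Bs j)) = [Bs ! j]"
proof -
  have B: "Bs ! l \<in> mobj M" if "l < length Bs" for l
    using assms that by auto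
  then show "set (unit_args Bs j) \<subseteq> marr M" "map (mtgt M) (unit_args Bs j) = Bs"
    by (auto simp: unit_args_def id_closed id_tgt diag_arr intro!: nth_equalityI)
  have "map (msrc M) (unit_args Bs j) = map (\<lambda>l. if l = j then [Bs ! l] else []) [0..<length Bs]"
    using B by (auto simp: unit_args_def id_src diag_arr)
  then show "concat (map (msrc M) (unit_args Bs j)) = [Bs ! j]"
    using concat_map_if_eq[OF assms(2), of "\<lambda>l. [Bs ! l]"] by simp
qed

text \<open>Units are inserted everywhere except at place \<open>\<sigma> ! i\<close>, which
  isolates that coordinate of the result. By \<open>comp_act_fun\<close> they arrive at
  \<open>f\<close> as units everywhere except at place \<open>i\<close>, under the action of a
  mapping from one place to one place, which is the identity.\<close>

lemma coords_act:
  assumes act: "actable M \<sigma> Bs f" and bij: "bijective_map \<sigma> (length Bs)"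
  shows "map ((!) (coords (mact M \<sigma> Bs f))) \<sigma> = coords f"
proof (rule nth_equalityI)
  have f: "f \<in> marr M" and Bs: "set Bs \<subseteq> mobj M" and \<sigma>: "set \<sigma> \<subseteq> {..<length Bs}" "map ((!) Bs) \<sigma> = msrc M f"
    using act by (auto simp: actable_def reindexes_def)
  note g = act_closed[OF act] act_src[OF act]
  have len: "length \<sigma> = length (msrc M f)"
    using arg_cong[OF \<sigma>(2), of length] by simp
  show "length (map ((!) (coords (mact M \<sigma> Bs f))) \<sigma>) = length (coords f)"
    using f by (simp add: len coords_arr)
  fix i assume "i < length (map ((!) (coords (mact M \<sigma> Bs f))) \<sigma>)"
  then have i: "i < length (msrc M f)"
    by (simp add: len)
  let ?j = "\<sigma> ! i" and ?us = "unit_args Bs (\<sigma> ! i)"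
  have j: "?j < length Bs"
    using \<sigma>(1) i len by (auto simp: subset_iff)
  have Bj: "Bs ! ?j = msrc M f ! i"
    using arg_cong[OF \<sigma>(2), of "\<lambda>xs. xs ! i"] i len by simp
  note us = unit_args[OF Bs j]
  have us_len: "length ?us = length Bs"
    by (simp add: unit_args_def)
  \<comment> \<open>Reindexed along \<open>\<sigma>\<close>, the units around place
    \<open>\<sigma> ! i\<close> become the units around place \<open>i\<close>.\<close>
  have perm: "map ((!) ?us) \<sigma> = unit_args (msrc M f) i"
  proof (rule nth_equalityI)
    fix l assume "l < length (map ((!) ?us) \<sigma>)"
    then have l: "l < length \<sigma>" by simp
    \<comment> \<open>Bijectivity enters here: a second place over \<open>\<sigma> ! i\<close> would
      leave two variables instead of one.\<close>
    then have "\<sigma> ! l = ?j \<longleftrightarrow> l = i"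
      using bij i len by (auto simp: bijective_map_iff nth_eq_iff_index_eq)
    moreover have "\<sigma> ! l < length Bs"
      using \<sigma>(1) l by (auto simp: subset_iff)
    moreover have "Bs ! (\<sigma> ! l) = msrc M f ! l"
      using arg_cong[OF \<sigma>(2), of "\<lambda>xs. xs ! l"] l by simp
    ultimately show "map ((!) ?us) \<sigma> ! l = unit_args (msrc M f) i ! l"
      using l len j Bj by (simp add: unit_args_def)
  qed (simp add: len unit_args_def)
  let ?h = "mcomp M f (unit_args (msrc M f) i)"
  have c: "composable M f (unit_args (msrc M f) i)"
    using f unit_args(1,2)[OF src_closed[OF f] i] by (simp add: composable_def)
  have h: "?h \<in> marr M" "msrc M ?h = [Bs ! ?j]"
    using comp_closed[OF c] comp_src[OF c] unit_args(3)[OF src_closed[OF f] i] Bj by simp_all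
  have "reindexes (block_map \<sigma> (map length (map (msrc M) ?us))) (concat (map ((!) (map (msrc M) ?us)) \<sigma>)) (concat (map (msrc M) ?us))"
    using \<sigma>(1) by (intro reindexes_block_map) (simp add: us_len)
  moreover have "concat (map ((!) (map (msrc M) ?us)) \<sigma>) = msrc M ?h"
    using \<sigma>(1) by (simp only: map_nth_map us_len perm comp_src[OF c])
  ultimately have "reindexes (block_map \<sigma> (map (length \<circ> msrc M) ?us)) [Bs ! ?j] [Bs ! ?j]"
    by (simp add: h us(3))
  \<comment> \<open>Typing alone determines this mapping, as its domain and codomain have a single
    place.\<close>
  then have "block_map \<sigma> (map (length \<circ> msrc M) ?us) = [0]"
    by (auto simp: reindexes_def map_eq_Cons_conv)
  moreover have "mcomp M (mact M \<sigma> Bs f) ?us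
    = mact M (block_map \<sigma> (map (length \<circ> msrc M) ?us)) (concat (map (msrc M) ?us)) (mcomp M f (map ((!) ?us) \<sigma>))"
    using us by (intro comp_act_fun[OF act]) auto
  ultimately have "mcomp M (mact M \<sigma> Bs f) ?us = ?h"
    using act_id[OF h(1)] by (simp add: perm us(3) h(2))
  then have "coords (mact M \<sigma> Bs f) ! ?j = coords f ! i"
    using coords_comp_unit_args[OF g(1), of ?j] coords_comp_unit_args[OF f i] j by (simp add: g(2))
  then show "map ((!) (coords (mact M \<sigma> Bs f))) \<sigma> ! i = coords f ! i"
    using i len by simp
qed

section \<open>The canonical monoids and the unit of the adjunction\<close>

definition canonical :: "'o \<Rightarrow> ('o, 'a) cmonoid" where
  "canonical X = \<lparr>fobj = \<lambda>_. X, farr = \<lambda>f. diag X (length (snd f))\<rparr>"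

lemma canonical_simps: "under_obj (canonical X) = X" "str_arr (canonical X) n = diag X n"
  by (simp_all add: canonical_def under_obj_def str_arr_def)

lemma map_nth_msrc: "map (\<lambda>i. h (msrc M f ! i)) [0..<length (msrc M f)] = map h (msrc M f)"
  by (rule map_nth_upt_length) simp

lemma coords_comp_diag:
  "f \<in> marr M \<Longrightarrow> coords (mcomp M f (map (\<lambda>X. diag X k) (msrc M f))) = concat (map (replicate k) (coords f))"
  using coords_comp_diag_args[of f "\<lambda>i. diag (msrc M f ! i) k" "\<lambda>_. k"] src_closed[of f]
    map_nth_msrc[of "\<lambda>X. diag X k" f] map_nth_upt_length[of "coords f" "length (msrc M f)" "replicate k"]
  by (simp add: diag_arr subset_iff coords_arr)

lemma coords_diag_comp:
  assumes X: "X \<in> mobj M" and fs: "set fs \<subseteq> {f \<in> marr M. mtgt M f = X}"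
  shows "composable M (diag X (length fs)) fs"
    "coords (mcomp M (diag X (length fs)) fs) = concat (map coords fs)"
proof -
  show c: "composable M (diag X (length fs)) fs"
    using fs diag_arr[OF X] by (auto simp: composable_def map_eq_replicate_iff)
  have "map (ccomp C (cid C (fobj \<Phi> X))) (coords f) = coords f" if "f \<in> set fs" for f
    using fs that coords_arr(3)[of f] C.id_comp[of _ _ "fobj \<Phi> X"] by (fastforce intro!: map_idI simp: chom_def)
  then have "map2 (\<lambda>a g. map (ccomp C a) (coords g)) (replicate (length fs) (cid C (fobj \<Phi> X))) fs = map coords fs"
    by (intro nth_equalityI) simp_all
  then show "coords (mcomp M (diag X (length fs)) fs) = concat (map coords fs)"
    by (simp add: coords_comp[OF c] diag_arr[OF X])
qed

lemma canonical_cmonoid: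
  assumes X: "X \<in> mobj M"
  shows "canonical X \<in> mobj (cmonoids M)"
proof -
  note d = diag_arr[OF X]
  have "diag X 1 = mid M X"
    using d X by (intro coords_inject) (simp_all add: id_closed id_tgt coords_id)
  moreover have "mcomp M (diag X (length ks)) (map (diag X) ks) = diag X (sum_list ks)" for ks
  proof (rule coords_inject)
    have *: "set (map (diag X) ks) \<subseteq> {f \<in> marr M. mtgt M f = X}"
      using d by auto
    note c = coords_diag_comp[OF X *]
    show "mcomp M (diag X (length ks)) (map (diag X) ks) \<in> marr M" "mtgt M (mcomp M (diag X (length ks)) (map (diag X) ks)) = mtgt M (diag X (sum_list ks))"
      using comp_closed[OF c(1)] comp_tgt[OF c(1)] d by simp_all
    have "concat (map (\<lambda>k. replicate k x) ks) = replicate (sum_list ks) x" for x :: 'b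
      by (induction ks) (simp_all add: replicate_add)
    then show "coords (mcomp M (diag X (length ks)) (map (diag X) ks)) = coords (diag X (sum_list ks))"
      using c(2) d(4) by (simp add: o_def)
  qed (rule d)
  moreover have "mact M \<sigma> (replicate (length \<sigma>) X) (diag X (length \<sigma>)) = diag X (length \<sigma>)"
    if bij: "bijective_map \<sigma> (length \<sigma>)" for \<sigma>
  proof (rule coords_inject)
    have act: "actable M \<sigma> (replicate (length \<sigma>) X) (diag X (length \<sigma>))"
      using bij d X by (auto simp: actable_def reindexes_def bijective_map_iff map_eq_replicate_iff set_replicate_conv_if)
    show "mact M \<sigma> (replicate (length \<sigma>) X) (diag X (length \<sigma>)) \<in> marr M"
      "mtgt M (mact M \<sigma> (replicate (length \<sigma>) X) (diag X (length \<sigma>))) = mtgt M (diag X (length \<sigma>))"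
      using act_closed[OF act] act_tgt[OF act] by simp_all
    \<comment> \<open>A constant tuple is invariant under permutations. Since
      \<open>coords_act\<close> describes the new tuple only after reindexing, the injectivity of
      reindexing along a bijection is used.\<close>
    show "coords (mact M \<sigma> (replicate (length \<sigma>) X) (diag X (length \<sigma>))) = coords (diag X (length \<sigma>))"
    proof (rule bijective_map_nth_inject[OF bij])
      show "length (coords (mact M \<sigma> (replicate (length \<sigma>) X) (diag X (length \<sigma>)))) = length \<sigma>"
        using coords_arr(2)[OF act_closed[OF act]] act_src[OF act] by simp
      have "map ((!) (coords (diag X (length \<sigma>)))) \<sigma> = coords (diag X (length \<sigma>))"
        using bij by (auto simp: d map_eq_replicate_iff bijective_map_iff)
      then show "map ((!) (coords (mact M \<sigma> (replicate (length \<sigma>) X) (diag X (length \<sigma>))))) \<sigma>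
         = map ((!) (coords (diag X (length \<sigma>)))) \<sigma>"
        using coords_act[OF act] bij by simp
    qed (simp add: d)
  qed (rule d)
  ultimately show ?thesis
    unfolding cmonoids_simps(1) mem_Collect_eq symmetric_functor_one_seq_iff canonical_simps
    using X d by (simp add: canonical_simps[abs_def])
qed

text \<open>As tuples, one side is \<open>coords \<alpha>\<close> repeated \<open>k\<close> times,
  the other repeats each coordinate \<open>k\<close> times before transposing. The transposition is
  a bijection, so \<open>coords_act\<close> compares the two.\<close>

lemma canonical_commutes:
  assumes \<alpha>: "\<alpha> \<in> marr M"
  shows "(map canonical (msrc M \<alpha>), canonical (mtgt M \<alpha>), \<alpha>) \<in> marr (cmonoids M)"
proof -
  let ?n = "length (msrc M \<alpha>)"
  have objs: "set (map canonical (msrc M \<alpha>)) \<subseteq> mobj (cmonoids M)" "canonical (mtgt M \<alpha>) \<in> mobj (cmonoids M)"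
    using canonical_cmonoid src_closed[OF \<alpha>] tgt_closed[OF \<alpha>] by auto
  have "mcomp M (diag (mtgt M \<alpha>) k) (replicate k \<alpha>) =
    mact M (transpose_map ?n k) (concat (replicate k (msrc M \<alpha>))) (mcomp M \<alpha> (map (\<lambda>X. diag X k) (msrc M \<alpha>)))" (is "?l = ?r") for k
  proof (rule coords_inject)
    let ?\<beta> = "mcomp M \<alpha> (map (\<lambda>X. diag X k) (msrc M \<alpha>))"
    have "set (replicate k \<alpha>) \<subseteq> {f \<in> marr M. mtgt M f = mtgt M \<alpha>}"
      using \<alpha> by auto
    note l = coords_diag_comp[OF tgt_closed[OF \<alpha>] this, simplified]
    have c: "composable M \<alpha> (map (\<lambda>X. diag X k) (msrc M \<alpha>))"
      using \<alpha> src_closed[OF \<alpha>] by (auto simp: composable_def diag_arr subset_iff intro!: map_idI)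
    have "msrc M ?\<beta> = concat (map (replicate k) (msrc M \<alpha>))"
      using src_closed[OF \<alpha>] comp_src[OF c] by (auto simp: diag_arr subset_iff intro!: arg_cong[where f = concat])
    then have act: "actable M (transpose_map ?n k) (concat (replicate k (msrc M \<alpha>))) ?\<beta>"
      using reindexes_transpose_map[of "msrc M \<alpha>" k] comp_closed[OF c] src_closed[OF \<alpha>]
      by (auto simp: actable_def)
    show "?l \<in> marr M" "?r \<in> marr M" "mtgt M ?l = mtgt M ?r"
      using comp_closed[OF l(1)] comp_tgt[OF l(1)] act_closed[OF act] act_tgt[OF act] comp_tgt[OF c] diag_arr(3)[OF tgt_closed[OF \<alpha>]]
      by simp_all
    have len: "length (concat (replicate k (msrc M \<alpha>))) = ?n * k"
      by (simp add: length_concat sum_list_replicate)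
    show "coords ?l = coords ?r"
    proof (rule bijective_map_nth_inject[OF bijective_transpose_map])
      show "length (coords ?l) = ?n * k"
        using l(2) coords_arr(2)[OF \<alpha>] by (simp add: length_concat sum_list_replicate)
      show "length (coords ?r) = ?n * k"
        using coords_arr(2)[OF act_closed[OF act]] act_src[OF act] len by simp
      have "map ((!) (coords ?l)) (transpose_map ?n k) = concat (map (replicate k) (coords \<alpha>))"
        using reindexes_transpose_map[of "coords \<alpha>" k] l(2) coords_arr(2)[OF \<alpha>] by (simp add: reindexes_def)
      also have "\<dots> = map ((!) (coords ?r)) (transpose_map ?n k)"
        using coords_act[OF act] coords_comp_diag[OF \<alpha>] len by (simp add: bijective_transpose_map)
      finally show "map ((!) (coords ?l)) (transpose_map ?n k) = map ((!) (coords ?r)) (transpose_map ?n k)" .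
    qed
  qed
  then have "commutes_with_str M (map canonical (msrc M \<alpha>)) (canonical (mtgt M \<alpha>)) \<alpha>"
    by (simp add: commutes_with_str_def canonical_simps o_def)
  then show ?thesis
    using objs \<alpha> by (simp add: cmonoids_simps(2) canonical_simps o_def)
qed

text \<open>The unit of the adjunction: a section of \<open>forget M\<close>, from which
  \<open>cmonoids_map\<close> produces the lift of any functor.\<close>

definition lift :: "('o, 'a, ('o, 'a) cmonoid, ('o, 'a) cmon_arr) fctr" where
  "lift = \<lparr>fobj = restrict canonical (mobj M),
     farr = (\<lambda>f\<in>marr M. (map canonical (msrc M f), canonical (mtgt M f), f))\<rparr>"

lemma lift_cartesian: "cartesian_functor M (cmonoids M) lift"
proof -
  have obj: "fobj lift X = canonical X" if "X \<in> mobj M" for X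
    using that by (simp add: lift_def)
  have arr: "farr lift f = (map canonical (msrc M f), canonical (mtgt M f), f)" if "f \<in> marr M" for f
    using that by (simp add: lift_def)
  have objs: "map (fobj lift) Xs = map canonical Xs" if "set Xs \<subseteq> mobj M" for Xs
    using that obj by auto
  have "multifunctor M (cmonoids M) lift"
    unfolding multifunctor_def
  proof (intro conjI allI ballI impI)
    show "fobj lift \<in> mobj M \<rightarrow>\<^sub>E mobj (cmonoids M)" "farr lift \<in> marr M \<rightarrow>\<^sub>E marr (cmonoids M)"
      using canonical_cmonoid canonical_commutes by (auto simp: lift_def)
    show "msrc (cmonoids M) (farr lift f) = map (fobj lift) (msrc M f)"
      "mtgt (cmonoids M) (farr lift f) = fobj lift (mtgt M f)" if f: "f \<in> marr M" for f
      using src_closed[OF f] tgt_closed[OF f] by (simp_all add: arr f cmonoids_simps(3,4) obj objs)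
    show "farr lift (mid M X) = mid (cmonoids M) (fobj lift X)" if "X \<in> mobj M" for X
      using that by (simp add: arr obj id_closed id_src id_tgt cmonoids_simps(5) canonical_simps)
    show "farr lift (mcomp M f gs) = mcomp (cmonoids M) (farr lift f) (map (farr lift) gs)"
      if c: "composable M f gs" for f gs
      using c comp_closed[OF c] comp_src[OF c] comp_tgt[OF c]
      by (simp add: arr composable_def subset_iff cmonoids_simps(6) map_concat o_def map_idI cong: map_cong)
  qed
  moreover have "farr lift (mact M \<sigma> Bs f) = mact (cmonoids M) \<sigma> (map (fobj lift) Bs) (farr lift f)"
    if a: "actable M \<sigma> Bs f" for \<sigma> Bs f
    using a act_closed[OF a] act_src[OF a] act_tgt[OF a]
    by (simp add: arr objs actable_def cmonoids_simps(7) canonical_simps o_def)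
  ultimately show ?thesis
    by (simp add: cartesian_functor_def)
qed

end

section \<open>The universal property of the forgetful functor\<close>

lemma sequential_cartesianE:
  assumes "fpSeq_obj S"
  obtains C :: "('o, 'a) cat" and \<Phi> \<Psi> where "sequential_cartesian_multicategory (S :: ('o, 'a) act_multicat) C \<Phi> \<Psi>"
  using assms
  by (auto simp: fpSeq_obj_def fpMlt_obj_def sequential_def multicat_isomorphic_def sequential_cartesian_multicategory_def
      plain_cartesian_multicategory_def sequential_cartesian_multicategory_axioms_def)

text \<open>\<open>forget N\<close> is the counit. Surjectivity rests on a triangle identity, with
  \<open>cmonoids_map M F\<close> after \<open>lift\<close> as preimage of \<open>F\<close>. For
  injectivity, the composite with \<open>forget N\<close> fixes the underlying arrows, and the
  monoids are fixed by the uniqueness of commuting structures.\<close>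

lemma (in sequential_cartesian_multicategory) bij_forget:
  assumes N: "cartesian_multicategory N"
  shows "bij_betw (comp_fctr M (forget N)) (fpMlt_hom M (cmonoids N)) (fpMlt_hom M N)"
proof (rule bij_betw_imageI)
  interpret N: plain_cartesian_multicategory N
    using N by (simp add: plain_cartesian_multicategory_def)
  have hom: "comp_fctr M H F \<in> fpMlt_hom M P" if "F \<in> fpMlt_hom M Q" "cartesian_functor Q P H" for H F P Q
    using that comp_cartesian_functor[OF multicategory_axioms _ _ act_closed] by (auto simp: fpMlt_hom_def)
  have "\<exists>G\<in>fpMlt_hom M (cmonoids N). F = comp_fctr M (forget N) G" if F: "F \<in> fpMlt_hom M N" for F
  proof (rule bexI)
    let ?G = "comp_fctr M (cmonoids_map M F) lift"
    have cF: "cartesian_functor M N F"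
      using F by (simp add: fpMlt_hom_def)
    show "?G \<in> fpMlt_hom M (cmonoids N)"
      using lift_cartesian cmonoids_map_cartesian[OF cF] by (intro hom) (simp_all add: fpMlt_hom_def)
    have "multifunctor M (cmonoids M) lift" and mF: "multifunctor M N F"
      using lift_cartesian cF by (simp_all add: cartesian_functor_def)
    then have "comp_fctr M (forget N) ?G = comp_fctr M F (comp_fctr M (forget M) lift)"
      using forget_natural[OF cF] by blast
    also have "comp_fctr M (forget M) lift = id_fctr M"
      using canonical_cmonoid canonical_commutes
      by (intro comp_fctr_eqI) (simp_all add: lift_def forget_def id_fctr_def canonical_simps)
    also have "comp_fctr M F (id_fctr M) = F"
      using multifunctorD(8,9)[OF mF] by (intro comp_fctr_eqI) (simp_all add: id_fctr_def)
    finally show "F = comp_fctr M (forget N) ?G" by simp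
  qed
  moreover have "comp_fctr M (forget N) G \<in> fpMlt_hom M N" if "G \<in> fpMlt_hom M (cmonoids N)" for G
    using that N.forget_cartesian by (rule hom)
  ultimately show "comp_fctr M (forget N) ` fpMlt_hom M (cmonoids N) = fpMlt_hom M N"
    by blast
  \<comment> \<open>\<open>G\<close> sends a tuple of \<open>n\<close> identities to an arrow of
    monoids between copies of \<open>fobj G X\<close>. So the operations that the composite with
    \<open>forget N\<close> transports from \<open>canonical X\<close> commute with those of
    \<open>fobj G X\<close>.\<close>
  have unique: "comp_fctr one_seq (comp_fctr M (forget N) G) (canonical X) = fobj G X"
    if G: "multifunctor M (cmonoids N) G" and X: "X \<in> mobj M" and "cartesian_functor M N (comp_fctr M (forget N) G)" for G X
  proof (rule N.cmonoid_unique)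
    note G' = multifunctorD[OF G]
    show Y: "fobj G X \<in> mobj (cmonoids N)"
      using G'(1)[OF X] .
    show "comp_fctr one_seq (comp_fctr M (forget N) G) (canonical X) \<in> mobj (cmonoids N)"
      using that(3) canonical_cmonoid[OF X] by (rule cmonoid_image)
    show "under_obj (comp_fctr one_seq (comp_fctr M (forget N) G) (canonical X)) = under_obj (fobj G X)"
      using X Y by (simp add: fctr_cmonoid canonical_simps comp_fctr_simps forget_def)
    show "(replicate n (fobj G X), fobj G X, str_arr (comp_fctr one_seq (comp_fctr M (forget N) G) (canonical X)) n) \<in> marr (cmonoids N)" for n
    proof -
      note d = diag_arr(1-3)[OF X, of n]
      have "farr G (diag X n) = (replicate n (fobj G X), fobj G X, under_arr (farr G (diag X n)))"
        using G'(3,4)[OF d(1)] d by (cases "farr G (diag X n)") (simp add: cmonoids_simps(3,4))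
      then show ?thesis
        using G'(2)[OF d(1)] d(1) by (simp add: fctr_cmonoid canonical_simps comp_fctr_simps forget_def)
    qed
  qed
  show "inj_on (comp_fctr M (forget N)) (fpMlt_hom M (cmonoids N))"
  proof (rule inj_onI)
    fix G H assume G: "G \<in> fpMlt_hom M (cmonoids N)" and H: "H \<in> fpMlt_hom M (cmonoids N)"
      and eq: "comp_fctr M (forget N) G = comp_fctr M (forget N) H"
    have mG: "multifunctor M (cmonoids N) G" and mH: "multifunctor M (cmonoids N) H"
      using G H by (simp_all add: fpMlt_hom_def cartesian_functor_def)
    note G' = multifunctorD[OF mG] and H' = multifunctorD[OF mH]
    have "cartesian_functor M N (comp_fctr M (forget N) G)"
      using hom[OF G N.forget_cartesian] by (simp add: fpMlt_hom_def)
    then have obj: "fobj G X = fobj H X" if "X \<in> mobj M" for X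
      using unique[OF mG that] unique[OF mH that] eq by metis
    have arr: "farr G f = farr H f" if f: "f \<in> marr M" for f
    proof -
      have "under_arr (farr G f) = farr (comp_fctr M (forget N) G) f"
        using f G'(2)[OF f] by (simp add: comp_fctr_simps forget_def)
      also have "\<dots> = under_arr (farr H f)"
        unfolding eq using f H'(2)[OF f] by (simp add: comp_fctr_simps forget_def)
      finally have "under_arr (farr G f) = under_arr (farr H f)" .
      moreover have "map (fobj G) (msrc M f) = map (fobj H) (msrc M f)"
        using obj src_closed[OF f] by auto
      ultimately show ?thesis
        using G'(3,4)[OF f] H'(3,4)[OF f] obj[OF tgt_closed[OF f]]
        by (simp add: cmonoids_simps(3,4) prod_eq_iff)
    qed
    show "G = H"
      using obj arr G'(8,9) H'(8,9)
      by (auto intro!: fctr.equality extensionalityI[of _ "mobj M"] extensionalityI[of _ "marr M"])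
  qed
qed

section \<open>Preadditive categories\<close>

lemma offset_add_le:
  assumes "i < j" "j \<le> length ls"
  shows "sum_list (take i ls) + ls ! i \<le> sum_list (take j (ls :: nat list))"
  using offset_le[of i "take j ls"] assms by (simp add: min_absorb1)

lemma offset_inject:
  assumes "sum_list (take i ls) + k = sum_list (take j ls) + l" "k < ls ! i" "l < ls ! j"
    "i < length ls" "j < length (ls :: nat list)"
  shows "i = j \<and> k = l"
  using assms offset_add_le[of i j ls] offset_add_le[of j i ls] by (cases i j rule: linorder_cases) auto

lemma nth_concat_offset:
  assumes "j < length xss" "k < length (xss ! j)"
  shows "concat xss ! (sum_list (take j (map length xss)) + k) = xss ! j ! k"
  using arg_cong[OF map_nth_offset[OF assms(1)], of "\<lambda>xs. xs ! k"] assms(2) by simp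

text \<open>The summands that meet at place \<open>j\<close> when \<open>\<sigma>\<close> acts on
  the tuple \<open>fs\<close>; a list, so that repeated arrows are counted.\<close>

definition fiber :: "nat list \<Rightarrow> 'a list \<Rightarrow> nat \<Rightarrow> 'a list" where
  "fiber \<sigma> fs j = map snd (filter (\<lambda>p. fst p = j) (zip \<sigma> fs))"

lemma fiber_map: "fiber (map h is) (map g is) t = map g (filter (\<lambda>i. h i = t) is)"
  by (induction "is") (auto simp: fiber_def)

lemma fiber_map_right: "fiber \<sigma> (map g fs) j = map g (fiber \<sigma> fs j)"
  by (simp add: fiber_def zip_map2 filter_map o_def case_prod_unfold)

lemma fiber_append:
  "length \<sigma> = length fs \<Longrightarrow> fiber (\<sigma> @ \<rho>) (fs @ gs) j = fiber \<sigma> fs j @ fiber \<rho> gs j"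
  by (simp add: fiber_def)

lemma fiber_eq_Nil: "j \<notin> set \<sigma> \<Longrightarrow> fiber \<sigma> fs j = []"
  by (auto simp: fiber_def filter_empty_conv dest: set_zip_leftD)

lemma fiber_shift: "fiber (map ((+) m) \<sigma>) fs (m + j) = fiber \<sigma> fs j"
  by (simp add: fiber_def zip_map1 filter_map o_def case_prod_unfold)

lemma filter_upt_eq: "filter (\<lambda>i. i = j) [0..<n] = (if j < n then [j] else [])"
  by (induction n) auto

text \<open>Distinct blocks are disjoint, so place \<open>k\<close> of block \<open>j\<close> is
  reached only from the copies of block \<open>j\<close>, and once from each of them.\<close>

lemma fiber_block_map:
  assumes len: "length \<sigma> = length fs" and \<sigma>: "set \<sigma> \<subseteq> {..<length xss}" and j: "j < length xss" "k < length (xss ! j)"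
  defines "ls \<equiv> map length xss"
  shows "fiber (block_map \<sigma> ls) (concat (map2 (\<lambda>f xs. map (h f) xs) fs (map ((!) xss) \<sigma>))) (sum_list (take j ls) + k)
    = map (\<lambda>f. h f (xss ! j ! k)) (fiber \<sigma> fs j)"
  using len \<sigma>
proof (induction \<sigma> fs rule: list_induct2)
  case Nil
  then show ?case by (simp add: fiber_def block_map_def)
next
  case (Cons s \<sigma> f fs)
  let ?t = "sum_list (take j ls) + k"
  have s: "s < length xss"
    using Cons.prems by simp
  have "map (h f) (xss ! s) = map (\<lambda>i. h f (xss ! s ! i)) [0..<ls ! s]"
    by (rule nth_equalityI) (simp_all add: ls_def s)
  then have "fiber (map (\<lambda>i. sum_list (take s ls) + i) [0..<ls ! s]) (map (h f) (xss ! s)) ?t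
    = map (\<lambda>i. h f (xss ! s ! i)) (filter (\<lambda>i. sum_list (take s ls) + i = ?t) [0..<ls ! s])"
    by (simp only: fiber_map)
  \<comment> \<open>A place determines its block and its position there, so at most one entry of
    this block survives.\<close>
  also have "filter (\<lambda>i. sum_list (take s ls) + i = ?t) [0..<ls ! s] = filter (\<lambda>i. i = k \<and> s = j) [0..<ls ! s]"
    using offset_inject[of s ls _ j k] s j by (intro filter_cong refl) (auto simp: ls_def)
  also have "map (\<lambda>i. h f (xss ! s ! i)) \<dots> = (if s = j then [h f (xss ! j ! k)] else [])"
    using j by (auto simp: filter_upt_eq ls_def)
  finally have block: "fiber (map (\<lambda>i. sum_list (take s ls) + i) [0..<ls ! s]) (map (h f) (xss ! s)) ?t = \<dots>" .
  have "block_map (s # \<sigma>) ls = map (\<lambda>i. sum_list (take s ls) + i) [0..<ls ! s] @ block_map \<sigma> ls"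
    by (simp add: block_map_def)
  moreover have "length (map (\<lambda>i. sum_list (take s ls) + i) [0..<ls ! s]) = length (map (h f) (xss ! s))"
    by (simp add: ls_def s)
  ultimately have "fiber (block_map (s # \<sigma>) ls) (concat (map2 (\<lambda>f xs. map (h f) xs) (f # fs) (map ((!) xss) (s # \<sigma>)))) ?t
    = (if s = j then [h f (xss ! j ! k)] else []) @ map (\<lambda>f. h f (xss ! j ! k)) (fiber \<sigma> fs j)"
    using Cons block by (simp add: fiber_append)
  then show ?case
    by (simp add: fiber_def)
qed

lemma additive_functorD:
  assumes "additive_functor C D F"
  shows "X \<in> cobj C \<Longrightarrow> fobj F X \<in> cobj D" "f \<in> carr C \<Longrightarrow> farr F f \<in> carr D"
    "f \<in> carr C \<Longrightarrow> csrc D (farr F f) = fobj F (csrc C f)" "f \<in> carr C \<Longrightarrow> ctgt D (farr F f) = fobj F (ctgt C f)"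
    "X \<in> cobj C \<Longrightarrow> farr F (cid C X) = cid D (fobj F X)"
    "f \<in> chom C X Y \<Longrightarrow> g \<in> chom C Y Z \<Longrightarrow> farr F (ccomp C g f) = ccomp D (farr F g) (farr F f)"
    "X \<in> cobj C \<Longrightarrow> Y \<in> cobj C \<Longrightarrow> farr F (czero C X Y) = czero D (fobj F X) (fobj F Y)"
    "f \<in> chom C X Y \<Longrightarrow> g \<in> chom C X Y \<Longrightarrow> farr F (cadd C f g) = cadd D (farr F f) (farr F g)"
  using assms unfolding additive_functor_def by (auto simp: PiE_def)

context preadditive_category
begin

lemma add_closed: "f \<in> chom C X Y \<Longrightarrow> g \<in> chom C X Y \<Longrightarrow> cadd C f g \<in> chom C X Y"
  and zero_closed: "X \<in> cobj C \<Longrightarrow> Y \<in> cobj C \<Longrightarrow> czero C X Y \<in> chom C X Y"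
  and add_assoc: "f \<in> chom C X Y \<Longrightarrow> g \<in> chom C X Y \<Longrightarrow> h \<in> chom C X Y \<Longrightarrow>
    cadd C (cadd C f g) h = cadd C f (cadd C g h)"
  and add_commute: "f \<in> chom C X Y \<Longrightarrow> g \<in> chom C X Y \<Longrightarrow> cadd C f g = cadd C g f"
  and zero_add: "f \<in> chom C X Y \<Longrightarrow> cadd C (czero C X Y) f = f"
  and add_zero: "f \<in> chom C X Y \<Longrightarrow> cadd C f (czero C X Y) = f"
proof -
  have cm: "Group.comm_monoid \<lparr>carrier = chom C X Y, monoid.mult = cadd C, one = czero C X Y\<rparr>"
    if "f \<in> chom C X Y" for f
    using that src_closed tgt_closed by (intro hom_comm_monoid) (auto simp: chom_def)
  note m = Group.comm_monoid.axioms(1)[OF cm]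
  show "f \<in> chom C X Y \<Longrightarrow> g \<in> chom C X Y \<Longrightarrow> cadd C f g \<in> chom C X Y"
    using monoid.m_closed[OF m] by simp
  show "X \<in> cobj C \<Longrightarrow> Y \<in> cobj C \<Longrightarrow> czero C X Y \<in> chom C X Y"
    using monoid.one_closed[OF Group.comm_monoid.axioms(1)[OF hom_comm_monoid]] by simp
  show "f \<in> chom C X Y \<Longrightarrow> g \<in> chom C X Y \<Longrightarrow> h \<in> chom C X Y \<Longrightarrow>
    cadd C (cadd C f g) h = cadd C f (cadd C g h)"
    using monoid.m_assoc[OF m] by simp
  show "f \<in> chom C X Y \<Longrightarrow> g \<in> chom C X Y \<Longrightarrow> cadd C f g = cadd C g f"
    using Group.comm_monoid.m_comm[OF cm] by simp
  show "f \<in> chom C X Y \<Longrightarrow> cadd C (czero C X Y) f = f" "f \<in> chom C X Y \<Longrightarrow> cadd C f (czero C X Y) = f"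
    using monoid.l_one[OF m] monoid.r_one[OF m] by simp_all
qed

lemma chom_objs: "f \<in> chom C X Y \<Longrightarrow> X \<in> cobj C \<and> Y \<in> cobj C"
  using src_closed tgt_closed by (auto simp: chom_def)

lemma preadd_isomorphicI:
  assumes D: "category D" and F: "additive_functor C D F"
    and obj: "bij_betw (fobj F) (cobj C) (cobj D)" and arr: "bij_betw (farr F) (carr C) (carr D)"
  shows "preadd_isomorphic C D"
proof -
  interpret D: category D by fact
  note F' = additive_functorD[OF F]
  define G where "G = \<lparr>fobj = restrict (inv_into (cobj C) (fobj F)) (cobj D),
    farr = restrict (inv_into (carr C) (farr F)) (carr D)\<rparr>"
  have obj_inv: "fobj F (fobj G Y) = Y" "fobj G Y \<in> cobj C" if "Y \<in> cobj D" for Y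
    using that obj by (auto simp: G_def bij_betw_inv_into_right bij_betwE[OF bij_betw_inv_into])
  have arr_inv: "farr F (farr G g) = g" "farr G g \<in> carr C" if "g \<in> carr D" for g
    using that arr by (auto simp: G_def bij_betw_inv_into_right bij_betwE[OF bij_betw_inv_into])
  have obj_eq: "fobj G (fobj F X) = X" if "X \<in> cobj C" for X
    using that obj bij_betwE[OF obj] by (simp add: G_def bij_betw_inv_into_left)
  have arr_eq: "farr G (farr F f) = f" if "f \<in> carr C" for f
    using that arr bij_betwE[OF arr] by (simp add: G_def bij_betw_inv_into_left)
  have src: "csrc C (farr G g) = fobj G (csrc D g)" and tgt: "ctgt C (farr G g) = fobj G (ctgt D g)"
    if g: "g \<in> carr D" for g
    using F'(3,4)[OF arr_inv(2)[OF g]] arr_inv[OF g] obj_eq src_closed tgt_closed by metis+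
  have hom: "farr G g \<in> chom C (fobj G X) (fobj G Y)" "farr F (farr G g) = g" if "g \<in> chom D X Y" for g X Y
    using that src tgt arr_inv by (auto simp: chom_def)
  have carr: "f \<in> carr C" if "f \<in> chom C X Y" for f X Y
    using that by (simp add: chom_def)
  have "farr G (cid D X) = cid C (fobj G X)" if "X \<in> cobj D" for X
    using F'(5)[OF obj_inv(2)[OF that]] obj_inv[OF that] arr_eq[OF carr[OF id_hom]] by metis
  moreover have "farr G (ccomp D g f) = ccomp C (farr G g) (farr G f)"
    if "f \<in> chom D X Y" "g \<in> chom D Y Z" for f g X Y Z
    using F'(6)[OF hom(1)[OF that(1)] hom(1)[OF that(2)]] hom(2)[OF that(1)] hom(2)[OF that(2)]
      arr_eq[OF carr[OF comp_hom[OF hom(1)[OF that(1)] hom(1)[OF that(2)]]]] by simp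
  moreover have "farr G (czero D X Y) = czero C (fobj G X) (fobj G Y)" if "X \<in> cobj D" "Y \<in> cobj D" for X Y
    using F'(7)[OF obj_inv(2)[OF that(1)] obj_inv(2)[OF that(2)]] obj_inv(1) that
      arr_eq[OF carr[OF zero_closed[OF obj_inv(2)[OF that(1)] obj_inv(2)[OF that(2)]]]] by simp
  moreover have "farr G (cadd D f g) = cadd C (farr G f) (farr G g)"
    if "f \<in> chom D X Y" "g \<in> chom D X Y" for f g X Y
    using F'(8)[OF hom(1)[OF that(1)] hom(1)[OF that(2)]] hom(2)[OF that(1)] hom(2)[OF that(2)]
      arr_eq[OF carr[OF add_closed[OF hom(1)[OF that(1)] hom(1)[OF that(2)]]]] by simp
  ultimately have "additive_functor D C G"
    unfolding additive_functor_def using obj_inv arr_inv src tgt by (auto simp: G_def)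
  then show ?thesis
    unfolding preadd_isomorphic_def using F obj_inv arr_inv obj_eq arr_eq by blast
qed

section \<open>Finite sums of arrows\<close>

definition csum :: "'o \<Rightarrow> 'o \<Rightarrow> 'a list \<Rightarrow> 'a" where
  "csum X Y fs = foldr (cadd C) fs (czero C X Y)"

lemma csum_simps: "csum X Y [] = czero C X Y" "csum X Y (f # fs) = cadd C f (csum X Y fs)"
  by (simp_all add: csum_def)

lemma csum_closed: "\<lbrakk>X \<in> cobj C; Y \<in> cobj C; set fs \<subseteq> chom C X Y\<rbrakk> \<Longrightarrow> csum X Y fs \<in> chom C X Y"
  by (induction fs) (auto simp: csum_simps zero_closed add_closed)

lemma csum_single: "f \<in> chom C X Y \<Longrightarrow> csum X Y [f] = f"
  by (simp add: csum_simps add_zero)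

lemma comp_csum:
  assumes "X \<in> cobj C" "set fs \<subseteq> chom C X Y" "h \<in> chom C Y Z"
  shows "ccomp C h (csum X Y fs) = csum X Z (map (ccomp C h) fs)"
  using assms(2)
proof (induction fs)
  case Nil
  show ?case using assms comp_zero_left by (simp add: csum_simps)
next
  case (Cons f fs)
  then show ?case
    using assms chom_objs[OF assms(3)] comp_add_left[OF _ csum_closed] by (simp add: csum_simps)
qed

lemma csum_comp:
  assumes "Z \<in> cobj C" "set fs \<subseteq> chom C Y Z" "h \<in> chom C X Y"
  shows "ccomp C (csum Y Z fs) h = csum X Z (map (\<lambda>f. ccomp C f h) fs)"
  using assms(2)
proof (induction fs)
  case Nil
  show ?case using assms comp_zero_right by (simp add: csum_simps)
next
  case (Cons f fs)
  then show ?case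
    using assms chom_objs[OF assms(3)] comp_add_right[OF assms(3) _ csum_closed] by (simp add: csum_simps)
qed

text \<open>Summands of the two kinds may alternate in the list, which is where commutativity of
  addition enters.\<close>

lemma csum_filter_disjoint:
  assumes "X \<in> cobj C" "Y \<in> cobj C" "\<And>x. x \<in> set xs \<Longrightarrow> g x \<in> chom C X Y" "\<And>x. \<not> (P x \<and> Q x)"
  shows "cadd C (csum X Y (map g (filter P xs))) (csum X Y (map g (filter Q xs)))
    = csum X Y (map g (filter (\<lambda>x. P x \<or> Q x) xs))"
  using assms(3)
proof (induction xs)
  case Nil
  show ?case using assms(1,2) by (simp add: csum_simps zero_add zero_closed)
next
  case (Cons x xs)
  let ?p = "csum X Y (map g (filter P xs))" and ?q = "csum X Y (map g (filter Q xs))"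
  have x: "g x \<in> chom C X Y" and p: "?p \<in> chom C X Y" and q: "?q \<in> chom C X Y"
    using Cons.prems assms(1,2) by (auto intro!: csum_closed)
  \<comment> \<open>For the case that \<open>x\<close> satisfies \<open>Q\<close>: its summand has
    to move past those selected by \<open>P\<close>.\<close>
  have "cadd C ?p (cadd C (g x) ?q) = cadd C (g x) (cadd C ?p ?q)"
    using add_assoc[OF p x q] add_assoc[OF x p q] add_commute[OF x p] by simp
  then show ?case
    using Cons assms(4)[of x] add_assoc[OF x p q] by (auto simp: csum_simps)
qed

text \<open>Regroups a sum by the values of \<open>h\<close>; with the place of a summand as
  \<open>h\<close>, this yields the functoriality of the action.\<close>

lemma csum_csum_filter:
  assumes "X \<in> cobj C" "Y \<in> cobj C" "\<And>x. x \<in> set xs \<Longrightarrow> g x \<in> chom C X Y" "distinct js"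
  shows "csum X Y (map (\<lambda>j. csum X Y (map g (filter (\<lambda>x. h x = j) xs))) js)
    = csum X Y (map g (filter (\<lambda>x. h x \<in> set js) xs))"
  using assms(4)
proof (induction js)
  case (Cons j js)
  then show ?case
    using csum_filter_disjoint[OF assms(1-3), where P = "\<lambda>x. h x = j" and Q = "\<lambda>x. h x \<in> set js"]
    by (auto simp: csum_simps)
qed (simp add: csum_simps)

text \<open>Push-forward along \<open>\<sigma>\<close>: identified places are added, and a place
  outside the image receives zero. The zero depends on its source and target, hence the arguments
  \<open>Bs\<close> and \<open>X\<close>.\<close>

definition act_tuple :: "nat list \<Rightarrow> 'o list \<Rightarrow> 'o \<Rightarrow> 'a list \<Rightarrow> 'a list" where
  "act_tuple \<sigma> Bs X fs = map (\<lambda>j. csum (Bs ! j) X (fiber \<sigma> fs j)) [0..<length Bs]"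

definition seq_cartesian :: "('o, 'o \<times> 'a list) act_multicat" where
  "seq_cartesian = multicat.extend (seq_multicat C)
     (act_multicat.fields (\<lambda>\<sigma> Bs f. (fst f, act_tuple \<sigma> Bs (fst f) (snd f))))"

lemma seq_cartesian_simps:
  "mobj seq_cartesian = cobj C" "marr seq_cartesian = marr (seq_multicat C)"
  "msrc seq_cartesian = msrc (seq_multicat C)" "mtgt seq_cartesian = mtgt (seq_multicat C)"
  "mid seq_cartesian = mid (seq_multicat C)" "mcomp seq_cartesian = mcomp (seq_multicat C)"
  "mact seq_cartesian \<sigma> Bs f = (fst f, act_tuple \<sigma> Bs (fst f) (snd f))"
  by (simp_all add: seq_cartesian_def multicat.defs act_multicat.defs seq_multicat_def)

lemma composable_seq_cartesian: "composable seq_cartesian = composable (seq_multicat C)"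
  by (simp add: fun_eq_iff composable_def seq_cartesian_simps)

text \<open>Typing entry by entry, the form suited to sums over fibers.\<close>

definition act_ok :: "nat list \<Rightarrow> 'o list \<Rightarrow> 'o \<Rightarrow> 'a list \<Rightarrow> bool" where
  "act_ok \<sigma> Bs X fs \<longleftrightarrow> X \<in> cobj C \<and> set Bs \<subseteq> cobj C \<and>
    list_all2 (\<lambda>s f. s < length Bs \<and> f \<in> chom C (Bs ! s) X) \<sigma> fs"

lemma actable_seq_cartesian: "actable seq_cartesian \<sigma> Bs (X, fs) \<longleftrightarrow> act_ok \<sigma> Bs X fs"
proof -
  have "set \<sigma> \<subseteq> {..<length Bs} \<and> map ((!) Bs) \<sigma> = map (csrc C) fs \<and> (\<forall>f\<in>set fs. f \<in> carr C \<and> ctgt C f = X) \<longleftrightarrow>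
    list_all2 (\<lambda>s f. s < length Bs \<and> f \<in> chom C (Bs ! s) X) \<sigma> fs"
  proof (induction \<sigma> arbitrary: fs)
    case (Cons s \<sigma>)
    then show ?case by (cases fs) (auto simp: chom_def)
  qed auto
  then show ?thesis
    by (auto simp: actable_def act_ok_def reindexes_def seq_cartesian_simps seq_multicat_simps)
qed

lemma act_okD:
  assumes "act_ok \<sigma> Bs X fs"
  shows "X \<in> cobj C" "set Bs \<subseteq> cobj C" "length \<sigma> = length fs" "set \<sigma> \<subseteq> {..<length Bs}"
    "set (fiber \<sigma> fs j) \<subseteq> chom C (Bs ! j) X"
    "p \<in> set (zip \<sigma> fs) \<Longrightarrow> fst p < length Bs \<and> snd p \<in> chom C (Bs ! fst p) X"
proof -
  have l: "list_all2 (\<lambda>s f. s < length Bs \<and> f \<in> chom C (Bs ! s) X) \<sigma> fs"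
    using assms by (simp add: act_ok_def)
  show "X \<in> cobj C" "set Bs \<subseteq> cobj C" "length \<sigma> = length fs"
    using assms by (auto simp: act_ok_def list_all2_lengthD)
  show *: "fst p < length Bs \<and> snd p \<in> chom C (Bs ! fst p) X" if "p \<in> set (zip \<sigma> fs)" for p
    using l that by (auto simp: list_all2_iff)
  then show "set (fiber \<sigma> fs j) \<subseteq> chom C (Bs ! j) X"
    by (auto simp: fiber_def)
  show "set \<sigma> \<subseteq> {..<length Bs}"
    using l by (auto simp: list_all2_conv_all_nth set_conv_nth)
qed

section \<open>Laws of the action on tuples\<close>

lemma act_tuple_closed:
  assumes "act_ok \<sigma> Bs X fs" "j < length Bs"
  shows "act_tuple \<sigma> Bs X fs ! j \<in> chom C (Bs ! j) X"
  using act_okD(1,2,5)[OF assms(1)] assms(2) by (auto simp: act_tuple_def intro!: csum_closed)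

lemma length_act_tuple: "length (act_tuple \<sigma> Bs X fs) = length Bs"
  by (simp add: act_tuple_def)

lemma act_tuple_id:
  assumes "\<forall>f\<in>set fs. f \<in> carr C \<and> ctgt C f = X"
  shows "act_tuple [0..<length fs] (map (csrc C) fs) X fs = fs"
proof (rule nth_equalityI)
  fix j assume "j < length (act_tuple [0..<length fs] (map (csrc C) fs) X fs)"
  then have j: "j < length fs"
    by (simp add: act_tuple_def)
  have "fiber [0..<length fs] fs j = fiber (map (\<lambda>i. i) [0..<length fs]) (map ((!) fs) [0..<length fs]) j"
    by (simp add: map_nth)
  also have "\<dots> = [fs ! j]"
    unfolding fiber_map using j by (simp add: filter_upt_eq)
  finally show "act_tuple [0..<length fs] (map (csrc C) fs) X fs ! j = fs ! j"
    using j assms by (simp add: act_tuple_def csum_single chom_def)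
qed (simp add: act_tuple_def)

text \<open>The fiber of the composite over \<open>l\<close> is the disjoint union of the fibers of
  \<open>\<sigma>\<close> over the places that \<open>\<rho>\<close> sends to \<open>l\<close>; the
  sum is regrouped accordingly.\<close>

lemma act_tuple_act_tuple:
  assumes ok: "act_ok \<sigma> Bs X fs" and Ds: "set Ds \<subseteq> cobj C" and \<rho>: "reindexes \<rho> Bs Ds"
  shows "act_tuple \<rho> Ds X (act_tuple \<sigma> Bs X fs) = act_tuple (map ((!) \<rho>) \<sigma>) Ds X fs"
proof (rule nth_equalityI)
  fix l assume "l < length (act_tuple \<rho> Ds X (act_tuple \<sigma> Bs X fs))"
  then have l: "l < length Ds"
    by (simp add: length_act_tuple)
  have len: "length \<rho> = length Bs"
    using \<rho> by (rule length_reindexes)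
  have Bs: "Bs ! j = Ds ! (\<rho> ! j)" if "j < length Bs" for j
    using \<rho> that nth_map[of j \<rho> "(!) Ds"] by (simp add: reindexes_def len)
  define js where "js = filter (\<lambda>j. \<rho> ! j = l) [0..<length Bs]"
  let ?Z = "Ds ! l" and ?xs = "filter (\<lambda>p. \<rho> ! fst p = l) (zip \<sigma> fs)"
  have Z: "?Z \<in> cobj C"
    using Ds l by auto
  have "fiber \<rho> (act_tuple \<sigma> Bs X fs) l
    = fiber (map ((!) \<rho>) [0..<length Bs]) (map (\<lambda>j. csum (Bs ! j) X (fiber \<sigma> fs j)) [0..<length Bs]) l"
    by (simp add: act_tuple_def len[symmetric] map_nth)
  also have "\<dots> = map (\<lambda>j. csum ?Z X (map snd (filter (\<lambda>p. fst p = j) ?xs))) js"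
    unfolding fiber_map js_def
  proof (intro map_cong refl)
    fix j assume j: "j \<in> set (filter (\<lambda>j. \<rho> ! j = l) [0..<length Bs])"
    then have "filter (\<lambda>p. fst p = j) ?xs = filter (\<lambda>p. fst p = j) (zip \<sigma> fs)"
      by (auto intro: filter_cong)
    then show "csum (Bs ! j) X (fiber \<sigma> fs j) = csum ?Z X (map snd (filter (\<lambda>p. fst p = j) ?xs))"
      using j Bs by (simp add: fiber_def)
  qed
  also have "csum ?Z X \<dots> = csum ?Z X (map snd (filter (\<lambda>p. fst p \<in> set js) ?xs))"
  proof (rule csum_csum_filter[OF Z act_okD(1)[OF ok]])
    show "snd p \<in> chom C ?Z X" if "p \<in> set ?xs" for p
      using that act_okD(6)[OF ok, of p] Bs[of "fst p"] by auto
  qed (simp add: js_def)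
  also have "filter (\<lambda>p. fst p \<in> set js) ?xs = ?xs"
    using act_okD(6)[OF ok] by (auto simp: js_def intro!: filter_cong)
  also have "map snd ?xs = fiber (map ((!) \<rho>) \<sigma>) fs l"
    by (simp add: fiber_def zip_map1 filter_map o_def case_prod_unfold)
  finally show "act_tuple \<rho> Ds X (act_tuple \<sigma> Bs X fs) ! l = act_tuple (map ((!) \<rho>) \<sigma>) Ds X fs ! l"
    using l by (simp add: act_tuple_def[of _ Ds])
qed (simp add: length_act_tuple)

text \<open>Places of the second part are shifted beyond those of the first, so each fiber comes
  from one part only.\<close>

lemma act_tuple_append:
  assumes "length \<sigma> = length fs" "set \<sigma> \<subseteq> {..<length Bs}"
  shows "act_tuple (\<sigma> @ map ((+) (length Bs)) \<rho>) (Bs @ Ds) X (fs @ gs) = act_tuple \<sigma> Bs X fs @ act_tuple \<rho> Ds X gs"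
proof (rule nth_equalityI)
  fix j assume "j < length (act_tuple (\<sigma> @ map ((+) (length Bs)) \<rho>) (Bs @ Ds) X (fs @ gs))"
  then have j: "j < length Bs + length Ds"
    by (simp add: length_act_tuple)
  show "act_tuple (\<sigma> @ map ((+) (length Bs)) \<rho>) (Bs @ Ds) X (fs @ gs) ! j = (act_tuple \<sigma> Bs X fs @ act_tuple \<rho> Ds X gs) ! j"
  proof (cases "j < length Bs")
    case True
    then have "fiber (map ((+) (length Bs)) \<rho>) gs j = []"
      by (intro fiber_eq_Nil) auto
    with True j show ?thesis
      by (simp add: act_tuple_def nth_append fiber_append[OF assms(1)])
  next
    case False
    then obtain l where l: "j = length Bs + l"
      using le_Suc_ex not_less by blast
    have "fiber \<sigma> fs j = []"
      using False assms(2) by (intro fiber_eq_Nil) auto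
    with l j show ?thesis
      by (simp add: act_tuple_def nth_append fiber_append[OF assms(1)] fiber_shift)
  qed
qed (simp add: length_act_tuple)

lemma comp_act_tuple:
  assumes ok: "act_ok \<sigma> Bs Y fs" and k: "k \<in> chom C Y X"
  shows "map (ccomp C k) (act_tuple \<sigma> Bs Y fs) = act_tuple \<sigma> Bs X (map (ccomp C k) fs)"
  using act_okD(2,5)[OF ok] k by (auto simp: act_tuple_def fiber_map_right intro!: comp_csum)

text \<open>Postcomposition preserves the sums within each block and the blocks do not interact, so
  the induction adds one block at a time.\<close>

lemma act_tuple_juxtapose:
  assumes "length fs = length ks" "length \<sigma>s = length ks" "length Bss = length ks"
    and "\<forall>i<length ks. ks ! i \<in> chom C (fst (fs ! i)) X \<and> act_ok (\<sigma>s ! i) (Bss ! i) (fst (fs ! i)) (snd (fs ! i))"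
  shows "concat (map (\<lambda>i. map (ccomp C (ks ! i)) (act_tuple (\<sigma>s ! i) (Bss ! i) (fst (fs ! i)) (snd (fs ! i)))) [0..<length ks])
    = act_tuple (juxtapose (zip \<sigma>s (map length Bss))) (concat Bss) X
        (concat (map2 (\<lambda>k g. map (ccomp C k) (snd g)) ks fs))"
proof -
  have "length ks = length fs" "length fs = length \<sigma>s" "length \<sigma>s = length Bss"
    using assms by simp_all
  then show ?thesis
    using assms(4)
  proof (induction ks fs \<sigma>s Bss rule: list_induct4)
    case (Cons k ks f fs \<sigma> \<sigma>s Bs Bss)
    have k: "k \<in> chom C (fst f) X" and ok: "act_ok \<sigma> Bs (fst f) (snd f)"
      using Cons.prems by fastforce+
    have "\<forall>i<length ks. ks ! i \<in> chom C (fst (fs ! i)) X \<and> act_ok (\<sigma>s ! i) (Bss ! i) (fst (fs ! i)) (snd (fs ! i))"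
      using Cons.prems by fastforce
    then have IH: "concat (map (\<lambda>i. map (ccomp C (ks ! i)) (act_tuple (\<sigma>s ! i) (Bss ! i) (fst (fs ! i)) (snd (fs ! i)))) [0..<length ks])
      = act_tuple (juxtapose (zip \<sigma>s (map length Bss))) (concat Bss) X
          (concat (map2 (\<lambda>k g. map (ccomp C k) (snd g)) ks fs))"
      using Cons.IH Cons.hyps by simp
    then show ?case
      using comp_act_tuple[OF ok k] act_okD(3,4)[OF ok]
      by (simp add: upt_conv_Cons map_Suc_upt[symmetric] o_def act_tuple_append del: upt_Suc)
  qed (auto simp: act_tuple_def)
qed

text \<open>At place \<open>k\<close> of block \<open>j\<close> both sides combine the arrows over
  \<open>j\<close> with entry \<open>k\<close> of \<open>gs ! j\<close>; \<open>csum_comp\<close>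
  exchanges the sum with the composition.\<close>

lemma act_tuple_comp:
  assumes ok: "act_ok \<sigma> Bs X fs" and gs: "set gs \<subseteq> marr (seq_multicat C)" "map fst gs = Bs"
  shows "concat (map2 (\<lambda>a g. map (ccomp C a) (snd g)) (act_tuple \<sigma> Bs X fs) gs)
    = act_tuple (block_map \<sigma> (map (length \<circ> snd) gs)) (concat (map (map (csrc C) \<circ> snd) gs)) X
        (concat (map2 (\<lambda>f g. map (ccomp C f) (snd g)) fs (map ((!) gs) \<sigma>)))"
proof -
  let ?ls = "map (length \<circ> snd) gs" and ?As = "concat (map (map (csrc C) \<circ> snd) gs)"
  let ?hs = "concat (map2 (\<lambda>f g. map (ccomp C f) (snd g)) fs (map ((!) gs) \<sigma>))"
  have m: "length Bs = length gs"
    using gs(2) by auto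
  have \<sigma>: "set \<sigma> \<subseteq> {..<length (map snd gs)}"
    using act_okD(4)[OF ok] by (simp add: m)
  have ls: "?ls = map length (map snd gs)"
    by simp
  have hs: "?hs = concat (map2 (\<lambda>f xs. map (ccomp C f) xs) fs (map ((!) (map snd gs)) \<sigma>))"
    using \<sigma> by (simp add: map_nth_map zip_map2 o_def case_prod_unfold del: map_map) (simp add: zip_map2 o_def case_prod_unfold)
  have place: "csum (?As ! (sum_list (take j ?ls) + k)) X (fiber (block_map \<sigma> ?ls) ?hs (sum_list (take j ?ls) + k))
    = ccomp C (csum (Bs ! j) X (fiber \<sigma> fs j)) (snd (gs ! j) ! k)" if j: "j < length gs" "k < length (snd (gs ! j))" for j k
  proof -
    have A: "?As ! (sum_list (take j ?ls) + k) = csrc C (snd (gs ! j) ! k)"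
      using nth_concat_offset[of j "map (map (csrc C) \<circ> snd) gs" k] j by (simp add: o_def)
    have "gs ! j \<in> marr (seq_multicat C)" "fst (gs ! j) = Bs ! j"
      using gs j by auto
    then have h: "snd (gs ! j) ! k \<in> chom C (csrc C (snd (gs ! j) ! k)) (Bs ! j)"
      using j(2) by (cases "gs ! j") (simp add: seq_multicat_simps(2) chom_def)
    have "fiber (block_map \<sigma> ?ls) ?hs (sum_list (take j ?ls) + k) = map (\<lambda>f. ccomp C f (snd (gs ! j) ! k)) (fiber \<sigma> fs j)"
      using fiber_block_map[OF act_okD(3)[OF ok] \<sigma>, of j k "ccomp C"] j unfolding ls hs by simp
    then show ?thesis
      using csum_comp[OF act_okD(1)[OF ok] act_okD(5)[OF ok] h] A by simp
  qed
  have "length ?As = sum_list ?ls"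
    by (simp add: length_concat o_def)
  \<comment> \<open>The places are grouped into blocks so that \<open>place\<close> applies to each
    of them.\<close>
  then have upt: "[0..<length ?As] = concat (map (\<lambda>j. map (\<lambda>k. sum_list (take j ?ls) + k) [0..<?ls ! j]) [0..<length gs])"
    using block_map_upt[of ?ls] by (simp add: block_map_def)
  have "act_tuple (block_map \<sigma> ?ls) ?As X ?hs
    = concat (map (\<lambda>j. map (\<lambda>k. csum (?As ! (sum_list (take j ?ls) + k)) X
        (fiber (block_map \<sigma> ?ls) ?hs (sum_list (take j ?ls) + k))) [0..<?ls ! j]) [0..<length gs])"
    unfolding act_tuple_def upt by (simp add: map_concat o_def)
  also have "\<dots> = concat (map (\<lambda>j. map (ccomp C (csum (Bs ! j) X (fiber \<sigma> fs j))) (snd (gs ! j))) [0..<length gs])"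
    using place by (intro arg_cong[where f = concat] map_cong refl nth_equalityI) simp_all
  also have "map (\<lambda>j. map (ccomp C (csum (Bs ! j) X (fiber \<sigma> fs j))) (snd (gs ! j))) [0..<length gs]
    = map2 (\<lambda>a g. map (ccomp C a) (snd g)) (act_tuple \<sigma> Bs X fs) gs"
    by (intro nth_equalityI) (simp_all add: act_tuple_def m)
  finally show ?thesis by (simp add: o_def)
qed

text \<open>The axioms on composition express its bilinearity: \<open>comp_act_args\<close> rests on
  \<open>comp_add_left\<close> and \<open>comp_zero_left\<close>, \<open>comp_act_fun\<close> on
  \<open>comp_add_right\<close> and \<open>comp_zero_right\<close>.\<close>

lemma cartesian_seq_cartesian: "cartesian_multicategory seq_cartesian"
proof -
  interpret S: multicategory "seq_multicat C" by (rule multicategory_seq_multicat)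
  have "multicategory seq_cartesian"
    using S.multicategory_axioms unfolding multicategory_def seq_cartesian_simps composable_seq_cartesian
    by (simp only: seq_multicat_simps(1))
  moreover have "cartesian_multicategory_axioms seq_cartesian"
  proof
    fix \<sigma> Bs f assume act: "actable seq_cartesian \<sigma> Bs f"
    obtain X fs where f: "f = (X, fs)" by fastforce
    have ok: "act_ok \<sigma> Bs X fs"
      using act by (simp add: f actable_seq_cartesian)
    have nth: "act_tuple \<sigma> Bs X fs ! j \<in> carr C \<and> csrc C (act_tuple \<sigma> Bs X fs ! j) = Bs ! j \<and>
        ctgt C (act_tuple \<sigma> Bs X fs ! j) = X" if "j < length Bs" for j
      using act_tuple_closed[OF ok that] by (simp add: chom_def)
    then have "\<forall>a\<in>set (act_tuple \<sigma> Bs X fs). a \<in> carr C \<and> ctgt C a = X"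
      by (auto simp: in_set_conv_nth length_act_tuple)
    then show "mact seq_cartesian \<sigma> Bs f \<in> marr seq_cartesian"
      using act_okD(1)[OF ok] by (simp add: f seq_cartesian_simps seq_multicat_simps(2))
    show "msrc seq_cartesian (mact seq_cartesian \<sigma> Bs f) = Bs"
      using nth by (auto simp: f seq_cartesian_simps seq_multicat_simps(3) length_act_tuple intro!: nth_equalityI)
    show "mtgt seq_cartesian (mact seq_cartesian \<sigma> Bs f) = mtgt seq_cartesian f"
      by (simp add: seq_cartesian_simps seq_multicat_simps(4))
  next
    fix f assume "f \<in> marr seq_cartesian"
    then show "mact seq_cartesian [0..<length (msrc seq_cartesian f)] (msrc seq_cartesian f) f = f"
      using act_tuple_id[of "snd f" "fst f"]
      by (cases f) (simp add: seq_cartesian_simps seq_multicat_simps(2,3))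
  next
    fix \<sigma> Bs f Ds \<rho>
    assume "actable seq_cartesian \<sigma> Bs f" "set Ds \<subseteq> mobj seq_cartesian" "reindexes \<rho> Bs Ds"
    then show "mact seq_cartesian \<rho> Ds (mact seq_cartesian \<sigma> Bs f) = mact seq_cartesian (map ((!) \<rho>) \<sigma>) Ds f"
      by (cases f) (simp add: actable_seq_cartesian act_tuple_act_tuple seq_cartesian_simps)
  next
    fix f fs \<sigma>s Bss
    assume c: "composable seq_cartesian f fs" and len: "length \<sigma>s = length fs" "length Bss = length fs"
      and act: "\<forall>i<length fs. actable seq_cartesian (\<sigma>s ! i) (Bss ! i) (fs ! i)"
    obtain X ks where f: "f = (X, ks)" by fastforce
    have lk: "length fs = length ks"
      using c by (auto simp: f composable_seq_cartesian composable_seq_multicat dest: list_all2_lengthD)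
    have "ks ! i \<in> chom C (fst (fs ! i)) X" if "i < length ks" for i
      using c that by (simp add: f composable_seq_cartesian composable_seq_multicat seq_multicat_simps(2)
          list_all2_conv_all_nth chom_def)
    moreover have "act_ok (\<sigma>s ! i) (Bss ! i) (fst (fs ! i)) (snd (fs ! i))" if "i < length ks" for i
      using act that lk by (metis actable_seq_cartesian prod.collapse)
    ultimately have eq: "concat (map (\<lambda>i. map (ccomp C (ks ! i)) (act_tuple (\<sigma>s ! i) (Bss ! i) (fst (fs ! i)) (snd (fs ! i)))) [0..<length ks])
      = act_tuple (juxtapose (zip \<sigma>s (map length Bss))) (concat Bss) X
          (concat (map2 (\<lambda>k g. map (ccomp C k) (snd g)) ks fs))"
      using lk len by (intro act_tuple_juxtapose) simp_all
    have "map2 (\<lambda>k g. map (ccomp C k) (snd g)) ks (map (\<lambda>i. mact seq_cartesian (\<sigma>s ! i) (Bss ! i) (fs ! i)) [0..<length fs])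
      = map (\<lambda>i. map (ccomp C (ks ! i)) (act_tuple (\<sigma>s ! i) (Bss ! i) (fst (fs ! i)) (snd (fs ! i)))) [0..<length ks]"
      by (intro nth_equalityI) (simp_all add: lk seq_cartesian_simps(7))
    then show "mcomp seq_cartesian f (map (\<lambda>i. mact seq_cartesian (\<sigma>s ! i) (Bss ! i) (fs ! i)) [0..<length fs])
      = mact seq_cartesian (juxtapose (zip \<sigma>s (map length Bss))) (concat Bss) (mcomp seq_cartesian f fs)"
      using eq by (simp add: f seq_cartesian_simps(6) seq_multicat_simps(6)) (simp add: seq_cartesian_simps(7))
  next
    fix \<sigma> Bs f fs
    assume act: "actable seq_cartesian \<sigma> Bs f" and fs: "set fs \<subseteq> marr seq_cartesian" "map (mtgt seq_cartesian) fs = Bs"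
    obtain X ks where f: "f = (X, ks)" by fastforce
    have ok: "act_ok \<sigma> Bs X ks"
      using act by (simp add: f actable_seq_cartesian)
    have src: "msrc (seq_multicat C) = map (csrc C) \<circ> snd"
      by (simp add: fun_eq_iff seq_multicat_simps(3))
    show "mcomp seq_cartesian (mact seq_cartesian \<sigma> Bs f) fs
      = mact seq_cartesian (block_map \<sigma> (map (length \<circ> msrc seq_cartesian) fs)) (concat (map (msrc seq_cartesian) fs))
          (mcomp seq_cartesian f (map ((!) fs) \<sigma>))"
      using act_tuple_comp[OF ok, of fs] fs
      by (simp add: f seq_cartesian_simps seq_multicat_simps(4,6) src o_def)
  qed
  ultimately show ?thesis
    by (rule cartesian_multicategory.intro)
qed

text \<open>Monoids carry no further information here, as each object has only the canonical one,
  and unary arrows are tuples with a single entry. What remains is the agreement of the two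
  sums.\<close>

lemma preadd_isomorphic_cMon: "preadd_isomorphic C (cMon seq_cartesian)"
proof -
  note C_closed = src_closed tgt_closed and C_id_comp = id_comp
  let ?M = seq_cartesian and ?I = "id_fctr (seq_multicat C)"
  interpret cartesian_multicategory ?M by (rule cartesian_seq_cartesian)
  interpret S: multicategory "seq_multicat C" by (rule multicategory_seq_multicat)
  \<comment> \<open>\<open>seq_cartesian\<close> has the arrows of \<open>seq_multicat C\<close>, so
    identity functors serve as the comparison and the results on sequential cartesian
    multicategories apply.\<close>
  have "multifunctor ?M (seq_multicat C) ?I" "multifunctor (seq_multicat C) ?M ?I"
    using S.src_closed S.tgt_closed S.id_closed S.comp_closed
    by (auto simp: multifunctor_def composable_seq_cartesian seq_cartesian_simps id_fctr_def seq_multicat_simps(1)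
        composable_def subset_iff intro!: map_idI[symmetric] arg_cong[where f = "mcomp (seq_multicat C) _"])
  then interpret sequential_cartesian_multicategory ?M C ?I ?I
    by unfold_locales (auto simp: comp_fctr_def id_fctr_def compose_def seq_cartesian_simps seq_multicat_simps(1) fun_eq_iff)
  let ?D = "cMon ?M"
  have arr_iff: "(B, [a]) \<in> marr ?M \<and> msrc ?M (B, [a]) = [A] \<longleftrightarrow> a \<in> chom C A B" for A B a
    using C_closed by (auto simp: seq_cartesian_simps seq_multicat_simps(2,3) chom_def)
  have diag: "diag B n = (B, replicate n (cid C B))" if "B \<in> cobj C" for B n
    unfolding diag_def using that id_hom[OF that] by (simp add: id_fctr_def seq_multicat_simps(1,2) chom_def)
  \<comment> \<open>Every arrow of \<open>?M\<close> is an arrow between canonical monoids, in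
    particular every operation of \<open>Y\<close>; the Eckmann-Hilton argument applies.\<close>
  have unique: "Y = canonical (under_obj Y)" if Y: "Y \<in> mobj (cmonoids ?M)" for Y
  proof (rule cmonoid_unique[OF canonical_cmonoid[OF cmonoidD(1)[OF Y]] Y])
    show "(replicate n (canonical (under_obj Y)), canonical (under_obj Y), str_arr Y n) \<in> marr (cmonoids ?M)" for n
      using canonical_commutes[OF cmonoidD(2)[OF Y, of n]] cmonoidD(3,4)[OF Y] by simp
  qed (simp add: canonical_simps)
  define F where "F = \<lparr>fobj = restrict canonical (cobj C),
    farr = (\<lambda>a\<in>carr C. ([canonical (csrc C a)], canonical (ctgt C a), (ctgt C a, [a])))\<rparr>"
  have obj: "fobj F X = canonical X" if "X \<in> cobj C" for X
    using that by (simp add: F_def)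
  have arr: "farr F a = ([canonical A], canonical B, (B, [a]))" if "a \<in> chom C A B" for a A B
    using that by (simp add: F_def chom_def)
  have cm: "canonical X \<in> mobj (cmonoids ?M)" if "X \<in> cobj C" for X
    using canonical_cmonoid that by (simp add: seq_cartesian_simps)
  have hom: "([canonical A], canonical B, (B, [a])) \<in> marr (cmonoids ?M)" if "a \<in> chom C A B" for a A B
    using canonical_commutes[of "(B, [a])"] that arr_iff[of B a A] by (simp add: seq_cartesian_simps seq_multicat_simps(4))
  \<comment> \<open>Composing a tuple of identities with single-entry tuples lists the summands, and
    the contraction adds this list up, since the fiber of a constant mapping is the whole
    list.\<close>
  have sum: "hom_sum (canonical A) (canonical B) (map (\<lambda>a. (B, [a])) as) = (B, [csum A B as])"
    if "A \<in> cobj C" "B \<in> cobj C" "set as \<subseteq> chom C A B" for A B as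
  proof -
    have "map2 (\<lambda>f g. map (ccomp C f) (snd g)) (replicate (length as) (cid C B)) (map (\<lambda>a. (B, [a])) as) = map (\<lambda>a. [a]) as"
      by (intro nth_equalityI) (simp_all add: C_id_comp[OF subsetD[OF that(3) nth_mem]])
    then have "mcomp ?M (diag B (length as)) (map (\<lambda>a. (B, [a])) as) = (B, as)"
      by (simp add: diag that seq_cartesian_simps seq_multicat_simps(6))
    moreover have "fiber (replicate (length as) 0) as 0 = as"
      by (induction as) (auto simp: fiber_def)
    ultimately show ?thesis
      by (simp add: hom_sum_def canonical_simps seq_cartesian_simps(7) act_tuple_def)
  qed
  have "additive_functor C ?D F"
    unfolding additive_functor_def
  proof (intro conjI allI ballI)
    show "fobj F \<in> cobj C \<rightarrow>\<^sub>E cobj ?D"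
      using cm by (auto simp: F_def cMon_simps)
    show "farr F \<in> carr C \<rightarrow>\<^sub>E carr ?D"
      using hom by (auto simp: F_def cMon_simps chom_def)
    show "csrc ?D (farr F a) = fobj F (csrc C a)" "ctgt ?D (farr F a) = fobj F (ctgt C a)" if "a \<in> carr C" for a
      using that C_closed by (auto simp: F_def cMon_simps)
    show "farr F (cid C X) = cid ?D (fobj F X)" if "X \<in> cobj C" for X
      using arr[OF id_hom[OF that]] that
      by (simp add: obj cMon_simps cmonoids_simps(5) canonical_simps seq_cartesian_simps seq_multicat_simps(5))
    show "farr F (ccomp C g f) = ccomp ?D (farr F g) (farr F f)" if "f \<in> chom C X Y" "g \<in> chom C Y Z" for f g X Y Z
      using arr[OF that(1)] arr[OF that(2)] arr[OF comp_hom[OF that]]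
      by (simp add: cMon_simps cmonoids_simps(6) seq_cartesian_simps seq_multicat_simps(6))
    show "farr F (czero C X Y) = czero ?D (fobj F X) (fobj F Y)" if "X \<in> cobj C" "Y \<in> cobj C" for X Y
      using arr[OF zero_closed[OF that]] sum[OF that, of "[]"] that
      by (simp add: obj cMon_simps cMon_sum_eq csum_simps)
    show "farr F (cadd C f g) = cadd ?D (farr F f) (farr F g)" if "f \<in> chom C X Y" "g \<in> chom C X Y" for f g X Y
      using arr[OF that(1)] arr[OF that(2)] arr[OF add_closed[OF that]] sum[of X Y "[f, g]"] that chom_objs[OF that(1)]
      by (simp add: cMon_simps cMon_sum_eq csum_simps add_zero)
  qed
  moreover have "bij_betw (fobj F) (cobj C) (cobj ?D)"
  proof (rule bij_betw_byWitness[where f' = under_obj])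
    show "\<forall>Y\<in>cobj ?D. fobj F (under_obj Y) = Y"
      using unique cmonoidD(1) by (simp add: cMon_simps obj seq_cartesian_simps(1))
    show "under_obj ` cobj ?D \<subseteq> cobj C"
      using cmonoidD(1) by (auto simp: cMon_simps seq_cartesian_simps(1))
  qed (auto simp: obj canonical_simps cMon_simps cm)
  moreover have "bij_betw (farr F) (carr C) (carr ?D)"
  proof (rule bij_betwI')
    show "(farr F a = farr F b) = (a = b)" if "a \<in> carr C" "b \<in> carr C" for a b
      using that by (auto simp: F_def)
    show "farr F a \<in> carr ?D" if "a \<in> carr C" for a
      using hom[of a] that by (auto simp: F_def cMon_simps chom_def)
    show "\<exists>a\<in>carr C. g = farr F a" if g: "g \<in> carr ?D" for g
    proof -
      obtain X Y \<alpha> where eq: "g = ([X], Y, \<alpha>)" and "([X], Y, \<alpha>) \<in> marr (cmonoids ?M)"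
        using g by (cases g) (auto simp: cMon_simps length_Suc_conv)
      note \<alpha> = this(2)[unfolded cmonoids_unary_iff]
      obtain B as where "\<alpha> = (B, as)" by fastforce
      with \<alpha> obtain a where a: "\<alpha> = (under_obj Y, [a])"
        by (auto simp: seq_cartesian_simps seq_multicat_simps(3,4))
      then have h: "a \<in> chom C (under_obj X) (under_obj Y)"
        using \<alpha> unfolding a arr_iff[symmetric] by blast
      then have "farr F a = g"
        using arr[OF h] unique \<alpha> by (simp add: eq a)
      then show ?thesis
        using h by (auto simp: chom_def)
    qed
  qed
  ultimately show ?thesis
    using category_cMon by (intro preadd_isomorphicI)
qed

end

text \<open>\<open>cmonoids M\<close> has other types than \<open>M\<close>, so the adjunction is
  spelled out: functoriality, a bijection of hom-sets given by the counit \<open>forget\<close>, and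
  its naturality in each variable. The hom-sets of \<open>fpMlt\<close> serve on both sides because
  \<open>fpSeq\<close> is a full subcategory.\<close>

theorem corollary4p19:
  shows "(\<forall>M :: ('o, 'a) act_multicat. fpMlt_obj M \<longrightarrow> fpSeq_obj (cmonoids M)) \<and>
    (\<forall>(M :: ('o, 'a) act_multicat) (N :: ('p, 'b) act_multicat).
      fpMlt_obj M \<and> fpMlt_obj N \<longrightarrow>
      (\<forall>F\<in>fpMlt_hom M N. cmonoids_map M F \<in> fpMlt_hom (cmonoids M) (cmonoids N))) \<and>
    (\<forall>M :: ('o, 'a) act_multicat. fpMlt_obj M \<longrightarrow>
      cmonoids_map M (id_fctr M) = id_fctr (cmonoids M)) \<and>
    (\<forall>(M :: ('o, 'a) act_multicat) (N :: ('p, 'b) act_multicat) (P :: ('q, 'c) act_multicat).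
      fpMlt_obj M \<and> fpMlt_obj N \<and> fpMlt_obj P \<longrightarrow>
      (\<forall>F\<in>fpMlt_hom M N. \<forall>G\<in>fpMlt_hom N P.
         cmonoids_map M (comp_fctr M G F) =
         comp_fctr (cmonoids M) (cmonoids_map N G) (cmonoids_map M F))) \<and>
    (\<forall>(S :: ('s, 'd) act_multicat) (M :: ('o, 'a) act_multicat).
      fpSeq_obj S \<and> fpMlt_obj M \<longrightarrow>
      bij_betw (comp_fctr S (forget M)) (fpMlt_hom S (cmonoids M)) (fpMlt_hom S M)) \<and>
    (\<forall>(S :: ('s, 'd) act_multicat) (T :: ('t, 'e) act_multicat) (M :: ('o, 'a) act_multicat).
      fpSeq_obj S \<and> fpSeq_obj T \<and> fpMlt_obj M \<longrightarrow>
      (\<forall>H\<in>fpMlt_hom T S. \<forall>G\<in>fpMlt_hom S (cmonoids M).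
         comp_fctr T (forget M) (comp_fctr T G H) =
         comp_fctr T (comp_fctr S (forget M) G) H)) \<and>
    (\<forall>(S :: ('s, 'd) act_multicat) (M :: ('o, 'a) act_multicat) (N :: ('p, 'b) act_multicat).
      fpSeq_obj S \<and> fpMlt_obj M \<and> fpMlt_obj N \<longrightarrow>
      (\<forall>F\<in>fpMlt_hom M N. \<forall>G\<in>fpMlt_hom S (cmonoids M).
         comp_fctr S (forget N) (comp_fctr S (cmonoids_map M F) G) =
         comp_fctr S F (comp_fctr S (forget M) G))) \<and>
    (\<forall>M :: ('o, 'a) act_multicat. fpMlt_obj M \<longrightarrow> preadditive_category (cMon M)) \<and>
    (\<forall>C :: ('o, 'a) preadd_cat. preadditive_category C \<longrightarrow>
      (\<exists>M :: ('o, 'o \<times> 'a list) act_multicat. fpMlt_obj M \<and> preadd_isomorphic C (cMon M)))"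
proof (intro conjI allI impI ballI)
  fix M :: "('o, 'a) act_multicat" assume "fpMlt_obj M"
  then interpret plain_cartesian_multicategory M
    by (simp add: fpMlt_obj_def plain_cartesian_multicategory_def)
  show "fpSeq_obj (cmonoids M)"
    using cmonoids_cartesian sequential_cmonoids by (simp add: fpSeq_obj_def fpMlt_obj_def)
  show "cmonoids_map M (id_fctr M) = id_fctr (cmonoids M)"
    by (rule cmonoids_map_id)
  show "preadditive_category (cMon M)"
    by (rule preadditive_cMon)
next
  fix M :: "('o, 'a) act_multicat" and N :: "('p, 'b) act_multicat" and F
  assume MN: "fpMlt_obj M \<and> fpMlt_obj N" and F: "F \<in> fpMlt_hom M N"
  interpret plain_cartesian_multicategory M
    using MN by (simp add: fpMlt_obj_def plain_cartesian_multicategory_def)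
  show "cmonoids_map M F \<in> fpMlt_hom (cmonoids M) (cmonoids N)"
    using F cmonoids_map_cartesian by (simp add: fpMlt_hom_def)
next
  fix M :: "('o, 'a) act_multicat" and N :: "('p, 'b) act_multicat" and P :: "('q, 'c) act_multicat" and F G
  assume MNP: "fpMlt_obj M \<and> fpMlt_obj N \<and> fpMlt_obj P" and F: "F \<in> fpMlt_hom M N"
  interpret plain_cartesian_multicategory M
    using MNP by (simp add: fpMlt_obj_def plain_cartesian_multicategory_def)
  show "cmonoids_map M (comp_fctr M G F) = comp_fctr (cmonoids M) (cmonoids_map N G) (cmonoids_map M F)"
    using F by (intro cmonoids_map_comp) (simp add: fpMlt_hom_def)
next
  fix S :: "('s, 'd) act_multicat" and M :: "('o, 'a) act_multicat"
  assume SM: "fpSeq_obj S \<and> fpMlt_obj M"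
  then obtain C :: "('s, 'd) cat" and \<Phi> \<Psi> where "sequential_cartesian_multicategory S C \<Phi> \<Psi>"
    by (auto elim: sequential_cartesianE)
  then show "bij_betw (comp_fctr S (forget M)) (fpMlt_hom S (cmonoids M)) (fpMlt_hom S M)"
    using SM sequential_cartesian_multicategory.bij_forget by (auto simp: fpMlt_obj_def)
next
  fix S :: "('s, 'd) act_multicat" and T :: "('t, 'e) act_multicat" and M :: "('o, 'a) act_multicat" and H G
  assume "H \<in> fpMlt_hom T S"
  then show "comp_fctr T (forget M) (comp_fctr T G H) = comp_fctr T (comp_fctr S (forget M) G) H"
    by (intro comp_fctr_assoc) (simp add: fpMlt_hom_def cartesian_functor_def)
next
  fix S :: "('s, 'd) act_multicat" and M :: "('o, 'a) act_multicat" and N :: "('p, 'b) act_multicat" and F G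
  assume SMN: "fpSeq_obj S \<and> fpMlt_obj M \<and> fpMlt_obj N"
    and FG: "F \<in> fpMlt_hom M N" "G \<in> fpMlt_hom S (cmonoids M)"
  interpret plain_cartesian_multicategory M
    using SMN by (simp add: fpMlt_obj_def plain_cartesian_multicategory_def)
  show "comp_fctr S (forget N) (comp_fctr S (cmonoids_map M F) G) = comp_fctr S F (comp_fctr S (forget M) G)"
    using FG by (intro forget_natural) (simp_all add: fpMlt_hom_def cartesian_functor_def)
next
  fix C :: "('o, 'a) preadd_cat" assume "preadditive_category C"
  then interpret preadditive_category C .
  show "\<exists>M :: ('o, 'o \<times> 'a list) act_multicat. fpMlt_obj M \<and> preadd_isomorphic C (cMon M)"
    using cartesian_seq_cartesian preadd_isomorphic_cMon by (auto simp: fpMlt_obj_def)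
qed

end
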